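(* Let $\mathfrak{A}$ be a W$^*$-algebra with predual $\mathfrak{A}_*$, let $\mathscr{S}\subset \mathscr{L}(\mathfrak{A},\sigma^* )$ be a (norm-)bounded semigroup of $\sigma^*$-continuous linear operators on $\mathfrak{A}$, and let $\Phi\subset\mathfrak{A}_*$ be a faithful family of normal states on $\mathfrak{A}$ satisfying $$\langle\varphi,(Sx)^*(Sx)\rangle\le\langle\varphi,x^*x\rangle\qquad\text{for all } x\in\mathfrak{A},\ S\in\mathscr{S},\ \varphi\in\Phi.$$ Let $\mathbf{S}:=\overline{\mathscr{S}}^{\mathscr{L}_s(\mathfrak{A},\sigma^* )}$ be the closure of $\mathscr{S}$ in the weak$^*$ operator topology. Then $\mathbf{S}$ (with this topology) is a compact semitopological semigroup containing a unique minimal ideal $M(\mathbf{S})$, and $M(\mathbf{S})$ is a compact topological group with unit $P$. The projection $P$ induces a decomposition $\mathfrak{A}=\mathfrak{A}_r\oplus\mathfrak{A}_s$, where \begin{align*} \operatorname{ran}P=\mathfrak{A}_r&=\{x\in\mathfrak{A}:\ \text{for all } S\in\mathbf{S} \text{ there exists } T\in\mathbf{S} \text{ such that } TSx=x\}\\ &=\{x\in\mathfrak{A}:\ \langle\varphi,(Tx)^*(Tx)\rangle=\langle\varphi,x^*x\rangle \text{ for all } T\in\mathbf{S},\ \varphi\in\Phi\}\\ &=\{x\in\mathfrak{A}:\ \langle\varphi,(Tx)^*(Ty)\rangle=\langle\varphi,x^*y\rangle \text{ for all } T\in\mathbf{S},\ \varphi\in\Phi,\ y\in\mathfrak{A}\}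 \end{align*} and $$\operatorname{ker}P=\mathfrak{A}_s=\{x\in\mathfrak{A}:\ 0\in\mathbf{S}x\}=\Big\{x\in\mathfrak{A}:\ 0\in\overline{\{Tx:T\in\mathbf{S}\}}^{\,\sigma(\mathfrak{A},\mathfrak{A}_* )}\Big\}=\bigcup_{T\in\mathbf{S}}\operatorname{ker}T.$$
   Context: $\mathfrak{A}$ has unit $\mathbb{1}$ and positive cone $\mathfrak{A}^+$. The $\sigma^*$-topology on $\mathfrak{A}$ is $\sigma(\mathfrak{A},\mathfrak{A}_* )$. $\mathscr{L}(\mathfrak{A})$ is the space of bounded linear operators on $\mathfrak{A}$, and $\mathscr{L}(\mathfrak{A},\sigma^* )$ the subset of $\sigma^*$-continuous ones. A semigroup of operators is a set of operators closed under composition. For $\varphi\in\mathfrak{A}_*$, $\langle\varphi,x\rangle:=\varphi(x)$. A normal state is a positive $\varphi\in\mathfrak{A}_*$ with $\langle\varphi,\mathbb{1}\rangle=1$. A set $\Phi$ of positive normal linear forms is faithful if $x\in\mathfrak{A}^+$ and $\langle\varphi,x\rangle=0$ for all $\varphi\in\Phi$ imply $x=0$. The weak$^*$ operator topology on $\mathscr{L}(\mathfrak{A})$, denoted $\mathscr{L}_s(\mathfrak{A},\sigma^* )$, is the topology of pointwise convergence on $\mathfrak{A}$ endowed with the $\sigma(\mathfrak{A},\mathfrak{A}_* )$-topology; the closure of $\mathscr{S}$ is taken in $\mathscr{L}(\mathfrak{A})$. A semigroup with a topology is semitopological if its multiplication is separately continuous. $\mathbf{S}x=\{Tx:T\in\mathbf{S}\}$.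 A projection is an idempotent operator, $P^2=P$. An ideal is a two-sided ideal of the semigroup; minimal means minimal with respect to inclusion among (nonempty) ideals. *)

theory Defs
  imports
    "HOL-Analysis.Analysis"
    "HOL-Library.Complex_Order"
    "HOL-Algebra.Group"
begin

(* Complex normed spaces are real normed spaces carrying a compatible complex scaling.
   The operator norm of a complex-linear map agrees with its norm as a real-linear map,
   so bounded complex-linear maps are represented inside the library type of bounded
   real-linear maps. *)

class complex_normed_vector = real_normed_vector +
  fixes scaleC :: "complex \<Rightarrow> 'a \<Rightarrow> 'a"  (infixr "*\<^sub>C" 75)
  assumes scaleC_add_right: "c *\<^sub>C (x + y) = c *\<^sub>C x + c *\<^sub>C y"
    and scaleC_add_left: "(c + d) *\<^sub>C x = c *\<^sub>C x + d *\<^sub>C x"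
    and scaleC_scaleC: "c *\<^sub>C d *\<^sub>C x = (c * d) *\<^sub>C x"
    and scaleC_of_real: "complex_of_real r *\<^sub>C x = r *\<^sub>R x"
    and norm_scaleC: "norm (c *\<^sub>C x) = cmod c * norm x"

instantiation complex :: complex_normed_vector
begin

definition scaleC_complex :: "complex \<Rightarrow> complex \<Rightarrow> complex"
  where "scaleC_complex c x = c * x"

instance
  by standard (auto simp: scaleC_complex_def algebra_simps norm_mult scaleR_conv_of_real)

end

lemma bounded_linear_scaleC: "bounded_linear (\<lambda>x::'a::complex_normed_vector. c *\<^sub>C x)"
proof (rule bounded_linear_intro)
  fix x y :: 'a and r :: real
  show "c *\<^sub>C (x + y) = c *\<^sub>C x + c *\<^sub>C y"
    by (rule scaleC_add_right)
  show "c *\<^sub>C (r *\<^sub>R x) = r *\<^sub>R (c *\<^sub>C x)"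
    by (metis scaleC_of_real scaleC_scaleC mult.commute)
  show "norm (c *\<^sub>C x) \<le> norm x * cmod c"
    by (simp add: norm_scaleC mult.commute)
qed

instantiation blinfun :: (real_normed_vector, complex_normed_vector) complex_normed_vector
begin

lift_definition scaleC_blinfun :: "complex \<Rightarrow> 'a \<Rightarrow>\<^sub>L 'b \<Rightarrow> 'a \<Rightarrow>\<^sub>L 'b"
  is "\<lambda>c f x. c *\<^sub>C f x"
  by (rule bounded_linear_compose[OF bounded_linear_scaleC])

instance
proof
  fix c d :: complex and r :: real and f g :: "'a \<Rightarrow>\<^sub>L 'b"
  show "c *\<^sub>C (f + g) = c *\<^sub>C f + c *\<^sub>C g"
    by transfer (simp add: scaleC_add_right)
  show "(c + d) *\<^sub>C f = c *\<^sub>C f + d *\<^sub>C f"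
    by transfer (simp add: scaleC_add_left)
  show "c *\<^sub>C d *\<^sub>C f = (c * d) *\<^sub>C f"
    by transfer (simp add: scaleC_scaleC)
  show "complex_of_real r *\<^sub>C f = r *\<^sub>R f"
    by transfer (simp add: scaleC_of_real)
  show "norm (c *\<^sub>C f) = cmod c * norm f"
  proof (transfer fixing: c)
    fix f :: "'a \<Rightarrow> 'b"
    assume f: "bounded_linear f"
    show "onorm (\<lambda>x. c *\<^sub>C f x) = cmod c * onorm f"
      using onorm_scaleR[OF f, of "cmod c"] by (simp add: onorm_def norm_scaleC)
  qed
qed

end

definition csubspace :: "'a::complex_normed_vector set \<Rightarrow> bool"
  where "csubspace V \<longleftrightarrow>
    0 \<in> V \<and> (\<forall>x\<in>V. \<forall>y\<in>V. x + y \<in> V) \<and> (\<forall>c. \<forall>x\<in>V. c *\<^sub>C x \<in> V)"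

definition direct_sum_decomposition :: "'a::complex_normed_vector set \<Rightarrow> 'a set \<Rightarrow> bool"
  where "direct_sum_decomposition V W \<longleftrightarrow>
    csubspace V \<and> csubspace W \<and> V \<inter> W = {0} \<and> {v + w |v w. v \<in> V \<and> w \<in> W} = UNIV"

definition cblinfuns :: "('a::complex_normed_vector \<Rightarrow>\<^sub>L 'b::complex_normed_vector) set"
  where "cblinfuns = {T. \<forall>c x. blinfun_apply T (c *\<^sub>C x) = c *\<^sub>C T x}"

(* Unital C*-algebras; the sort monoid_mult provides the unit without
   excluding the zero algebra. *)

class cstar_algebra = complex_normed_vector + real_normed_algebra + monoid_mult + banach +
  fixes adj :: "'a \<Rightarrow> 'a"
  assumes scaleC_mult_left: "(c *\<^sub>C x) * y = c *\<^sub>C (x * y)"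
    and scaleC_mult_right: "x * (c *\<^sub>C y) = c *\<^sub>C (x * y)"
    and adj_adj: "adj (adj x) = x"
    and adj_add: "adj (x + y) = adj x + adj y"
    and adj_scaleC: "adj (c *\<^sub>C x) = cnj c *\<^sub>C adj x"
    and adj_mult: "adj (x * y) = adj y * adj x"
    and cstar_identity: "norm (adj x * x) = (norm x)\<^sup>2"

definition positive_cone :: "'a::cstar_algebra set"
  where "positive_cone = {adj y * y |y. True}"

(* A W*-algebra is a C*-algebra that is a dual Banach space. The predual is embedded
   canonically in the dual space: it is a norm-closed subspace N of the dual such that
   evaluation is an isometric isomorphism from the algebra onto the dual of N. *)

definition predual :: "('a::cstar_algebra \<Rightarrow>\<^sub>L complex) set \<Rightarrow> bool"
  where "predual N \<longleftrightarrow>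
    N \<subseteq> cblinfuns \<and> csubspace N \<and> closed N \<and>
    (\<forall>x. norm x = (SUP \<phi>\<in>{\<phi>\<in>N. norm \<phi> \<le> 1}. cmod (blinfun_apply \<phi> x))) \<and>
    (\<forall>F :: ('a \<Rightarrow>\<^sub>L complex) \<Rightarrow> complex.
       (\<forall>\<phi>\<in>N. \<forall>\<psi>\<in>N. F (\<phi> + \<psi>) = F \<phi> + F \<psi>) \<and>
       (\<forall>c. \<forall>\<phi>\<in>N. F (c *\<^sub>C \<phi>) = c * F \<phi>) \<and>
       (\<exists>K. \<forall>\<phi>\<in>N. cmod (F \<phi>) \<le> K * norm \<phi>) \<longrightarrow>
       (\<exists>x. \<forall>\<phi>\<in>N. F \<phi> = \<phi> x))"

definition weak_star_topology :: "('a::cstar_algebra \<Rightarrow>\<^sub>L complex) set \<Rightarrow> 'a topology"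
  where "weak_star_topology N =
    pullback_topology UNIV (\<lambda>x. \<lambda>\<phi>\<in>N. blinfun_apply \<phi> x) (product_topology (\<lambda>_. euclidean) N)"

definition weak_star_operator_topology ::
    "('a::cstar_algebra \<Rightarrow>\<^sub>L complex) set \<Rightarrow> ('a \<Rightarrow>\<^sub>L 'a) topology"
  where "weak_star_operator_topology N =
    pullback_topology cblinfuns blinfun_apply (product_topology (\<lambda>_. weak_star_topology N) UNIV)"

definition weak_star_continuous_operators ::
    "('a::cstar_algebra \<Rightarrow>\<^sub>L complex) set \<Rightarrow> ('a \<Rightarrow>\<^sub>L 'a) set"
  where "weak_star_continuous_operators N =
    {T \<in> cblinfuns. continuous_map (weak_star_topology N) (weak_star_topology N) (blinfun_apply T)}"

(* The order on complex numbers is that of the library theory Complex_Order: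
   z \<le> w means that w - z is real and nonnegative. *)

definition normal_state :: "('a::cstar_algebra \<Rightarrow>\<^sub>L complex) set \<Rightarrow> ('a \<Rightarrow>\<^sub>L complex) \<Rightarrow> bool"
  where "normal_state N \<phi> \<longleftrightarrow> \<phi> \<in> N \<and> (\<forall>x\<in>positive_cone. 0 \<le> \<phi> x) \<and> \<phi> 1 = 1"

definition faithful :: "('a::cstar_algebra \<Rightarrow>\<^sub>L complex) set \<Rightarrow> bool"
  where "faithful \<Phi> \<longleftrightarrow> (\<forall>x\<in>positive_cone. (\<forall>\<phi>\<in>\<Phi>. \<phi> x = 0) \<longrightarrow> x = 0)"

definition operator_semigroup :: "('a::complex_normed_vector \<Rightarrow>\<^sub>L 'a) set \<Rightarrow> bool"
  where "operator_semigroup \<S> \<longleftrightarrow> \<S> \<subseteq> cblinfuns \<and> (\<forall>S\<in>\<S>. \<forall>T\<in>\<S>. S o\<^sub>L T \<in> \<S>)"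

definition semigroup_ideal :: "('a::complex_normed_vector \<Rightarrow>\<^sub>L 'a) set \<Rightarrow> ('a \<Rightarrow>\<^sub>L 'a) set \<Rightarrow> bool"
  where "semigroup_ideal \<S> I \<longleftrightarrow>
    I \<noteq> {} \<and> I \<subseteq> \<S> \<and> (\<forall>S\<in>\<S>. \<forall>T\<in>I. S o\<^sub>L T \<in> I \<and> T o\<^sub>L S \<in> I)"

definition minimal_ideal :: "('a::complex_normed_vector \<Rightarrow>\<^sub>L 'a) set \<Rightarrow> ('a \<Rightarrow>\<^sub>L 'a) set \<Rightarrow> bool"
  where "minimal_ideal \<S> I \<longleftrightarrow>
    semigroup_ideal \<S> I \<and> (\<forall>J. semigroup_ideal \<S> J \<and> J \<subseteq> I \<longrightarrow> J = I)"

definition semitopological_semigroup :: "'s topology \<Rightarrow> ('s \<Rightarrow> 's \<Rightarrow> 's) \<Rightarrow> bool"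
  where "semitopological_semigroup X m \<longleftrightarrow>
    (\<forall>a\<in>topspace X. \<forall>b\<in>topspace X. m a b \<in> topspace X) \<and>
    (\<forall>a\<in>topspace X. \<forall>b\<in>topspace X. \<forall>c\<in>topspace X. m (m a b) c = m a (m b c)) \<and>
    (\<forall>a\<in>topspace X. continuous_map X X (\<lambda>b. m a b) \<and> continuous_map X X (\<lambda>b. m b a))"

definition topological_group :: "('s, 'more) monoid_scheme \<Rightarrow> 's topology \<Rightarrow> bool"
  where "topological_group G X \<longleftrightarrow>
    group G \<and> topspace X = carrier G \<and>
    continuous_map (prod_topology X X) X (\<lambda>(a, b). a \<otimes>\<^bsub>G\<^esub> b) \<and>
    continuous_map X X (\<lambda>a. inv\<^bsub>G\<^esub> a)"

end

theory Submission
  imports Defs "HOL-Computational_Algebra.Polynomial"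
begin

text \<open>Each state \<open>\<phi>\<close> in \<open>\<Phi>\<close> defines the semi-inner product \<open>\<phi>(x* y)\<close>, with square norm \<open>q(x) = \<phi>(x* x)\<close>, and the semigroup acts by
contractions on the resulting pre-Hilbert spaces. As \<open>\<Phi>\<close> is faithful these spaces jointly determine the algebra, and the theorem is
a statement about Hilbert space contractions.

The bridge is that on bounded sets the weak* topology is the topology of the functionals \<open>x \<mapsto> \<phi>(y* x)\<close>
(\<open>wconv_if_states_converge\<close>). It requires these functionals to be weak* continuous on bounded sets, which is Sakai's theorem on the
continuity of multiplication (\<open>wconv_mult_left\<close>). It is derived here from the predual axioms alone, as follows. For a unitary \<open>u\<close> with real part \<open>h\<close>,
polynomials in \<open>h\<close> are bounded by their supremum on \<open>[-1, 1]\<close>, which yields a continuous functional calculus without spectral theory. For a bounded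
net \<open>x_i\<close> let \<open>V(f)\<close> be the weak* limit of \<open>f(h) x_i\<close> along an ultrafilter. Orthogonality of \<open>f(h) x_i\<close> and \<open>k(h) v\<close> for disjointly supported \<open>f\<close>
and \<open>k\<close>, combined with lower semicontinuity of the norm, shows that \<open>k(h) V(f) = 0\<close> (\<open>locality\<close>). A partition of unity turns locality into
\<open>V(id) = h V(1)\<close> (\<open>limit_of_id\<close>), which is continuity of multiplication by \<open>h\<close>. The Cayley transform provides enough unitaries to reach all elements.

Given the bridge, every contraction for the states is weak* continuous on bounded sets (\<open>wconv_state_contraction\<close>), and the norm-bounded contractions form
a compact set; so the closure of the semigroup is a compact semitopological semigroup of contractions. Ellis's lemma gives an idempotent \<open>P\<close> in a minimal left ideal.
Contractive idempotents are orthogonal projections, and this rigidity forces \<open>P\<close> to be the only idempotent of the ideal and to commute with the whole semigroup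
(\<open>kernel_exists\<close>). Hence the ideal is a group, two-sided and contained in every other ideal. Its elements are isometric on the range of \<open>P\<close>, so weak and strong
convergence agree on it, and it is a topological group. The range of \<open>P\<close> consists of the vectors whose norm is preserved by all operators, and the kernel of \<open>P\<close>
consists of the vectors that some operator annihilates.\<close>

section \<open>Ultrafilters\<close>

definition ultrafilter :: "'i filter \<Rightarrow> bool"
  where "ultrafilter U \<longleftrightarrow> U \<noteq> bot \<and> (\<forall>P. eventually P U \<or> eventually (\<lambda>x. \<not> P x) U)"

lemma ultrafilter_exists:
  assumes "F \<noteq> bot"
  obtains U where "U \<le> F" "ultrafilter U"
proof -
  let ?A = "{G. G \<le> F \<and> G \<noteq> bot}"
  have "\<exists>m\<in>?A. \<forall>a\<in>?A. m \<ge> a \<longrightarrow> a = m"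
  proof (rule predicate_Zorn)
    show "partial_order_on ?A (relation_of (\<ge>) ?A)"
      by (rule partial_order_on_relation_ofI) auto
  next
    fix C assume C: "C \<in> Chains (relation_of (\<ge>) ?A)"
    have sub: "C \<subseteq> ?A" and tot: "\<And>a b. a \<in> C \<Longrightarrow> b \<in> C \<Longrightarrow> a \<le> b \<or> b \<le> a"
      using C by (auto simp: Chains_def relation_of_def)
    show "\<exists>u\<in>?A. \<forall>a\<in>C. u \<le> a"
    proof (cases "C = {}")
      case True then show ?thesis using assms by auto
    next
      case False
      have "\<And>P. eventually P (Inf C) \<longleftrightarrow> (\<exists>b\<in>C. eventually P b)"
        by (rule eventually_Inf_base[OF False]) (metis tot inf.absorb1 inf.absorb2 order_refl)
      then have "Inf C \<noteq> bot"
        using sub by (auto simp: trivial_limit_def)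
      moreover have "Inf C \<le> F"
        using False sub by (metis (no_types, lifting) Inf_lower2 mem_Collect_eq subset_eq all_not_in_conv)
      ultimately show ?thesis by (auto intro: Inf_lower)
    qed
  qed
  then obtain U where U: "U \<le> F" "U \<noteq> bot" and max: "\<And>a. a \<le> F \<Longrightarrow> a \<noteq> bot \<Longrightarrow> a \<le> U \<Longrightarrow> a = U"
    by blast
  have "eventually P U \<or> eventually (\<lambda>x. \<not> P x) U" for P
  proof (cases "inf U (principal {x. P x}) = bot")
    case True
    then show ?thesis by (auto simp: trivial_limit_def eventually_inf_principal)
  next
    case False
    then have "inf U (principal {x. P x}) = U"
      using U by (intro max) (auto intro: le_infI1)
    then have "U \<le> principal {x. P x}" by (metis inf.cobounded2)
    then show ?thesis by (simp add: le_principal)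
  qed
  then show ?thesis using U that by (auto simp: ultrafilter_def)
qed

lemma ultrafilter_bounded_converges:
  fixes f :: "'i \<Rightarrow> 'a::heine_borel"
  assumes U: "ultrafilter U" and b: "\<And>i. f i \<in> S" and S: "compact S"
  shows "\<exists>l. (f \<longlongrightarrow> l) U"
proof -
  have "filtermap f U \<noteq> bot" using U by (simp add: ultrafilter_def filtermap_bot_iff)
  then obtain l where l: "inf (nhds l) (filtermap f U) \<noteq> bot"
    using S[unfolded compact_filter] b by (force simp: eventually_filtermap)
  have "eventually (\<lambda>i. f i \<in> T) U" if "open T" "l \<in> T" for T
  proof (rule ccontr)
    assume "\<not> eventually (\<lambda>i. f i \<in> T) U"
    then have "eventually (\<lambda>i. f i \<notin> T) U" using U unfolding ultrafilter_def by blast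
    then have "eventually (\<lambda>y. y \<notin> T) (filtermap f U)" by (simp add: eventually_filtermap)
    moreover have "eventually (\<lambda>y. y \<in> T) (nhds l)" using that by (rule eventually_nhds_in_open)
    ultimately have "eventually (\<lambda>y. False) (inf (nhds l) (filtermap f U))"
      unfolding eventually_inf by blast
    then show False using l by (simp add: trivial_limit_def)
  qed
  then show ?thesis by (auto simp: tendsto_def)
qed

text \<open>A neighbourhood of the limit that the net does not eventually enter would be avoided along some
finer ultrafilter. Convergence can therefore be tested on ultrafilters, where bounded nets converge
without any passage to subnets.\<close>

lemma tendsto_if_all_ultrafilters:
  assumes "\<And>U. ultrafilter U \<Longrightarrow> U \<le> F \<Longrightarrow> (f \<longlongrightarrow> l) U"
  shows "(f \<longlongrightarrow> l) F"
proof (rule ccontr)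
  assume "\<not> ?thesis"
  then obtain S where S: "open S" "l \<in> S" "\<not> eventually (\<lambda>x. f x \<in> S) F" by (auto simp: tendsto_def)
  then have "inf F (principal {x. f x \<notin> S}) \<noteq> bot"
    by (auto simp: trivial_limit_def eventually_inf_principal)
  then obtain U where U: "U \<le> inf F (principal {x. f x \<notin> S})" "ultrafilter U"
    by (rule ultrafilter_exists)
  have "eventually (\<lambda>x. f x \<notin> S) U" using U(1) by (simp add: le_principal)
  moreover have "eventually (\<lambda>x. f x \<in> S) U"
    using assms[OF U(2)] U(1) S by (auto simp: tendsto_def)
  ultimately have "eventually (\<lambda>x. False) U" by eventually_elim auto
  then show False using U(2) by (simp add: ultrafilter_def trivial_limit_def)
qed

text \<open>The complements of the members of a cover without finite subcover generate a proper filter. Its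
refining ultrafilter has no limit, since a limit would lie in some member of the cover.\<close>

lemma compact_space_if_ultrafilters_converge:
  assumes "\<And>U. ultrafilter U \<Longrightarrow> eventually (\<lambda>x. x \<in> topspace X) U \<Longrightarrow> \<exists>l. limitin X id l U"
  shows "compact_space X"
  unfolding compact_space_alt
proof (intro allI impI, elim conjE)
  fix \<U> assume op: "\<forall>U\<in>\<U>. openin X U" and cov: "topspace X \<subseteq> \<Union>\<U>"
  show "\<exists>\<F>. finite \<F> \<and> \<F> \<subseteq> \<U> \<and> topspace X \<subseteq> \<Union>\<F>"
  proof (rule ccontr)
    assume no: "\<not> ?thesis"
    let ?F = "INF W\<in>\<U>. principal (topspace X - W)"
    let ?G = "inf ?F (principal (topspace X))"
    have ev: "eventually P ?G \<longleftrightarrow> (\<exists>\<F>. finite \<F> \<and> \<F> \<subseteq> \<U> \<and> (\<forall>x\<in>topspace X - \<Union>\<F>. P x))" for P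
    proof
      assume "eventually P ?G"
      then obtain \<F> where \<F>: "\<F> \<subseteq> \<U>" "finite \<F>"
          "eventually (\<lambda>x. x \<in> topspace X \<longrightarrow> P x) (INF W\<in>\<F>. principal (topspace X - W))"
        unfolding eventually_inf_principal eventually_INF[of _ _ \<U>] by blast
      have "(INF W\<in>\<F>. principal (topspace X - W)) = principal (\<Inter>W\<in>\<F>. topspace X - W)"
        using \<F>(2) by (rule INF_principal_finite)
      then have "\<forall>x\<in>topspace X - \<Union>\<F>. P x" using \<F>(3) by (auto simp: eventually_principal)
      then show "\<exists>\<F>. finite \<F> \<and> \<F> \<subseteq> \<U> \<and> (\<forall>x\<in>topspace X - \<Union>\<F>. P x)" using \<F> by blast
    next
      assume "\<exists>\<F>. finite \<F> \<and> \<F> \<subseteq> \<U> \<and> (\<forall>x\<in>topspace X - \<Union>\<F>. P x)"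
      then obtain \<F> where \<F>: "finite \<F>" "\<F> \<subseteq> \<U>" "\<forall>x\<in>topspace X - \<Union>\<F>. P x" by blast
      have "?F \<le> (INF W\<in>\<F>. principal (topspace X - W))"
        using \<F>(2) by (rule INF_superset_mono) auto
      also have "\<dots> = principal (\<Inter>W\<in>\<F>. topspace X - W)" using \<F>(1) by (rule INF_principal_finite)
      finally have "?F \<le> principal (\<Inter>W\<in>\<F>. topspace X - W)" .
      moreover have "eventually (\<lambda>x. x \<in> topspace X \<longrightarrow> P x) (principal (\<Inter>W\<in>\<F>. topspace X - W))"
        using \<F>(3) by (auto simp: eventually_principal)
      ultimately show "eventually P ?G"
        unfolding eventually_inf_principal by (rule filter_leD)
    qed
    have "?G \<noteq> bot" using no unfolding trivial_limit_def ev by blast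
    then obtain U where U: "U \<le> ?G" "ultrafilter U" by (rule ultrafilter_exists)
    have "eventually (\<lambda>x. x \<in> topspace X) U"
      using U(1) by (simp add: le_principal)
    then obtain l where l: "limitin X id l U" using assms U(2) by blast
    then have "l \<in> topspace X" by (simp add: limitin_def)
    then obtain W where W: "W \<in> \<U>" "l \<in> W" using cov by blast
    then have "eventually (\<lambda>x. x \<in> W) U" using l op by (auto simp: limitin_def)
    moreover have "eventually (\<lambda>x. x \<notin> W) ?G"
      unfolding ev using W by (intro exI[of _ "{W}"]) auto
    then have "eventually (\<lambda>x. x \<notin> W) U" using U(1) by (rule filter_leD[rotated])
    ultimately have "eventually (\<lambda>x. False) U" by eventually_elim auto
    then show False using U(2) by (simp add: ultrafilter_def trivial_limit_def)
  qed
qed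

section \<open>Elementary C*-algebra\<close>

lemma scaleC_zero_right [simp]: "c *\<^sub>C (0::'a::complex_normed_vector) = 0"
  using norm_scaleC[of c "0::'a"] by simp

lemma scaleC_zero_left [simp]: "0 *\<^sub>C (x::'a::complex_normed_vector) = 0"
  using norm_scaleC[of 0 x] by simp

lemma scaleC_one [simp]: "1 *\<^sub>C (x::'a::complex_normed_vector) = x"
  using scaleC_of_real[of 1 x] by simp

lemma scaleC_minus_left: "(- c) *\<^sub>C (x::'a::complex_normed_vector) = - (c *\<^sub>C x)"
  using scaleC_add_left[of c "-c" x] by (simp add: add_eq_0_iff)

lemma scaleC_minus_right: "c *\<^sub>C (- x::'a::complex_normed_vector) = - (c *\<^sub>C x)"
  using scaleC_add_right[of c x "-x"] by (simp add: add_eq_0_iff)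

lemma scaleC_diff_right: "c *\<^sub>C (x - y::'a::complex_normed_vector) = c *\<^sub>C x - c *\<^sub>C y"
  using scaleC_add_right[of c x "-y"] by (simp add: scaleC_minus_right)

lemma scaleC_sum_right: "c *\<^sub>C (\<Sum>i\<in>I. f i::'a::complex_normed_vector) = (\<Sum>i\<in>I. c *\<^sub>C f i)"
  by (induction I rule: infinite_finite_induct) (auto simp: scaleC_add_right)

lemma adj_zero [simp]: "adj (0::'a::cstar_algebra) = 0"
  using adj_add[of "0::'a" 0] by simp

lemma adj_minus: "adj (- x) = - adj (x::'a::cstar_algebra)"
  using adj_add[of x "-x"] by (simp add: add_eq_0_iff)

lemma adj_diff: "adj (x - y) = adj x - adj (y::'a::cstar_algebra)"
  using adj_add[of x "-y"] by (simp add: adj_minus)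

lemma adj_scaleR: "adj (r *\<^sub>R x) = r *\<^sub>R adj (x::'a::cstar_algebra)"
  using adj_scaleC[of "complex_of_real r" x] by (simp add: scaleC_of_real)

lemma adj_one [simp]: "adj (1::'a::cstar_algebra) = 1"
  by (metis adj_adj adj_mult mult_1_right mult_1_left)

lemma adj_power: "adj (x ^ n) = adj (x::'a::cstar_algebra) ^ n"
  by (induction n) (auto simp: adj_mult power_commutes)

lemma norm_adj [simp]: "norm (adj x) = norm (x::'a::cstar_algebra)"
proof -
  have le: "norm y \<le> norm (adj y)" for y :: 'a
  proof (cases "norm y = 0")
    case False
    have "norm y * norm y \<le> norm (adj y) * norm y"
      using norm_mult_ineq[of "adj y" y] cstar_identity[of y] by (simp add: power2_eq_square)
    then show ?thesis using False mult_right_le_imp_le[of "norm y" "norm y" "norm (adj y)"] by simp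
  qed auto
  show ?thesis using le[of x] le[of "adj x"] by (simp add: adj_adj)
qed

lemma norm_one_le: "norm (1::'a::cstar_algebra) \<le> 1"
proof -
  have "norm (1::'a) * norm (1::'a) = norm (1::'a)"
    using cstar_identity[of "1::'a"] by (simp add: power2_eq_square)
  then show ?thesis by (metis mult_cancel_right1 order_refl zero_le_one)
qed

lemma norm_power_le: "norm (x ^ n) \<le> norm (x::'a::cstar_algebra) ^ n"
proof (induction n)
  case 0 then show ?case using norm_one_le by simp
next
  case (Suc n)
  then show ?case using norm_mult_ineq[of x "x^n"]
    by (simp add: order_trans[OF _ mult_left_mono])
qed

lemma bounded_linear_adj: "bounded_linear (adj :: 'a::cstar_algebra \<Rightarrow> 'a)"
  by (rule bounded_linear_intro[where K=1]) (auto simp: adj_add adj_scaleR)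

section \<open>Weak* convergence of nets\<close>

definition wconv :: "('a::cstar_algebra \<Rightarrow>\<^sub>L complex) set \<Rightarrow> 'i filter \<Rightarrow> ('i \<Rightarrow> 'a) \<Rightarrow> 'a \<Rightarrow> bool"
  where "wconv N F x a \<longleftrightarrow> (\<forall>\<phi>\<in>N. ((\<lambda>i. blinfun_apply \<phi> (x i)) \<longlongrightarrow> \<phi> a) F)"

lemma wconv_add: "wconv N F x a \<Longrightarrow> wconv N F y b \<Longrightarrow> wconv N F (\<lambda>i. x i + y i) (a + b)"
  unfolding wconv_def by (auto simp: blinfun.add_right intro: tendsto_add)

lemma wconv_diff: "wconv N F x a \<Longrightarrow> wconv N F y b \<Longrightarrow> wconv N F (\<lambda>i. x i - y i) (a - b)"
  unfolding wconv_def by (auto simp: blinfun.diff_right intro: tendsto_diff)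

lemma wconv_scaleR: "wconv N F x a \<Longrightarrow> wconv N F (\<lambda>i. r *\<^sub>R x i) (r *\<^sub>R a)"
  unfolding wconv_def by (auto simp: blinfun.scaleR_right intro: tendsto_scaleR)

lemma wconv_const: "wconv N F (\<lambda>i. a) a"
  unfolding wconv_def by auto

lemma wconv_mono: "wconv N F x a \<Longrightarrow> G \<le> F \<Longrightarrow> wconv N G x a"
  unfolding wconv_def by (auto intro: tendsto_mono)

lemma wconv_if_all_ultrafilters:
  "(\<And>U. ultrafilter U \<Longrightarrow> U \<le> F \<Longrightarrow> wconv N U x a) \<Longrightarrow> wconv N F x a"
  unfolding wconv_def by (auto intro: tendsto_if_all_ultrafilters)

context
  fixes N :: "('a::cstar_algebra \<Rightarrow>\<^sub>L complex) set"
  assumes N: "predual N"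
begin

lemma predual_scaleC: "\<phi> \<in> N \<Longrightarrow> blinfun_apply \<phi> (c *\<^sub>C x) = c * \<phi> x"
  using N unfolding predual_def cblinfuns_def by (auto simp: scaleC_complex_def)

lemma predual_zero: "0 \<in> N"
  using N unfolding predual_def csubspace_def by auto

lemma predual_represents:
  fixes L :: "('a \<Rightarrow>\<^sub>L complex) \<Rightarrow> complex"
  assumes "\<And>\<phi> \<psi>. L (\<phi> + \<psi>) = L \<phi> + L \<psi>" "\<And>c \<phi>. L (c *\<^sub>C \<phi>) = c * L \<phi>"
    and "\<And>\<phi>. cmod (L \<phi>) \<le> K * norm \<phi>"
  shows "\<exists>x. \<forall>\<phi>\<in>N. L \<phi> = blinfun_apply \<phi> x"
proof -
  have "\<forall>F :: ('a \<Rightarrow>\<^sub>L complex) \<Rightarrow> complex.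
       (\<forall>\<phi>\<in>N. \<forall>\<psi>\<in>N. F (\<phi> + \<psi>) = F \<phi> + F \<psi>) \<and>
       (\<forall>c. \<forall>\<phi>\<in>N. F (c *\<^sub>C \<phi>) = c * F \<phi>) \<and>
       (\<exists>K. \<forall>\<phi>\<in>N. cmod (F \<phi>) \<le> K * norm \<phi>) \<longrightarrow>
       (\<exists>x. \<forall>\<phi>\<in>N. F \<phi> = \<phi> x)"
    using N unfolding predual_def by (elim conjE)
  note D = this[rule_format, of L]
  show ?thesis
    by (rule D) (use assms in \<open>auto intro: exI[of _ K]\<close>)
qed

text \<open>The isometry of the duality makes the norm lower
semicontinuous for the weak* topology (\<open>wconv_norm_le\<close>), and lower semicontinuity of the norm is the
engine of the whole continuity argument.\<close>

lemma norm_le_predual: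
  assumes "\<And>\<phi>. \<phi> \<in> N \<Longrightarrow> norm \<phi> \<le> 1 \<Longrightarrow> cmod (blinfun_apply \<phi> x) \<le> C"
  shows "norm x \<le> C"
proof -
  have "norm x = (SUP \<phi>\<in>{\<phi>\<in>N. norm \<phi> \<le> 1}. cmod (blinfun_apply \<phi> x))"
    using N unfolding predual_def by blast
  also have "\<dots> \<le> C" using assms predual_zero by (intro cSUP_least) force+
  finally show ?thesis .
qed

lemma predual_separates:
  assumes "\<And>\<phi>. \<phi> \<in> N \<Longrightarrow> blinfun_apply \<phi> x = \<phi> y"
  shows "x = y"
proof -
  have "norm (x - y) \<le> 0"
    using assms by (intro norm_le_predual) (auto simp: blinfun.diff_right)
  then show ?thesis by simp
qed

lemma wconv_scaleC: "wconv N F x a \<Longrightarrow> wconv N F (\<lambda>i. c *\<^sub>C x i) (c *\<^sub>C a)"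
  unfolding wconv_def by (auto simp: predual_scaleC intro: tendsto_mult)

lemma wconv_unique:
  assumes "F \<noteq> bot" "wconv N F x a" "wconv N F x b"
  shows "a = b"
  using assms by (intro predual_separates) (auto simp: wconv_def intro: tendsto_unique)

lemma wconv_norm_le:
  assumes F: "F \<noteq> bot" and w: "wconv N F x a" and C: "eventually (\<lambda>i. norm (x i) \<le> C) F"
  shows "norm a \<le> C"
proof (rule norm_le_predual)
  fix \<phi> assume \<phi>: "\<phi> \<in> N" "norm \<phi> \<le> 1"
  have "((\<lambda>i. cmod (blinfun_apply \<phi> (x i))) \<longlongrightarrow> cmod (\<phi> a)) F"
    using w \<phi> by (auto simp: wconv_def intro: tendsto_norm)
  moreover have "eventually (\<lambda>i. cmod (blinfun_apply \<phi> (x i)) \<le> C) F"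
    using C
  proof eventually_elim
    case (elim i)
    have "cmod (blinfun_apply \<phi> (x i)) \<le> norm \<phi> * norm (x i)" by (rule norm_blinfun)
    also have "\<dots> \<le> 1 * norm (x i)" using \<phi> by (intro mult_right_mono) auto
    finally show ?case using elim by simp
  qed
  ultimately show "cmod (blinfun_apply \<phi> a) \<le> C" using F by (rule tendsto_upperbound)
qed

text \<open>The Banach-Alaoglu theorem in ultrafilter form: the pointwise limit on the predual is a bounded
linear functional, hence evaluation at an element of the algebra.\<close>

lemma bounded_net_wconv:
  assumes U: "ultrafilter U" and b: "\<And>i. norm (x i) \<le> C"
  shows "\<exists>a. wconv N U x a"
proof -
  have nb: "U \<noteq> bot" using U by (simp add: ultrafilter_def)
  have bd: "cmod (blinfun_apply \<phi> (x i)) \<le> norm \<phi> * C" for \<phi> i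
    using norm_blinfun[of \<phi> "x i"] mult_left_mono[OF b[of i] norm_ge_zero[of \<phi>]] by linarith
  have "\<forall>\<phi>::'a \<Rightarrow>\<^sub>L complex. \<exists>l. ((\<lambda>i. blinfun_apply \<phi> (x i)) \<longlongrightarrow> l) U"
  proof
    fix \<phi> :: "'a \<Rightarrow>\<^sub>L complex"
    show "\<exists>l. ((\<lambda>i. blinfun_apply \<phi> (x i)) \<longlongrightarrow> l) U"
      using bd[of \<phi>] by (intro ultrafilter_bounded_converges[OF U, where S="cball 0 (norm \<phi> * C)"]) auto
  qed
  then obtain L :: "('a \<Rightarrow>\<^sub>L complex) \<Rightarrow> complex"
    where L: "\<And>\<phi>. ((\<lambda>i. blinfun_apply \<phi> (x i)) \<longlongrightarrow> L \<phi>) U" by metis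
  have "\<exists>a. \<forall>\<phi>\<in>N. L \<phi> = blinfun_apply \<phi> a"
  proof -
    have 1: "L (\<phi> + \<psi>) = L \<phi> + L \<psi>" for \<phi> \<psi>
      using tendsto_add[OF L[of \<phi>] L[of \<psi>]] L[of "\<phi> + \<psi>"]
      unfolding blinfun.add_left by (rule tendsto_unique[OF nb, rotated])
    have 2: "L (c *\<^sub>C \<phi>) = c * L \<phi>" for c \<phi>
      using tendsto_mult[OF tendsto_const[of c] L[of \<phi>]] L[of "c *\<^sub>C \<phi>"]
      unfolding scaleC_blinfun.rep_eq scaleC_complex_def by (rule tendsto_unique[OF nb, rotated])
    have 3: "cmod (L \<phi>) \<le> C * norm \<phi>" for \<phi>
      using bd[of \<phi>] nb
      by (intro tendsto_upperbound[OF tendsto_norm[OF L[of \<phi>]]]) (simp_all add: mult.commute)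
    show ?thesis
    proof (rule predual_represents)
      show "L (\<phi> + \<psi>) = L \<phi> + L \<psi>" for \<phi> \<psi> by (rule 1)
      show "L (c *\<^sub>C \<phi>) = c * L \<phi>" for c \<phi> by (rule 2)
      show "cmod (L \<phi>) \<le> C * norm \<phi>" for \<phi> by (rule 3)
    qed
  qed
  then obtain a where "\<forall>\<phi>\<in>N. L \<phi> = blinfun_apply \<phi> a" by (elim exE)
  then have "wconv N U x a" using L unfolding wconv_def by metis
  then show ?thesis by (rule exI)
qed

end

section \<open>Real polynomials of the real part of a unitary\<close>

text \<open>Averaging over the \<open>n\<close>-th roots of unity recovers the coefficients of a polynomial of degree below
\<open>n\<close> from its values on the circle.\<close>

lemma norm_coeff_le_on_circle:
  fixes c :: "nat \<Rightarrow> complex"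
  assumes M: "\<And>z. cmod z = 1 \<Longrightarrow> cmod (\<Sum>l<n. c l * z ^ l) \<le> M" and k: "k < n"
  shows "cmod (c k) \<le> M"
proof -
  define w where "w = cis (2 * pi / n)"
  have n: "n > 0" using k by simp
  have w1: "cmod w = 1" by (simp add: w_def)
  have wn: "w ^ m = cis (2 * pi * m / n)" for m
    unfolding w_def Complex.DeMoivre by (rule arg_cong[where f=cis]) simp
  have orth: "(\<Sum>j<n. (w ^ j) ^ l * cnj (w ^ j) ^ k) = (if l = k then of_nat n else 0)" if l: "l < n" for l
  proof (cases "l = k")
    case True
    have "w ^ j * cnj (w ^ j) = 1" for j
      using complex_norm_square[of "w ^ j"] by (simp add: norm_power w1)
    then have "(w ^ j) ^ k * cnj (w ^ j) ^ k = 1" for j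
      by (simp only: power_one flip: power_mult_distrib)
    then show ?thesis using True by simp
  next
    case False
    define v where "v = w ^ l * cnj w ^ k"
    have v: "v = cis (2 * pi * (real l - real k) / n)"
      by (simp add: v_def wn cis_cnj cis_mult diff_divide_distrib right_diff_distrib flip: complex_cnj_power)
    have "v \<noteq> 1"
    proof
      assume "v = 1"
      then have "cos (2 * pi * (real l - real k) / n) = 1" by (simp add: v complex_eq_iff)
      then obtain m :: int where "2 * pi * (real l - real k) / n = m * 2 * pi"
        using cos_one_2pi_int by auto
      then have "(2 * pi) * ((real l - real k) / n) = (2 * pi) * m" by (simp add: mult.commute)
      then have "(real l - real k) / n = m" using pi_gt_zero by (simp only: mult_cancel_left) simp
      then have "real l - real k = m * real n" using n by (simp add: divide_eq_eq)
      then have "int l - int k = m * int n" by (metis of_int_diff of_int_eq_iff of_int_mult of_int_of_nat_eq)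
      then have "int n dvd int l - int k" by simp
      moreover have "\<bar>int l - int k\<bar> < int n" using l k by linarith
      ultimately show False using False zdvd_imp_le[of "int n" "\<bar>int l - int k\<bar>"] by auto
    qed
    moreover have "v ^ n = 1"
    proof -
      have "v ^ n = (w ^ n) ^ l * cnj (w ^ n) ^ k"
        by (simp add: v_def power_mult_distrib mult.commute flip: power_mult)
      also have "w ^ n = 1" using n by (simp add: wn)
      finally show ?thesis by simp
    qed
    moreover have "(w ^ j) ^ l * cnj (w ^ j) ^ k = v ^ j" for j
      by (simp add: v_def power_mult_distrib mult.commute flip: power_mult)
    ultimately show ?thesis using False by (simp add: sum_gp_strict)
  qed
  have "(\<Sum>j<n. (\<Sum>l<n. c l * (w ^ j) ^ l) * cnj (w ^ j) ^ k)
      = (\<Sum>j<n. \<Sum>l<n. c l * ((w ^ j) ^ l * cnj (w ^ j) ^ k))"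
    by (simp add: sum_distrib_right mult.assoc)
  also have "\<dots> = (\<Sum>l<n. c l * (\<Sum>j<n. (w ^ j) ^ l * cnj (w ^ j) ^ k))"
    by (subst sum.swap) (simp add: sum_distrib_left)
  also have "\<dots> = (\<Sum>l<n. if l = k then c l * of_nat n else 0)"
  proof (rule sum.cong[OF refl])
    fix l assume "l \<in> {..<n}"
    then show "c l * (\<Sum>j<n. (w ^ j) ^ l * cnj (w ^ j) ^ k) = (if l = k then c l * of_nat n else 0)"
      by (subst orth) auto
  qed
  also have "\<dots> = c k * of_nat n" using k by (simp add: sum.delta)
  finally have "cmod (c k) * n = cmod (\<Sum>j<n. (\<Sum>l<n. c l * (w ^ j) ^ l) * cnj (w ^ j) ^ k)"
    by (simp add: norm_mult)
  also have "\<dots> \<le> (\<Sum>j<n. M)"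
  proof (rule sum_norm_le)
    fix j
    have "cmod (w ^ j) = 1" by (simp add: norm_power w1)
    then show "cmod ((\<Sum>l<n. c l * (w ^ j) ^ l) * cnj (w ^ j) ^ k) \<le> M"
      using M[of "w ^ j"] by (simp add: norm_mult norm_power)
  qed
  finally show ?thesis using n by (simp add: mult.commute)
qed

definition poly_at :: "'a::cstar_algebra \<Rightarrow> real poly \<Rightarrow> 'a"
  where "poly_at h p = fold_coeffs (\<lambda>c a. c *\<^sub>R 1 + h * a) p 0"

lemma poly_at_0 [simp]: "poly_at h 0 = 0"
  by (simp add: poly_at_def)

lemma poly_at_pCons [simp]: "poly_at h (pCons c p) = c *\<^sub>R 1 + h * poly_at h p"
  by (cases "c = 0 \<and> p = 0") (auto simp: poly_at_def)

lemma poly_at_add: "poly_at h (p + q) = poly_at h p + poly_at h q"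
  by (induction p q rule: poly_induct2) (auto simp: algebra_simps)

lemma poly_at_smult: "poly_at h (smult c p) = c *\<^sub>R poly_at h p"
  by (induction p) (auto simp: algebra_simps)

lemma poly_at_diff: "poly_at h (p - q) = poly_at h p - poly_at h q"
  using poly_at_add[of h "p - q" q] by (simp add: algebra_simps)

lemma poly_at_mult: "poly_at h (p * q) = poly_at h p * poly_at h q"
  by (induction p) (auto simp: poly_at_add poly_at_smult algebra_simps)

lemma poly_at_power: "poly_at h (p ^ n) = poly_at h p ^ n"
proof (induction n)
  case 0
  have "poly_at h [:1:] = 1" by simp
  then show ?case by (simp only: power_0 one_pCons)
qed (simp add: poly_at_mult)

lemma poly_at_commute: "h * poly_at h p = poly_at h p * h"
  using poly_at_mult[of h "[:0,1:]" p] poly_at_mult[of h p "[:0,1:]"] by (simp add: mult.commute)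

lemma adj_poly_at:
  assumes "adj h = h"
  shows "adj (poly_at h p) = poly_at h p"
  by (induction p) (auto simp: adj_add adj_scaleR adj_mult assms poly_at_commute)

lemma norm_self_adjoint_power:
  assumes "adj a = (a::'a::cstar_algebra)"
  shows "norm (a ^ 2 ^ j) = norm a ^ 2 ^ j"
proof (induction j)
  case (Suc j)
  let ?b = "a ^ 2 ^ j"
  have "norm (a ^ 2 ^ Suc j) = norm (adj ?b * ?b)"
    by (simp add: adj_power assms power_add mult_2)
  also have "\<dots> = (norm a ^ 2 ^ j)\<^sup>2" using Suc by (simp add: cstar_identity)
  finally show ?case by (simp flip: power_mult add: mult.commute)
qed simp

text \<open>One coefficient sequence serves two purposes: it represents the function \<open>f\<close> on the unit circle and
the element \<open>a\<close> as a polynomial in \<open>u\<close>. Bounds for \<open>f\<close> on the circle then become bounds for \<open>a\<close>.\<close>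

definition laurent_form :: "'a::cstar_algebra \<Rightarrow> nat \<Rightarrow> (complex \<Rightarrow> complex) \<Rightarrow> 'a \<Rightarrow> bool"
  where "laurent_form u n f a \<longleftrightarrow>
    (\<exists>c. (\<forall>z. cmod z = 1 \<longrightarrow> f z = (\<Sum>k<n. c k * z ^ k)) \<and> a = (\<Sum>k<n. c k *\<^sub>C u ^ k))"

lemma laurent_form_add:
  assumes "laurent_form u n f a" "laurent_form u n g b"
  shows "laurent_form u n (\<lambda>z. f z + g z) (a + b)"
proof -
  obtain c d where "\<forall>z. cmod z = 1 \<longrightarrow> f z = (\<Sum>k<n. c k * z ^ k)" "a = (\<Sum>k<n. c k *\<^sub>C u ^ k)"
    "\<forall>z. cmod z = 1 \<longrightarrow> g z = (\<Sum>k<n. d k * z ^ k)" "b = (\<Sum>k<n. d k *\<^sub>C u ^ k)"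
    using assms unfolding laurent_form_def by blast
  then show ?thesis unfolding laurent_form_def
    by (intro exI[of _ "\<lambda>k. c k + d k"]) (auto simp: algebra_simps sum.distrib scaleC_add_left)
qed

lemma laurent_form_scale:
  assumes "laurent_form u n f a"
  shows "laurent_form u n (\<lambda>z. s * f z) (s *\<^sub>C a)"
proof -
  obtain c where "\<forall>z. cmod z = 1 \<longrightarrow> f z = (\<Sum>k<n. c k * z ^ k)" "a = (\<Sum>k<n. c k *\<^sub>C u ^ k)"
    using assms unfolding laurent_form_def by blast
  then show ?thesis unfolding laurent_form_def
    by (intro exI[of _ "\<lambda>k. s * c k"])
      (auto simp: sum_distrib_left mult.assoc scaleC_sum_right scaleC_scaleC)
qed

lemma laurent_form_shift:
  assumes "laurent_form u n f a"
  shows "laurent_form u (Suc n) (\<lambda>z. z * f z) (u * a)"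
proof -
  obtain c where c: "\<forall>z. cmod z = 1 \<longrightarrow> f z = (\<Sum>k<n. c k * z ^ k)" "a = (\<Sum>k<n. c k *\<^sub>C u ^ k)"
    using assms unfolding laurent_form_def by blast
  let ?d = "\<lambda>k. case k of 0 \<Rightarrow> 0 | Suc k \<Rightarrow> c k"
  have "z * f z = (\<Sum>k<Suc n. ?d k * z ^ k)" if "cmod z = 1" for z
    using c(1) that by (simp add: sum.lessThan_Suc_shift sum_distrib_left mult.left_commute del: sum.lessThan_Suc)
  moreover have "u * a = (\<Sum>k<Suc n. ?d k *\<^sub>C u ^ k)"
    using c(2) by (simp add: sum.lessThan_Suc_shift sum_distrib_left scaleC_mult_right del: sum.lessThan_Suc)
  ultimately show ?thesis unfolding laurent_form_def by (intro exI[of _ ?d]) simp_all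
qed

lemma laurent_form_mono:
  assumes "laurent_form u n f a" "n \<le> m"
  shows "laurent_form u m f a"
proof -
  obtain c where c: "\<forall>z. cmod z = 1 \<longrightarrow> f z = (\<Sum>k<n. c k * z ^ k)" "a = (\<Sum>k<n. c k *\<^sub>C u ^ k)"
    using assms unfolding laurent_form_def by blast
  let ?d = "\<lambda>k. if k < n then c k else 0"
  have "f z = (\<Sum>k<m. ?d k * z ^ k)" if "cmod z = 1" for z
    unfolding c(1)[rule_format, OF that]
    by (rule sum.mono_neutral_cong_left) (use assms(2) in auto)
  moreover have "a = (\<Sum>k<m. ?d k *\<^sub>C u ^ k)"
    unfolding c(2)
    by (rule sum.mono_neutral_cong_left) (use assms(2) in auto)
  ultimately show ?thesis unfolding laurent_form_def by (intro exI[of _ ?d]) simp_all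
qed

lemma laurent_form_const: "laurent_form u 1 (\<lambda>z. s) (s *\<^sub>C 1)"
  unfolding laurent_form_def by (intro exI[of _ "\<lambda>k. s"]) auto

lemma laurent_form_monomial: "laurent_form u (Suc d) (\<lambda>z. s * z ^ d) (s *\<^sub>C u ^ d)"
proof (induction d)
  case 0 then show ?case using laurent_form_const[of u s] by simp
next
  case (Suc d)
  from laurent_form_shift[OF Suc] show ?case
    by (simp add: scaleC_mult_right mult.left_commute)
qed

lemma laurent_form_cong:
  assumes "laurent_form u n f a" "\<And>z. cmod z = 1 \<Longrightarrow> f z = g z" "a = b"
  shows "laurent_form u n g b"
  using assms unfolding laurent_form_def by metis

text \<open>On the unit circle \<open>z * Re z = (z ^ 2 + 1) / 2\<close>, and likewise \<open>u * h = (u ^ 2 + 1) / 2\<close>. The powers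
\<open>z ^ d\<close> and \<open>u ^ d\<close> clear the negative exponents.\<close>

lemma laurent_form_poly_at:
  fixes u :: "'a::cstar_algebra"
  assumes u: "u * adj u = 1" and h: "h = (1/2) *\<^sub>R (u + adj u)"
  shows "degree p \<le> d \<Longrightarrow>
    laurent_form u (2 * d + 1) (\<lambda>z. z ^ d * of_real (poly p (Re z))) (u ^ d * poly_at h p)"
proof (induction d arbitrary: p)
  case 0
  then obtain a where "p = [:a:]" using degree_eq_zeroE[of p] by auto
  then show ?case using laurent_form_const[of u "of_real a"] by (simp add: scaleC_of_real)
next
  case (Suc d)
  obtain a q where p: "p = pCons a q" by (cases p)
  have "degree q \<le> d" using Suc.prems p by (auto simp: degree_pCons_eq_if split: if_splits)
  note IH = Suc.IH[OF this]
  let ?f = "\<lambda>z. z ^ d * of_real (poly q (Re z))" and ?b = "u ^ d * poly_at h q"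
  let ?n = "2 * Suc d + 1"
  have uh: "u * h = (1/2) *\<^sub>R (u * u + 1)"
    by (simp add: h u distrib_left)
  have half: "(1/2) *\<^sub>C x = (1/2) *\<^sub>R x" for x :: 'a
    using scaleC_of_real[of "1/2" x] by simp
  have mon: "laurent_form u ?n (\<lambda>z. of_real a * z ^ Suc d) (of_real a *\<^sub>C u ^ Suc d)"
    by (rule laurent_form_mono[OF laurent_form_monomial]) simp
  have low: "laurent_form u ?n ?f ?b"
    by (rule laurent_form_mono[OF IH]) simp
  have high: "laurent_form u ?n (\<lambda>z. z * (z * ?f z)) (u * (u * ?b))"
    by (rule laurent_form_mono[OF laurent_form_shift[OF laurent_form_shift[OF IH]]]) simp
  show ?case
  proof (rule laurent_form_cong[OF laurent_form_add[OF mon laurent_form_scale[OF laurent_form_add[OF high low]]]])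
    fix z assume "cmod z = 1"
    then have "z * cnj z = 1" using complex_norm_square[of z] by simp
    moreover have "of_real (Re z) = (1/2) * (z + cnj z)"
      by (simp add: complex_add_cnj)
    ultimately have zz: "z * of_real (Re z) = (1/2) * (z * z + 1)"
      by (simp add: distrib_left)
    have "z ^ Suc d * of_real (poly p (Re z)) = of_real a * z ^ Suc d + (z * of_real (Re z)) * ?f z"
      by (simp add: p algebra_simps)
    also have "\<dots> = of_real a * z ^ Suc d + (1/2) * (z * (z * ?f z) + ?f z)"
      unfolding zz by (simp add: algebra_simps)
    finally show "of_real a * z ^ Suc d + (1/2) * (z * (z * ?f z) + ?f z)
      = z ^ Suc d * of_real (poly p (Re z))" ..
  next
    have "u ^ Suc d * (h * poly_at h q) = u ^ d * (u * h) * poly_at h q"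
      by (subst power_Suc2) (simp only: mult.assoc)
    also have "\<dots> = (1/2) *\<^sub>R (u ^ d * (u * u) * poly_at h q + ?b)"
      unfolding uh by (simp add: distrib_left distrib_right scaleR_add_right)
    also have "u ^ d * (u * u) = u * u * u ^ d"
      by (metis add.commute power2_eq_square power_add)
    finally have "u ^ Suc d * (h * poly_at h q) = (1/2) *\<^sub>R (u * (u * ?b) + ?b)"
      by (simp only: mult.assoc)
    then show "of_real a *\<^sub>C u ^ Suc d + (1/2) *\<^sub>C (u * (u * ?b) + ?b) = u ^ Suc d * poly_at h p"
      unfolding half p poly_at_pCons distrib_left by (simp only: scaleC_of_real mult_scaleR_right mult_1_right)
  qed
qed

lemma laurent_form_norm_le:
  assumes "laurent_form u n f a" "norm (u::'a::cstar_algebra) \<le> 1"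
    and "\<And>z. cmod z = 1 \<Longrightarrow> cmod (f z) \<le> M"
  shows "norm a \<le> n * M"
proof -
  obtain c where c: "\<forall>z. cmod z = 1 \<longrightarrow> f z = (\<Sum>k<n. c k * z ^ k)" "a = (\<Sum>k<n. c k *\<^sub>C u ^ k)"
    using assms(1) unfolding laurent_form_def by blast
  have "norm a \<le> (\<Sum>k<n. M)" unfolding c(2)
  proof (rule sum_norm_le)
    fix k assume "k \<in> {..<n}"
    then have "cmod (c k) \<le> M"
      using norm_coeff_le_on_circle[where n=n and c=c and M=M and k=k] assms(3) c(1) by auto
    moreover have "norm (u ^ k) \<le> 1"
      using norm_power_le[of u k] power_le_one[OF norm_ge_zero assms(2), of k] by linarith
    ultimately show "norm (c k *\<^sub>C u ^ k) \<le> M"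
      using mult_mono[of "cmod (c k)" M "norm (u ^ k)" 1] order_trans[OF norm_ge_zero]
      by (auto simp: norm_scaleC)
  qed
  then show ?thesis by simp
qed

text \<open>A ratio \<open>x / M > 1\<close> would have powers growing faster than any linear function of the exponent.\<close>

lemma le_if_power_le_linear_growth:
  fixes x M :: real
  assumes le: "\<And>j::nat. x ^ 2 ^ j \<le> (2 ^ j * D + 1) * M ^ 2 ^ j" and M: "0 \<le> M"
  shows "x \<le> M"
proof (rule ccontr)
  assume "\<not> x \<le> M"
  then have xM: "M < x" by simp
  show False
  proof (cases "M = 0")
    case True
    then have "x ^ 2 ^ 0 \<le> 0" using le[of 0] by simp
    then show False using xM True by simp
  next
    case False
    define r where "r = x / M"
    have r: "r > 1" using False M xM by (simp add: r_def)
    have rle: "r ^ 2 ^ j \<le> 2 ^ j * D + 1" for j :: nat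
      using le[of j] False M by (simp add: r_def power_divide divide_le_eq)
    have "(\<lambda>n. (real n * D + 1) / r ^ n) \<longlonglongrightarrow> 0"
    proof -
      have "(\<lambda>n. D * (real n * (1/r) ^ n) + (1/r) ^ n) \<longlonglongrightarrow> D * 0 + 0"
        using r by (intro tendsto_intros powser_times_n_limit_0 LIMSEQ_power_zero) auto
      then show ?thesis by (simp add: field_simps add_divide_distrib power_divide)
    qed
    then have "eventually (\<lambda>n. (real n * D + 1) / r ^ n < 1) sequentially"
      by (rule order_tendstoD) simp
    then obtain n0 where n0: "\<And>n. n \<ge> n0 \<Longrightarrow> (real n * D + 1) / r ^ n < 1"
      by (auto simp: eventually_sequentially)
    have "n0 \<le> 2 ^ n0" by (simp add: less_imp_le)
    from n0[OF this] have "2 ^ n0 * D + 1 < r ^ 2 ^ n0" using r by (simp add: divide_less_eq)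
    then show False using rle[of n0] by simp
  qed
qed

text \<open>The crude bound by the number of coefficients is applied to the powers \<open>p ^ 2 ^ j\<close>. Since \<open>p h\<close> is
self-adjoint, the C*-identity gives \<open>norm (a ^ 2 ^ j) = norm a ^ 2 ^ j\<close> for \<open>a = p h\<close>, and in the limit the
polynomial factor disappears. This replaces spectral theory: it makes polynomials in the real part of a
unitary contractive for the supremum norm on \<open>[-1, 1]\<close>.\<close>

lemma norm_poly_at_le:
  fixes u :: "'a::cstar_algebra"
  assumes u: "adj u * u = 1" "u * adj u = 1" and h: "h = (1/2) *\<^sub>R (u + adj u)"
    and M: "\<And>t. t \<in> {-1..1} \<Longrightarrow> \<bar>poly p t\<bar> \<le> M"
  shows "norm (poly_at h p) \<le> M"
proof (rule le_if_power_le_linear_growth[where D = "2 * real (degree p)"])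
  show M0: "0 \<le> M" using M[of 0] by auto
  have hs: "adj h = h" by (simp add: h adj_scaleR adj_add adj_adj add.commute)
  have nu: "norm u \<le> 1"
    using cstar_identity[of u] norm_one_le[where 'a='a] u(1) by (auto simp: power2_eq_square abs_le_square_iff[of "norm u" 1, simplified] power2_eq_square)
  fix j :: nat
  let ?m = "2 ^ j :: nat"
  let ?d = "degree p * ?m"
  have "degree (p ^ ?m) \<le> ?d" by (rule degree_power_le)
  from laurent_form_poly_at[OF u(2) h this]
  have "norm (u ^ ?d * poly_at h (p ^ ?m)) \<le> (2 * ?d + 1) * M ^ ?m"
  proof (rule laurent_form_norm_le[OF _ nu])
    fix z assume "cmod z = 1"
    then have "\<bar>poly p (Re z)\<bar> \<le> M" using abs_Re_le_cmod[of z] by (intro M) auto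
    then show "cmod (z ^ ?d * of_real (poly (p ^ ?m) (Re z))) \<le> M ^ ?m"
      using \<open>cmod z = 1\<close> by (simp add: norm_mult norm_power poly_power power_mono)
  qed
  moreover have "norm (poly_at h p ^ ?m) \<le> norm (u ^ ?d * poly_at h (p ^ ?m))"
  proof -
    have "adj u ^ n * u ^ n = 1" for n
    proof (induction n)
      case (Suc n)
      have "adj u ^ Suc n * u ^ Suc n = adj u ^ n * (adj u * u) * u ^ n"
        by (subst (1) power_Suc2) (simp only: power_Suc mult.assoc)
      then show ?case using u(1) Suc by simp
    qed simp
    then have "poly_at h p ^ ?m = adj u ^ ?d * (u ^ ?d * poly_at h (p ^ ?m))"
      by (simp add: poly_at_power flip: mult.assoc)
    also have "norm \<dots> \<le> norm (adj u ^ ?d) * norm (u ^ ?d * poly_at h (p ^ ?m))"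
      by (rule norm_mult_ineq)
    also have "\<dots> \<le> 1 * norm (u ^ ?d * poly_at h (p ^ ?m))"
      using norm_power_le[of "adj u" ?d] power_le_one[OF norm_ge_zero nu, of ?d]
      by (intro mult_right_mono) auto
    finally show ?thesis by simp
  qed
  ultimately show "norm (poly_at h p) ^ 2 ^ j \<le> (2 ^ j * (2 * real (degree p)) + 1) * M ^ 2 ^ j"
    using norm_self_adjoint_power[OF adj_poly_at[OF hs], of p j]
    by (simp add: algebra_simps)
qed

section \<open>Continuous functional calculus on an interval\<close>

text \<open>\<open>poly_limit h f a\<close> holds if \<open>a\<close> is the value at \<open>h\<close> of the uniform limit \<open>f\<close> of polynomials on
\<open>[-1, 1]\<close>; contractivity makes \<open>a\<close> unique and Weierstrass approximation makes it exist, so that \<open>cfc\<close>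
is the continuous functional calculus.\<close>

definition poly_limit :: "'a::cstar_algebra \<Rightarrow> (real \<Rightarrow> real) \<Rightarrow> 'a \<Rightarrow> bool"
  where "poly_limit h f a \<longleftrightarrow> (\<exists>p. uniform_limit {-1..1} (\<lambda>n. poly (p n)) f sequentially \<and>
    (\<lambda>n::nat. poly_at h (p n)) \<longlonglongrightarrow> a)"

definition cfc :: "'a::cstar_algebra \<Rightarrow> (real \<Rightarrow> real) \<Rightarrow> 'a"
  where "cfc h f = (SOME a. poly_limit h f a)"

definition spectral_contraction :: "'a::cstar_algebra \<Rightarrow> bool"
  where "spectral_contraction h \<longleftrightarrow> adj h = h \<and>
    (\<forall>p M. (\<forall>t\<in>{-1..1}. \<bar>poly p t\<bar> \<le> M) \<longrightarrow> norm (poly_at h p) \<le> M)"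

lemma uniform_polynomial_approximation:
  fixes f :: "real \<Rightarrow> real"
  assumes "continuous_on {-1..1} f" "e > 0"
  shows "\<exists>p. \<forall>t\<in>{-1..1}. \<bar>poly p t - f t\<bar> < e"
proof -
  obtain g where g: "real_polynomial_function g" "\<And>t. t \<in> {-1..1} \<Longrightarrow> \<bar>f t - g t\<bar> < e"
    using Stone_Weierstrass_real_polynomial_function[of "{-1..1}" f e] assms by auto
  obtain a n where "g = (\<lambda>x. \<Sum>i\<le>n. a i * x ^ i)"
    using g(1) unfolding real_polynomial_function_iff_sum by blast
  then have "poly (\<Sum>i\<le>n. monom (a i) i) t = g t" for t
    by (simp add: poly_sum poly_monom)
  then show ?thesis using g(2) by (metis abs_minus_commute)
qed

lemma continuous_on_interval_bounded:
  fixes f :: "real \<Rightarrow> real"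
  assumes "continuous_on {-1..1} f"
  obtains M where "M > 0" "\<And>t. t \<in> {-1..1} \<Longrightarrow> \<bar>f t\<bar> \<le> M"
proof -
  have "bounded (f ` {-1..1})"
    using assms by (intro compact_imp_bounded compact_continuous_image) auto
  then show ?thesis using that unfolding bounded_pos by auto
qed

context
  fixes h :: "'a::cstar_algebra"
  assumes h: "spectral_contraction h"
begin

lemma h_self_adjoint: "adj h = h"
  using h by (simp add: spectral_contraction_def)

lemma poly_limit_norm_le:
  assumes "poly_limit h f a" "\<And>t. t \<in> {-1..1} \<Longrightarrow> \<bar>f t\<bar> \<le> M"
  shows "norm a \<le> M"
proof (rule field_le_epsilon)
  fix e :: real assume e: "0 < e"
  obtain p where p: "uniform_limit {-1..1} (\<lambda>n. poly (p n)) f sequentially"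
    and l: "(\<lambda>n::nat. poly_at h (p n)) \<longlonglongrightarrow> a"
    using assms(1) unfolding poly_limit_def by blast
  have "eventually (\<lambda>n. norm (poly_at h (p n)) \<le> M + e) sequentially"
    using uniform_limitD[OF p e]
  proof eventually_elim
    case (elim n)
    have "\<bar>poly (p n) t\<bar> \<le> M + e" if "t \<in> {-1..1}" for t
      using elim[rule_format, OF that] assms(2)[OF that] by (simp add: dist_real_def)
    then show ?case using h unfolding spectral_contraction_def by blast
  qed
  then show "norm a \<le> M + e"
    by (intro tendsto_upperbound[OF tendsto_norm[OF l]]) auto
qed

lemma poly_limit_exists:
  assumes f: "continuous_on {-1..1} f"
  shows "\<exists>a. poly_limit h f a"
proof -
  have "\<exists>p. \<forall>t\<in>{-1..1}. \<bar>poly p t - f t\<bar> < inverse (real (Suc n))" for n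
    using f by (intro uniform_polynomial_approximation) auto
  then obtain p where p: "\<And>n t. t \<in> {-1..1} \<Longrightarrow> \<bar>poly (p n) t - f t\<bar> < inverse (real (Suc n))"
    by metis
  have small: "\<exists>k. \<forall>n\<ge>k. inverse (real (Suc n)) < e" if e: "e > 0" for e :: real
    using order_tendstoD(2)[OF LIMSEQ_inverse_real_of_nat e] by (simp add: eventually_sequentially)
  have "uniform_limit {-1..1} (\<lambda>n. poly (p n)) f sequentially"
  proof (rule uniform_limitI)
    fix e :: real assume "e > 0"
    then obtain k where k: "\<And>n. n \<ge> k \<Longrightarrow> inverse (real (Suc n)) < e" using small by blast
    show "\<forall>\<^sub>F n in sequentially. \<forall>t\<in>{-1..1}. dist (poly (p n) t) (f t) < e"
      unfolding eventually_sequentially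
    proof (intro exI allI impI ballI)
      fix n t assume "k \<le> n" "t \<in> {-1..1::real}"
      then show "dist (poly (p n) t) (f t) < e"
        using p[of t n] k[of n] unfolding dist_real_def by linarith
    qed
  qed
  moreover have "Cauchy (\<lambda>n. poly_at h (p n))"
  proof (rule CauchyI)
    fix e :: real assume "e > 0"
    then obtain k where k: "\<And>n. n \<ge> k \<Longrightarrow> inverse (real (Suc n)) < e / 3"
      using small[of "e/3"] by auto
    show "\<exists>M. \<forall>m\<ge>M. \<forall>n\<ge>M. norm (poly_at h (p m) - poly_at h (p n)) < e"
    proof (intro exI allI impI)
      fix m n assume mn: "k \<le> m" "k \<le> n"
      have "\<bar>poly (p m - p n) t\<bar> \<le> 2 * (e / 3)" if "t \<in> {-1..1}" for t
        using p[OF that, of m] p[OF that, of n] k[OF mn(1)] k[OF mn(2)]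
        unfolding poly_diff by linarith
      then have "norm (poly_at h (p m - p n)) \<le> 2 * (e / 3)"
        using h unfolding spectral_contraction_def by blast
      then show "norm (poly_at h (p m) - poly_at h (p n)) < e"
        using \<open>e > 0\<close> by (simp add: poly_at_diff)
    qed
  qed
  ultimately show ?thesis
    unfolding poly_limit_def by (meson Cauchy_convergent_iff convergent_def)
qed

lemma poly_limit_cfc: "continuous_on {-1..1} f \<Longrightarrow> poly_limit h f (cfc h f)"
  unfolding cfc_def by (rule someI_ex) (rule poly_limit_exists)

lemma poly_limit_diff:
  assumes "poly_limit h f a" "poly_limit h g b"
  shows "poly_limit h (\<lambda>t. f t - g t) (a - b)"
proof -
  obtain p q where "uniform_limit {-1..1} (\<lambda>n. poly (p n)) f sequentially" "(\<lambda>n::nat. poly_at h (p n)) \<longlonglongrightarrow> a"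
    "uniform_limit {-1..1} (\<lambda>n. poly (q n)) g sequentially" "(\<lambda>n::nat. poly_at h (q n)) \<longlonglongrightarrow> b"
    using assms unfolding poly_limit_def by blast
  moreover have "poly (p n - q n) = (\<lambda>t. poly (p n) t - poly (q n) t)" for n
    by (simp add: fun_eq_iff)
  ultimately show ?thesis unfolding poly_limit_def
    by (intro exI[of _ "\<lambda>n. p n - q n"]) (auto simp: poly_at_diff intro: uniform_limit_minus tendsto_diff)
qed

lemma poly_limit_unique:
  assumes "poly_limit h f a" "poly_limit h g b" "\<And>t. t \<in> {-1..1} \<Longrightarrow> f t = g t"
  shows "a = b"
  using poly_limit_norm_le[OF poly_limit_diff[OF assms(1,2)], of 0] assms(3) by simp

lemma cfc_eqI: "poly_limit h f a \<Longrightarrow> continuous_on {-1..1} f \<Longrightarrow> cfc h f = a"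
  using poly_limit_unique[OF poly_limit_cfc] by blast

lemma cfc_cong:
  assumes "continuous_on {-1..1} f" "continuous_on {-1..1} g" "\<And>t. t \<in> {-1..1} \<Longrightarrow> f t = g t"
  shows "cfc h f = cfc h g"
  using poly_limit_unique[OF poly_limit_cfc poly_limit_cfc] assms by blast

lemma cfc_norm_le:
  assumes "continuous_on {-1..1} f" "\<And>t. t \<in> {-1..1} \<Longrightarrow> \<bar>f t\<bar> \<le> M"
  shows "norm (cfc h f) \<le> M"
  using poly_limit_norm_le[OF poly_limit_cfc] assms by blast

lemma cfc_diff:
  assumes "continuous_on {-1..1} f" "continuous_on {-1..1} g"
  shows "cfc h (\<lambda>t. f t - g t) = cfc h f - cfc h g"
  using assms by (intro cfc_eqI poly_limit_diff poly_limit_cfc continuous_intros)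

lemma cfc_poly: "cfc h (poly p) = poly_at h p"
  by (rule cfc_eqI) (auto simp: poly_limit_def intro!: exI[of _ "\<lambda>n. p"] uniform_limit_const continuous_intros)

lemma cfc_one: "cfc h (\<lambda>t. 1) = 1"
proof -
  have "(\<lambda>t::real. 1) = poly [:1:]" by (simp add: fun_eq_iff)
  then have "cfc h (\<lambda>t. 1) = poly_at h [:1:]" by (simp only: cfc_poly)
  then show ?thesis by simp
qed

lemma cfc_id: "cfc h (\<lambda>t. t) = h"
proof -
  have "(\<lambda>t::real. t) = poly [:0, 1:]" by (simp add: fun_eq_iff)
  then have "cfc h (\<lambda>t. t) = poly_at h [:0, 1:]" by (simp only: cfc_poly)
  then show ?thesis by simp
qed

lemma cfc_zero: "cfc h (\<lambda>t. 0) = 0"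
proof -
  have "(\<lambda>t::real. 0) = poly 0" by (simp add: fun_eq_iff)
  then have "cfc h (\<lambda>t. 0) = poly_at h 0" by (simp only: cfc_poly)
  then show ?thesis by simp
qed

lemma cfc_add:
  assumes "continuous_on {-1..1} f" "continuous_on {-1..1} g"
  shows "cfc h (\<lambda>t. f t + g t) = cfc h f + cfc h g"
proof -
  have "cfc h (\<lambda>t. (f t + g t) - g t) = cfc h (\<lambda>t. f t + g t) - cfc h g"
    using assms by (intro cfc_diff continuous_intros)
  then show ?thesis by simp
qed

lemma cfc_mult:
  assumes f: "continuous_on {-1..1} f" and g: "continuous_on {-1..1} g"
  shows "cfc h (\<lambda>t. f t * g t) = cfc h f * cfc h g"
proof (rule cfc_eqI)
  obtain p q where p: "uniform_limit {-1..1} (\<lambda>n. poly (p n)) f sequentially" "(\<lambda>n::nat. poly_at h (p n)) \<longlonglongrightarrow> cfc h f"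
    and q: "uniform_limit {-1..1} (\<lambda>n. poly (q n)) g sequentially" "(\<lambda>n::nat. poly_at h (q n)) \<longlonglongrightarrow> cfc h g"
    using poly_limit_cfc[OF f] poly_limit_cfc[OF g] unfolding poly_limit_def by blast
  have "bounded (f ` {-1..1})" "bounded (g ` {-1..1})"
    using f g by (auto intro!: compact_imp_bounded compact_continuous_image)
  then have "uniform_limit {-1..1} (\<lambda>n t. poly (p n) t * poly (q n) t) (\<lambda>t. f t * g t) sequentially"
    by (intro uniform_lim_mult p q)
  moreover have "poly (p n * q n) = (\<lambda>t. poly (p n) t * poly (q n) t)" for n
    by (simp add: fun_eq_iff)
  moreover have "(\<lambda>n. poly_at h (p n * q n)) \<longlonglongrightarrow> cfc h f * cfc h g"
    unfolding poly_at_mult by (intro tendsto_mult p q)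
  ultimately show "poly_limit h (\<lambda>t. f t * g t) (cfc h f * cfc h g)"
    unfolding poly_limit_def by (intro exI[of _ "\<lambda>n. p n * q n"]) simp
qed (intro continuous_intros f g)

lemma cfc_scale:
  assumes "continuous_on {-1..1} f"
  shows "cfc h (\<lambda>t. c * f t) = c *\<^sub>R cfc h f"
proof -
  have "poly [:c:] = (\<lambda>t. c)" by (simp add: fun_eq_iff)
  then have "cfc h (\<lambda>t. c) = c *\<^sub>R 1" using cfc_poly[of "[:c:]"] by simp
  then show ?thesis using cfc_mult[OF continuous_on_const assms] by simp
qed

lemma cfc_adj:
  assumes "continuous_on {-1..1} f"
  shows "adj (cfc h f) = cfc h f"
proof -
  obtain p where "(\<lambda>n::nat. poly_at h (p n)) \<longlonglongrightarrow> cfc h f"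
    using poly_limit_cfc[OF assms] unfolding poly_limit_def by blast
  from this bounded_linear.tendsto[OF bounded_linear_adj this]
  show ?thesis unfolding adj_poly_at[OF h_self_adjoint] by (rule LIMSEQ_unique[rotated])
qed

lemma cfc_mult_zero:
  assumes "continuous_on {-1..1} f" "continuous_on {-1..1} g" "\<And>t. t \<in> {-1..1} \<Longrightarrow> f t * g t = 0"
  shows "cfc h f * cfc h g = 0"
proof -
  have "cfc h f * cfc h g = cfc h (\<lambda>t. f t * g t)" using assms by (simp add: cfc_mult)
  also have "\<dots> = cfc h (\<lambda>t. 0)" using assms by (intro cfc_cong continuous_intros) auto
  finally show ?thesis by (simp add: cfc_zero)
qed

end

section \<open>Locality of weak* limits\<close>

lemma norm_add_orthogonal:
  fixes y w :: "'a::cstar_algebra"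
  assumes "adj y * w = 0"
  shows "(norm (y + w))\<^sup>2 \<le> (norm y)\<^sup>2 + (norm w)\<^sup>2"
proof -
  have "adj w * y = adj (adj y * w)" by (simp add: adj_mult adj_adj)
  then have "adj w * y = 0" using assms by simp
  then have "adj (y + w) * (y + w) = adj y * y + adj w * w"
    using assms by (simp add: adj_add algebra_simps)
  then have "(norm (y + w))\<^sup>2 = norm (adj y * y + adj w * w)" by (metis cstar_identity)
  also have "\<dots> \<le> (norm y)\<^sup>2 + (norm w)\<^sup>2"
    using norm_triangle_ineq[of "adj y * y" "adj w * w"] by (simp add: cstar_identity)
  finally show ?thesis .
qed

text \<open>In the double sum for the square of the norm each index meets at most seven others, so the norm grows
like the square root of the number of terms instead of linearly.\<close>

lemma norm_sum_almost_orthogonal: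
  fixes D :: "nat \<Rightarrow> 'a::cstar_algebra"
  assumes orth: "\<And>i j. 4 \<le> \<bar>int i - int j\<bar> \<Longrightarrow> adj (D i) * D j = 0"
    and b: "\<And>i. norm (D i) \<le> b"
  shows "(norm (\<Sum>j<m. D j))\<^sup>2 \<le> m * (7 * b\<^sup>2)"
proof -
  have b0: "0 \<le> b" using b[of 0] norm_ge_zero order_trans by blast
  have adjsum: "adj (\<Sum>j<m. D j) = (\<Sum>j<m. adj (D j))" for m
    by (induction m) (auto simp: adj_add)
  have inner: "(\<Sum>j<m. norm (adj (D i) * D j)) \<le> 7 * b\<^sup>2" for i
  proof -
    let ?J = "{j. j < m \<and> \<bar>int i - int j\<bar> < 4}"
    have fin: "finite ?J" by simp
    have "(\<Sum>j<m. norm (adj (D i) * D j)) = (\<Sum>j\<in>?J. norm (adj (D i) * D j))"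
      
    proof (rule sum.mono_neutral_right)
      show "\<forall>j\<in>{..<m} - ?J. norm (adj (D i) * D j) = 0"
        using orth[of i] by (intro ballI) (simp, fastforce)
    qed auto
    also have "\<dots> \<le> (\<Sum>j\<in>?J. b\<^sup>2)"
    proof (rule sum_mono)
      fix j
      have "norm (adj (D i) * D j) \<le> norm (adj (D i)) * norm (D j)" by (rule norm_mult_ineq)
      also have "\<dots> \<le> b * b" using b b0 by (intro mult_mono) auto
      finally show "norm (adj (D i) * D j) \<le> b\<^sup>2" by (simp add: power2_eq_square)
    qed
    also have "\<dots> = card ?J * b\<^sup>2" by simp
    also have "\<dots> \<le> 7 * b\<^sup>2"
    proof (rule mult_right_mono)
      have "?J \<subseteq> {i - 3..i + 3}" by auto
      then have "card ?J \<le> card {i - 3..i + 3}" by (intro card_mono) auto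
      also have "\<dots> \<le> 7" by simp
      finally show "real (card ?J) \<le> 7" by simp
    qed simp
    finally show ?thesis .
  qed
  have "(norm (\<Sum>j<m. D j))\<^sup>2 = norm (\<Sum>i<m. \<Sum>j<m. adj (D i) * D j)"
    by (simp add: adjsum sum_product flip: cstar_identity)
  also have "\<dots> \<le> (\<Sum>i<m. \<Sum>j<m. norm (adj (D i) * D j))"
    by (rule order_trans[OF norm_sum sum_mono[OF norm_sum]])
  also have "\<dots> \<le> (\<Sum>i<m. 7 * b\<^sup>2)" by (intro sum_mono inner)
  finally show ?thesis by simp
qed

context
  fixes N :: "('a::cstar_algebra \<Rightarrow>\<^sub>L complex) set" and h :: 'a
    and U :: "'i filter" and x :: "'i \<Rightarrow> 'a" and C :: real
  assumes N: "predual N" and h: "spectral_contraction h"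
    and U: "ultrafilter U" and x: "\<And>i. norm (x i) \<le> C"
begin

text \<open>The map sending \<open>f\<close> to the weak* limit of \<open>f(h) x_i\<close>. The goal is \<open>limit_of f = f(h) (limit_of 1)\<close> for
\<open>f t = t\<close>. Bounded linear maps on the continuous functions with this module property for all \<open>f\<close> are exactly the
local ones, and locality is what lower semicontinuity of the norm provides.\<close>

definition limit_of :: "(real \<Rightarrow> real) \<Rightarrow> 'a"
  where "limit_of f = (SOME a. wconv N U (\<lambda>i. cfc h f * x i) a)"

lemma U_not_bot: "U \<noteq> bot"
  using U by (simp add: ultrafilter_def)

lemma C_nonneg: "0 \<le> C"
  using x order_trans norm_ge_zero by blast

lemma norm_cfc_mult_le:
  assumes "continuous_on {-1..1} f" "\<And>t. t \<in> {-1..1} \<Longrightarrow> \<bar>f t\<bar> \<le> M"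
  shows "norm (cfc h f * x i) \<le> M * C"
proof -
  have "norm (cfc h f) \<le> M" using cfc_norm_le[OF h] assms by blast
  moreover have "0 \<le> M" using assms(2)[of 0] by auto
  ultimately show ?thesis
    using norm_mult_ineq[of "cfc h f" "x i"] mult_mono[of "norm (cfc h f)" M "norm (x i)" C] x[of i]
    by auto
qed

lemma wconv_limit_of:
  assumes f: "continuous_on {-1..1} f"
  shows "wconv N U (\<lambda>i. cfc h f * x i) (limit_of f)"
proof -
  obtain M where "\<And>t. t \<in> {-1..1} \<Longrightarrow> \<bar>f t\<bar> \<le> M"
    using continuous_on_interval_bounded[OF f] by blast
  then have "norm (cfc h f * x i) \<le> M * C" for i by (rule norm_cfc_mult_le[OF f])
  then have "\<exists>a. wconv N U (\<lambda>i. cfc h f * x i) a" by (rule bounded_net_wconv[OF N U])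
  then show ?thesis unfolding limit_of_def by (rule someI_ex)
qed

lemma limit_of_eqI:
  "wconv N U (\<lambda>i. cfc h f * x i) a \<Longrightarrow> continuous_on {-1..1} f \<Longrightarrow> limit_of f = a"
  using wconv_unique[OF N U_not_bot wconv_limit_of] by blast

lemma norm_limit_of_le:
  assumes "continuous_on {-1..1} f" "\<And>t. t \<in> {-1..1} \<Longrightarrow> \<bar>f t\<bar> \<le> M"
  shows "norm (limit_of f) \<le> M * C"
  using wconv_norm_le[OF N U_not_bot wconv_limit_of[OF assms(1)]] norm_cfc_mult_le[OF assms] by auto

lemma limit_of_cong:
  assumes "continuous_on {-1..1} f" "continuous_on {-1..1} g" "\<And>t. t \<in> {-1..1} \<Longrightarrow> f t = g t"
  shows "limit_of f = limit_of g"
proof -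
  have "cfc h f = cfc h g" by (rule cfc_cong[OF h assms])
  then show ?thesis by (simp only: limit_of_def)
qed

lemma limit_of_diff:
  assumes "continuous_on {-1..1} f" "continuous_on {-1..1} g"
  shows "limit_of (\<lambda>t. f t - g t) = limit_of f - limit_of g"
  using wconv_diff[OF wconv_limit_of[OF assms(1)] wconv_limit_of[OF assms(2)]] assms
  by (intro limit_of_eqI) (auto simp: cfc_diff[OF h] algebra_simps intro: continuous_intros)

lemma limit_of_scale:
  assumes "continuous_on {-1..1} f"
  shows "limit_of (\<lambda>t. c * f t) = c *\<^sub>R limit_of f"
  using wconv_scaleR[OF wconv_limit_of[OF assms], of c] assms
  by (intro limit_of_eqI) (auto simp: cfc_scale[OF h] intro: continuous_intros)

lemma limit_of_add:
  assumes "continuous_on {-1..1} f" "continuous_on {-1..1} g"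
  shows "limit_of (\<lambda>t. f t + g t) = limit_of f + limit_of g"
  using wconv_add[OF wconv_limit_of[OF assms(1)] wconv_limit_of[OF assms(2)]] assms
  by (intro limit_of_eqI) (auto simp: cfc_add[OF h] algebra_simps intro: continuous_intros)

lemma limit_of_zero: "limit_of (\<lambda>t. 0) = 0"
  using wconv_const[of N U 0] by (intro limit_of_eqI) (auto simp: cfc_zero[OF h])

lemma limit_of_sum:
  assumes "\<And>j. continuous_on {-1..1} (e j)"
  shows "limit_of (\<lambda>t. \<Sum>j<m::nat. e j t) = (\<Sum>j<m. limit_of (e j))"
proof (induction m)
  case (Suc m)
  have "limit_of (\<lambda>t. (\<Sum>j<m. e j t) + e m t) = limit_of (\<lambda>t. \<Sum>j<m. e j t) + limit_of (e m)"
    by (intro limit_of_add continuous_intros assms)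
  then show ?case using Suc by simp
qed (simp add: limit_of_zero)

text \<open>Let \<open>v\<close> be the limit of \<open>f(h) x_i\<close> and let \<open>k, k'\<close> be cut-offs with \<open>k * k' = k\<close> and \<open>k' * f = 0\<close>. The summands of
\<open>f(h) x_i + n k'(h) v\<close> are orthogonal, so its norm is at most \<open>sqrt (B ^ 2 + (n * \<alpha>) ^ 2)\<close>, where \<open>B\<close> bounds
\<open>f(h) x_i\<close> and \<open>\<alpha>\<close> is the supremum of \<open>norm (k(h) v)\<close> over the cut-offs. By lower semicontinuity the same bound
holds for \<open>v + n k'(h) v\<close>, which \<open>k(h)\<close> maps to \<open>(1 + n) k(h) v\<close>. Hence \<open>(1 + n) * \<alpha>\<close> is at most
\<open>sqrt (B ^ 2 + (n * \<alpha>) ^ 2)\<close> for every \<open>n\<close>, which forces \<open>\<alpha> = 0\<close>. The auxiliary \<open>g\<close> measures the separation of the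
supports.\<close>

lemma locality_separated:
  fixes f g k :: "real \<Rightarrow> real" and \<delta> :: real
  assumes f: "continuous_on {-1..1} f" and k: "continuous_on {-1..1} k"
    and g: "continuous_on {-1..1} g" and \<delta>: "\<delta> > 0"
    and fg: "\<And>t. t \<in> {-1..1} \<Longrightarrow> \<bar>g t\<bar> < \<delta> \<Longrightarrow> f t = 0"
    and kg: "\<And>t. t \<in> {-1..1} \<Longrightarrow> \<delta> / 2 \<le> \<bar>g t\<bar> \<Longrightarrow> k t = 0"
    and k1: "\<And>t. t \<in> {-1..1} \<Longrightarrow> \<bar>k t\<bar> \<le> 1"
  shows "cfc h k * limit_of f = 0"
proof -
  define v where "v = limit_of f"
  define K :: "(real \<Rightarrow> real) set" where "K = {k. continuous_on {-1..1} k \<and> (\<forall>t\<in>{-1..1}. \<bar>k t\<bar> \<le> 1) \<and>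
    (\<exists>c. 0 \<le> c \<and> c < \<delta> \<and> (\<forall>t\<in>{-1..1}. c \<le> \<bar>g t\<bar> \<longrightarrow> k t = 0))}"
  \<comment> \<open>The strict bound \<open>c < \<delta>\<close> leaves room for a larger cut-off \<open>k'\<close> in \<open>K\<close> that is \<open>1\<close> on the support of \<open>k\<close>.\<close>
  define \<alpha> where "\<alpha> = (SUP k\<in>K. norm (cfc h k * v))"
  have kK: "k \<in> K" using k k1 kg \<delta> unfolding K_def by (auto intro!: exI[of _ "\<delta>/2"])
  have Kle: "norm (cfc h k * v) \<le> norm v" if "k \<in> K" for k
  proof -
    have "norm (cfc h k) \<le> 1" using that by (intro cfc_norm_le[OF h]) (auto simp: K_def)
    then show ?thesis
      using norm_mult_ineq[of "cfc h k" v] mult_right_mono[of "norm (cfc h k)" 1 "norm v"] by auto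
  qed
  then have bdd: "bdd_above ((\<lambda>k. norm (cfc h k * v)) ` K)" by (rule bdd_aboveI2)
  have le_\<alpha>: "norm (cfc h k * v) \<le> \<alpha>" if "k \<in> K" for k
    unfolding \<alpha>_def by (rule cSUP_upper[OF that bdd])
  have \<alpha>0: "0 \<le> \<alpha>" using le_\<alpha>[OF kK] norm_ge_zero order_trans by blast
  obtain M where M: "M > 0" "\<And>t. t \<in> {-1..1} \<Longrightarrow> \<bar>f t\<bar> \<le> M"
    using continuous_on_interval_bounded[OF f] by blast
  have step: "(1 + n) * norm (cfc h k * v) \<le> sqrt ((M * C)\<^sup>2 + (n * \<alpha>)\<^sup>2)" if n: "n \<ge> 0" and kK: "k \<in> K" for n k
  proof -
    obtain c where c: "0 \<le> c" "c < \<delta>" "\<And>t. t \<in> {-1..1} \<Longrightarrow> c \<le> \<bar>g t\<bar> \<Longrightarrow> k t = 0"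
      and k: "continuous_on {-1..1} k"
      using kK unfolding K_def by blast
    define d where "d = (c + \<delta>) / 2"
    have d: "c < d" "d < \<delta>" "0 \<le> d" using c by (auto simp: d_def)
    define k' where "k' = (\<lambda>t. max 0 (min 1 ((d - \<bar>g t\<bar>) / (d - c))))"
    have k': "continuous_on {-1..1} k'"
      unfolding k'_def by (intro continuous_intros g) (use d in auto)
    have k'K: "k' \<in> K"
      unfolding K_def using k' d by (auto simp: k'_def divide_le_0_iff intro!: exI[of _ d])
    have "cfc h f * cfc h k' = 0"
    proof (rule cfc_mult_zero[OF h f k'])
      fix t :: real assume t: "t \<in> {-1..1}"
      show "f t * k' t = 0"
      proof (cases "\<bar>g t\<bar> < \<delta>")
        case False
        then have "(d - \<bar>g t\<bar>) / (d - c) \<le> 0" using d by (simp add: divide_le_0_iff)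
        then show ?thesis by (simp add: k'_def)
      qed (use fg t in auto)
    qed
    then have "adj (cfc h f * x i) * (n *\<^sub>R (cfc h k' * v)) = 0" for i
      by (simp add: adj_mult cfc_adj[OF h f] mult.assoc) (simp flip: mult.assoc add: mult.assoc[of "adj (x i)"])
    from norm_add_orthogonal[OF this]
    have "(norm (cfc h f * x i + n *\<^sub>R (cfc h k' * v)))\<^sup>2 \<le> (M * C)\<^sup>2 + (n * \<alpha>)\<^sup>2" for i
    proof -
      have "norm (cfc h f * x i) \<le> M * C" by (rule norm_cfc_mult_le[OF f M(2)])
      moreover have "norm (n *\<^sub>R (cfc h k' * v)) \<le> n * \<alpha>"
        using le_\<alpha>[OF k'K] n by (simp add: mult_left_mono)
      ultimately show ?thesis
        using norm_add_orthogonal[OF \<open>adj (cfc h f * x i) * (n *\<^sub>R (cfc h k' * v)) = 0\<close>]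
          power_mono[of "norm (cfc h f * x i)" "M * C" 2] power_mono[of "norm (n *\<^sub>R (cfc h k' * v))" "n * \<alpha>" 2]
        by auto
    qed
    then have "norm (cfc h f * x i + n *\<^sub>R (cfc h k' * v)) \<le> sqrt ((M * C)\<^sup>2 + (n * \<alpha>)\<^sup>2)" for i
      using real_le_rsqrt by blast
    then have le: "norm (v + n *\<^sub>R (cfc h k' * v)) \<le> sqrt ((M * C)\<^sup>2 + (n * \<alpha>)\<^sup>2)"
      unfolding v_def
      by (intro wconv_norm_le[OF N U_not_bot wconv_add[OF wconv_limit_of[OF f] wconv_const]]) auto
    have "cfc h k * cfc h k' = cfc h k"
    proof -
      have "k t * k' t = k t" if "t \<in> {-1..1}" for t
      proof (cases "c \<le> \<bar>g t\<bar>")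
        case False
        then have "1 \<le> (d - \<bar>g t\<bar>) / (d - c)" using d by (simp add: le_divide_eq)
        then show ?thesis by (simp add: k'_def)
      qed (use c that in auto)
      then have "cfc h (\<lambda>t. k t * k' t) = cfc h k" using k k' by (intro cfc_cong[OF h] continuous_intros) auto
      then show ?thesis by (simp add: cfc_mult[OF h k k'])
    qed
    then have "cfc h k * (v + n *\<^sub>R (cfc h k' * v)) = (1 + n) *\<^sub>R (cfc h k * v)"
      by (simp add: distrib_left scaleR_add_left flip: mult.assoc)
    then have "(1 + n) * norm (cfc h k * v) = norm (cfc h k * (v + n *\<^sub>R (cfc h k' * v)))"
      using n by simp
    also have "\<dots> \<le> norm (cfc h k) * norm (v + n *\<^sub>R (cfc h k' * v))" by (rule norm_mult_ineq)
    also have "\<dots> \<le> 1 * norm (v + n *\<^sub>R (cfc h k' * v))"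
      using kK by (intro mult_right_mono cfc_norm_le[OF h]) (auto simp: K_def)
    finally show ?thesis using le by simp
  qed
  have "(1 + n) * \<alpha> \<le> sqrt ((M * C)\<^sup>2 + (n * \<alpha>)\<^sup>2)" if n: "n \<ge> 0" for n
  proof -
    have "\<alpha> \<le> sqrt ((M * C)\<^sup>2 + (n * \<alpha>)\<^sup>2) / (1 + n)"
      using step[OF n] kK n by (subst \<alpha>_def, intro cSUP_least) (auto simp: le_divide_eq mult.commute)
    then show ?thesis using n by (simp add: le_divide_eq mult.commute)
  qed
  then have sq: "((1 + n) * \<alpha>)\<^sup>2 \<le> (M * C)\<^sup>2 + (n * \<alpha>)\<^sup>2" if "n \<ge> 0" for n
    using real_sqrt_le_iff that by (smt (verit) \<alpha>0 mult_nonneg_nonneg power_mono real_sqrt_pow2 zero_le_power2)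
  have main: "\<alpha>\<^sup>2 * (1 + 2 * n) \<le> (M * C)\<^sup>2" if "n \<ge> 0" for n
    using sq[OF that] by (simp add: power2_eq_square algebra_simps)
  have "\<alpha> = 0"
  proof (rule ccontr)
    assume "\<alpha> \<noteq> 0"
    then have a: "\<alpha>\<^sup>2 > 0" by simp
    have "\<alpha>\<^sup>2 * (1 + 2 * ((M * C)\<^sup>2 / \<alpha>\<^sup>2)) \<le> (M * C)\<^sup>2" by (rule main) simp
    then have "\<alpha>\<^sup>2 + 2 * (M * C)\<^sup>2 \<le> (M * C)\<^sup>2" using a by (simp add: distrib_left)
    then show False using a by (smt (verit) zero_le_power2)
  qed
  then show ?thesis using le_\<alpha>[OF kK] by (simp add: v_def)
qed

text \<open>Truncating \<open>f\<close> at height \<open>\<delta>\<close> separates its support from that of \<open>k\<close> and changes \<open>limit_of f\<close> by at most \<open>\<delta> * C\<close>.\<close>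

lemma locality:
  fixes f k :: "real \<Rightarrow> real"
  assumes f: "continuous_on {-1..1} f" and k: "continuous_on {-1..1} k"
    and kf: "\<And>t. t \<in> {-1..1} \<Longrightarrow> k t * f t = 0"
  shows "cfc h k * limit_of f = 0"
proof -
  obtain M where M: "M > 0" "\<And>t. t \<in> {-1..1} \<Longrightarrow> \<bar>k t\<bar> \<le> M"
    using continuous_on_interval_bounded[OF k] by blast
  have "norm (cfc h k * limit_of f) \<le> M * (\<delta> * C)" if \<delta>: "\<delta> > 0" for \<delta>
  proof -
    define g where "g = (\<lambda>t. f t - max (- \<delta>) (min \<delta> (f t)))"
    have g: "continuous_on {-1..1} g" unfolding g_def by (intro continuous_intros f)
    have "cfc h (\<lambda>t. inverse M * k t) * limit_of g = 0"
    proof (rule locality_separated[where g = f and \<delta> = \<delta>])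
      show "continuous_on {-1..1} (\<lambda>t. inverse M * k t)" by (intro continuous_intros k)
    next
      fix t :: real assume t: "t \<in> {-1..1}"
      show "\<bar>inverse M * k t\<bar> \<le> 1" using M(1) M(2)[OF t] by (simp add: abs_mult field_simps)
      assume "\<delta> / 2 \<le> \<bar>f t\<bar>"
      then show "inverse M * k t = 0" using kf[OF t] \<delta> by auto
    qed (use f g \<delta> in \<open>auto simp: g_def\<close>)
    then have "cfc h k * limit_of g = 0" using M(1) by (simp add: cfc_scale[OF h k])
    then have "cfc h k * limit_of f = cfc h k * limit_of (\<lambda>t. f t - g t)"
      by (simp add: limit_of_diff[OF f g] right_diff_distrib)
    also have "norm \<dots> \<le> norm (cfc h k) * norm (limit_of (\<lambda>t. f t - g t))" by (rule norm_mult_ineq)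
    also have "\<dots> \<le> M * (\<delta> * C)"
      using M \<delta> by (intro mult_mono cfc_norm_le[OF h k] norm_limit_of_le continuous_intros f g)
        (auto simp: g_def)
    finally show ?thesis .
  qed
  then have "norm (cfc h k * limit_of f) \<le> 0 + e" if "e > 0" for e
  proof -
    have "norm (cfc h k * limit_of f) \<le> M * (e / (M * (C + 1)) * C)"
      using that M C_nonneg by (intro \<open>\<And>\<delta>. \<delta> > 0 \<Longrightarrow> norm (cfc h k * limit_of f) \<le> M * (\<delta> * C)\<close>) auto
    also have "\<dots> = e * (C / (C + 1))" using M(1) by simp
    also have "\<dots> \<le> e * 1" using that C_nonneg by (intro mult_left_mono) auto
    finally show ?thesis by simp
  qed
  then have "norm (cfc h k * limit_of f) \<le> 0" by (rule field_le_epsilon)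
  then show ?thesis by simp
qed

text \<open>For a partition of unity \<open>e_j\<close> of mesh \<open>1 / n\<close>, locality lets each defect \<open>D_j = h (limit_of e_j) - limit_of (t e_j)\<close>
be computed near the point \<open>c_j\<close>, so its norm is of order \<open>1 / n\<close>. Defects with distant indices are orthogonal.
Thus about \<open>2 n\<close> almost orthogonal terms of size \<open>1 / n\<close> add up to a vector of size about \<open>1 / sqrt n\<close>.\<close>

lemma limit_of_id_estimate:
  assumes n: "n \<ge> (1::nat)"
  shows "(norm (h * limit_of (\<lambda>t. 1) - limit_of (\<lambda>t. t)))\<^sup>2 \<le> real (2 * n + 1) * (7 * (3 * C / n)\<^sup>2)"
proof -
  \<comment> \<open>The ramp \<open>r 0\<close> is \<open>1\<close> and \<open>r (2 * n + 1)\<close> is \<open>0\<close> on \<open>[-1, 1]\<close>, so the bumps \<open>e j\<close> telescope to \<open>1\<close>.\<close>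
  define r where "r = (\<lambda>j t. max 0 (min 1 (real n * (t + 1) + 1 - real j)))"
  define e where "e = (\<lambda>j t. r j t - r (Suc j) t)"
  \<comment> \<open>\<open>\<kappa> j\<close> is \<open>1\<close> on the support of \<open>e j\<close> and vanishes at distance \<open>2 / n\<close> from \<open>c j\<close>.\<close>
  define \<kappa> where "\<kappa> = (\<lambda>j t. max 0 (min 1 (2 - \<bar>real n * (t + 1) - real j\<bar>)))"
  define c where "c = (\<lambda>j. real j / n - 1)"
  define D where "D = (\<lambda>j. h * limit_of (e j) - limit_of (\<lambda>t. t * e j t))"
  let ?m = "2 * n + 1"
  have n0: "real n > 0" using n by simp
  have ce: "continuous_on {-1..1} (e j)" for j unfolding e_def r_def by (intro continuous_intros)
  have c\<kappa>: "continuous_on {-1..1} (\<kappa> j)" for j unfolding \<kappa>_def by (intro continuous_intros)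
  have e0: "0 \<le> e j t" "e j t \<le> 1" for j t unfolding e_def r_def by auto
  have supp: "e j t = 0" if "1 \<le> \<bar>real n * (t + 1) - real j\<bar>" for j t
    using that unfolding e_def r_def by auto
  have near: "\<bar>t - c j\<bar> = \<bar>real n * (t + 1) - real j\<bar> / n" for t j
  proof -
    have "t - c j = (real n * (t + 1) - real j) / n" using n0 by (simp add: c_def field_simps)
    then show ?thesis by simp
  qed
  have \<kappa>e: "\<kappa> j t = 1 \<or> e j t = 0" for j t
    using supp[of t j] unfolding \<kappa>_def by linarith
  have local_unit: "cfc h (\<kappa> j) * limit_of f = limit_of f"
    if f: "continuous_on {-1..1} f" "\<And>t. f t = 0 \<or> e j t \<noteq> 0" for f j
  proof -
    have "cfc h (\<lambda>t. 1 - \<kappa> j t) * limit_of f = 0"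
      using f \<kappa>e[of j] by (intro locality continuous_intros c\<kappa>) (metis diff_self mult_zero_left mult_zero_right)+
    then show ?thesis by (simp add: cfc_diff[OF h _ c\<kappa>] cfc_one[OF h] left_diff_distrib)
  qed
  have u1: "cfc h (\<kappa> j) * limit_of (e j) = limit_of (e j)" for j
    by (rule local_unit[OF ce]) auto
  have u2: "cfc h (\<kappa> j) * limit_of (\<lambda>t. t * e j t) = limit_of (\<lambda>t. t * e j t)" for j
    by (rule local_unit) (auto intro!: continuous_intros ce)
  have comm: "cfc h (\<kappa> j) * h = h * cfc h (\<kappa> j)" for j
    using cfc_mult[OF h c\<kappa>[of j] continuous_on_id] cfc_mult[OF h continuous_on_id c\<kappa>[of j]]
    by (simp add: cfc_id[OF h] mult.commute)
  have D\<kappa>: "cfc h (\<kappa> j) * D j = D j" for j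
  proof -
    have "cfc h (\<kappa> j) * D j = h * (cfc h (\<kappa> j) * limit_of (e j)) - cfc h (\<kappa> j) * limit_of (\<lambda>t. t * e j t)"
      unfolding D_def right_diff_distrib by (simp only: comm flip: mult.assoc)
    then show ?thesis by (simp add: u1 u2 D_def)
  qed
  have orth: "adj (D i) * D j = 0" if ij: "4 \<le> \<bar>int i - int j\<bar>" for i j
  proof -
    have "cfc h (\<kappa> i) * cfc h (\<kappa> j) = 0"
    proof (rule cfc_mult_zero[OF h c\<kappa> c\<kappa>])
      fix t :: real
      have "4 \<le> \<bar>real i - real j\<bar>" using ij by linarith
      then have "2 \<le> \<bar>real n * (t + 1) - real i\<bar> \<or> 2 \<le> \<bar>real n * (t + 1) - real j\<bar>" by linarith
      then show "\<kappa> i t * \<kappa> j t = 0" unfolding \<kappa>_def by auto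
    qed
    moreover have "adj (D i) * D j = adj (D i) * (cfc h (\<kappa> i) * cfc h (\<kappa> j)) * D j"
    proof -
      have "adj (D i) * D j = adj (cfc h (\<kappa> i) * D i) * (cfc h (\<kappa> j) * D j)" by (simp add: D\<kappa>)
      then show ?thesis by (simp add: adj_mult cfc_adj[OF h c\<kappa>] mult.assoc)
    qed
    ultimately show ?thesis by simp
  qed
  have bound: "norm (D j) \<le> 3 * C / n" for j
  proof -
    have c1: "continuous_on {-1..1} (\<lambda>t. (t - c j) * \<kappa> j t)" and c2: "continuous_on {-1..1} (\<lambda>t. (t - c j) * e j t)"
      by (intro continuous_intros c\<kappa> ce)+
    have "cfc h (\<lambda>t. c j) = c j *\<^sub>R 1"
      using cfc_scale[OF h continuous_on_const[of "{-1..1}" 1], of "c j"] by (simp add: cfc_one[OF h])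
    then have h1: "cfc h (\<lambda>t. t - c j) = h - c j *\<^sub>R 1"
      by (simp add: cfc_diff[OF h] continuous_intros cfc_id[OF h])
    have "limit_of (\<lambda>t. (t - c j) * e j t) = limit_of (\<lambda>t. t * e j t) - c j *\<^sub>R limit_of (e j)"
      by (simp add: left_diff_distrib limit_of_diff limit_of_scale ce continuous_intros)
    moreover have "cfc h (\<lambda>t. (t - c j) * \<kappa> j t) * limit_of (e j) = h * limit_of (e j) - c j *\<^sub>R limit_of (e j)"
    proof -
      have "continuous_on {-1..1} (\<lambda>t. t - c j)" by (intro continuous_intros)
      from cfc_mult[OF h this c\<kappa>[of j]] show ?thesis
        unfolding h1 by (simp only: mult.assoc u1) (simp add: left_diff_distrib)
    qed
    ultimately have "D j = cfc h (\<lambda>t. (t - c j) * \<kappa> j t) * limit_of (e j) - limit_of (\<lambda>t. (t - c j) * e j t)"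
      by (simp add: D_def)
    then have "norm (D j) \<le> norm (cfc h (\<lambda>t. (t - c j) * \<kappa> j t)) * norm (limit_of (e j))
        + norm (limit_of (\<lambda>t. (t - c j) * e j t))"
      using norm_triangle_ineq4 norm_mult_ineq by (metis (no_types, lifting) add_right_mono order_trans)
    also have "\<dots> \<le> 2 / n * (1 * C) + 1 / n * C"
    proof (intro add_mono mult_mono cfc_norm_le[OF h c1] norm_limit_of_le ce c2)
      fix t :: real
      show "\<bar>(t - c j) * \<kappa> j t\<bar> \<le> 2 / n"
      proof (cases "2 \<le> \<bar>real n * (t + 1) - real j\<bar>")
        case True
        then have "\<kappa> j t = 0" by (simp add: \<kappa>_def)
        then show ?thesis by simp
      next
        case False
        then have "\<bar>t - c j\<bar> \<le> 2 / n" unfolding near using n0 by (intro divide_right_mono) auto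
        moreover have "0 \<le> \<kappa> j t" "\<kappa> j t \<le> 1" by (auto simp: \<kappa>_def)
        ultimately show ?thesis using mult_mono[of "\<bar>t - c j\<bar>" "2/n" "\<kappa> j t" 1] by (auto simp: abs_mult)
      qed
      show "\<bar>e j t\<bar> \<le> 1" using e0[of j t] by simp
      show "\<bar>(t - c j) * e j t\<bar> \<le> 1 / n"
      proof (cases "1 \<le> \<bar>real n * (t + 1) - real j\<bar>")
        case True
        then show ?thesis by (simp add: supp)
      next
        case False
        then have "\<bar>t - c j\<bar> \<le> 1 / n" unfolding near using n0 by (intro divide_right_mono) auto
        then show ?thesis using mult_mono[of "\<bar>t - c j\<bar>" "1/n" "e j t" 1] e0[of j t] by (auto simp: abs_mult)
      qed
    qed auto
    finally show ?thesis by simp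
  qed
  have part: "(\<Sum>j<?m. e j t) = 1" if "t \<in> {-1..1}" for t
  proof -
    have "(\<Sum>j<?m. e j t) = r 0 t - r ?m t" unfolding e_def by (rule sum_lessThan_telescope')
    moreover have "0 \<le> real n * (t + 1)" "real n * (t + 1) \<le> real n * 2"
      using that by (auto intro!: mult_left_mono)
    ultimately show ?thesis by (simp add: r_def)
  qed
  have "(\<Sum>j<?m. D j) = h * (\<Sum>j<?m. limit_of (e j)) - (\<Sum>j<?m. limit_of (\<lambda>t. t * e j t))"
    by (simp only: D_def sum_subtractf sum_distrib_left)
  also have "(\<Sum>j<?m. limit_of (e j)) = limit_of (\<lambda>t. 1)"
    unfolding limit_of_sum[of e, OF ce, symmetric]
    by (intro limit_of_cong continuous_intros ce part)
  also have "(\<Sum>j<?m. limit_of (\<lambda>t. t * e j t)) = limit_of (\<lambda>t. t)"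
  proof -
    have "(\<Sum>j<?m. limit_of (\<lambda>t. t * e j t)) = limit_of (\<lambda>t. \<Sum>j<?m. t * e j t)"
      by (rule limit_of_sum[symmetric]) (intro continuous_intros ce)
    also have "\<dots> = limit_of (\<lambda>t. t)"
    proof (intro limit_of_cong continuous_intros ce)
      fix t :: real assume "t \<in> {-1..1}"
      then show "(\<Sum>j<?m. t * e j t) = t" using part by (simp only: mult_1_right flip: sum_distrib_left)
    qed
    finally show ?thesis .
  qed
  finally show ?thesis using norm_sum_almost_orthogonal[of D "3 * C / n" ?m] orth bound by simp
qed

lemma limit_of_id: "limit_of (\<lambda>t. t) = h * limit_of (\<lambda>t. 1)"
proof -
  let ?d = "norm (h * limit_of (\<lambda>t. 1) - limit_of (\<lambda>t. t))"
  have "?d\<^sup>2 \<le> 0"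
  proof (rule LIMSEQ_le_const)
    show "(\<lambda>n. 189 * C\<^sup>2 * (1 / real n)) \<longlonglongrightarrow> 0"
      using tendsto_mult[OF tendsto_const lim_1_over_n] by simp
    show "\<exists>k. \<forall>n\<ge>k. ?d\<^sup>2 \<le> 189 * C\<^sup>2 * (1 / real n)"
    proof (intro exI[of _ 1] allI impI)
      fix n :: nat assume n: "1 \<le> n"
      have "?d\<^sup>2 \<le> real (2 * n + 1) * (7 * (3 * C / n)\<^sup>2)" by (rule limit_of_id_estimate[OF n])
      also have "\<dots> \<le> (3 * real n) * (7 * (3 * C / n)\<^sup>2)"
        using n by (intro mult_right_mono) auto
      also have "\<dots> = 189 * C\<^sup>2 * (1 / real n)"
        using n by (simp add: power2_eq_square field_simps)
      finally show "?d\<^sup>2 \<le> 189 * C\<^sup>2 * (1 / real n)" .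
    qed
  qed
  then show ?thesis by simp
qed

lemma wconv_spectral_contraction_mult:
  assumes "wconv N U x a"
  shows "wconv N U (\<lambda>i. h * x i) (h * a)"
proof -
  have "limit_of (\<lambda>t. 1) = a"
    using assms by (intro limit_of_eqI) (auto simp: cfc_one[OF h])
  then show ?thesis
    using wconv_limit_of[of "\<lambda>t. t"] by (simp add: cfc_id[OF h] limit_of_id continuous_intros)
qed

end

section \<open>Weak* continuity of left multiplication\<close>

lemma spectral_contraction_real_part_unitary:
  assumes "adj u * u = 1" "u * adj u = (1::'a::cstar_algebra)"
  shows "spectral_contraction ((1/2) *\<^sub>R (u + adj u))"
  unfolding spectral_contraction_def
  using norm_poly_at_le[OF assms refl]
  by (auto simp: adj_scaleR adj_add adj_adj add.commute)

lemma neumann_inverse: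
  fixes c :: "'a::cstar_algebra"
  assumes c: "norm c \<le> 1/2"
  obtains b where "(1 - c) * b = 1" "b * (1 - c) = 1" "norm b \<le> 2"
proof -
  have le: "norm (c ^ n) \<le> (1/2) ^ n" for n
    using norm_power_le[of c n] power_mono[OF c norm_ge_zero, of n] by linarith
  have sn: "summable (\<lambda>n. norm (c ^ n))"
    by (rule summable_comparison_test'[of "\<lambda>n. (1/2) ^ n" 0]) (use le in \<open>auto intro: summable_geometric\<close>)
  then have s: "summable (\<lambda>n. c ^ n)" by (rule summable_norm_cancel)
  define b where "b = (\<Sum>n. c ^ n)"
  have split: "b = 1 + (\<Sum>n. c ^ Suc n)"
    unfolding b_def using suminf_split_head[OF s] by (simp add: algebra_simps)
  have "(\<Sum>n. c ^ Suc n) = c * b"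
    unfolding b_def power_Suc by (rule suminf_mult[OF s])
  moreover have "(\<Sum>n. c ^ Suc n) = b * c"
    unfolding b_def power_Suc2 by (rule suminf_mult2[OF s, symmetric])
  ultimately have "(1 - c) * b = 1" "b * (1 - c) = 1"
    using split by (simp_all add: algebra_simps)
  moreover have "norm b \<le> 2"
  proof -
    have "norm b \<le> (\<Sum>n. norm (c ^ n))" unfolding b_def by (rule summable_norm[OF sn])
    also have "\<dots> \<le> (\<Sum>n. (1/2) ^ n)"
      by (rule suminf_le) (use le sn in \<open>auto intro: summable_geometric\<close>)
    also have "\<dots> = 2" by (subst suminf_geometric) auto
    finally show ?thesis .
  qed
  ultimately show ?thesis using that by blast
qed

text \<open>The Cayley transform \<open>(1 + c) / (1 - c)\<close> of a skew-adjoint element.\<close>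

lemma cayley_unitary:
  fixes c b :: "'a::cstar_algebra"
  assumes c: "adj c = - c" and b: "(1 - c) * b = 1" "b * (1 - c) = 1"
  defines "u \<equiv> (1 + c) * b"
  shows "adj u * u = 1" "u * adj u = 1"
proof -
  have ab: "adj b * (1 + c) = 1" "(1 + c) * adj b = 1"
  proof -
    have "adj ((1 - c) * b) = 1" "adj (b * (1 - c)) = 1" by (simp_all only: b adj_one)
    then show "adj b * (1 + c) = 1" "(1 + c) * adj b = 1"
      by (simp_all add: adj_mult adj_diff c)
  qed
  have cb: "c * b = b * c"
    using b by (simp add: algebra_simps) (metis add_left_cancel add_diff_cancel_left' diff_add_cancel)
  have au: "adj u = adj b * (1 - c)" by (simp add: u_def adj_mult adj_add c)
  have "adj u * u = adj b * ((1 - c) * (1 + c)) * b" unfolding au by (simp only: u_def mult.assoc)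
  also have "(1 - c) * (1 + c) = (1 + c) * (1 - c)" by (simp add: algebra_simps)
  also have "adj b * \<dots> * b = (adj b * (1 + c)) * ((1 - c) * b)" by (simp only: mult.assoc)
  finally show "adj u * u = 1" by (simp add: ab b)
  have "u = b * (1 + c)" by (simp add: u_def cb algebra_simps)
  then have "u * adj u = b * ((1 + c) * adj b) * (1 - c)" unfolding au by (simp only: mult.assoc)
  then show "u * adj u = 1" by (simp add: ab b)
qed

context
  fixes N :: "('a::cstar_algebra \<Rightarrow>\<^sub>L complex) set" and U :: "'i filter"
  assumes N: "predual N" and U: "ultrafilter U"
begin

text \<open>The ultrafilter, and with it the index type of the nets, is fixed: a definition cannot quantify over
index types.\<close>

definition left_wcont :: "'a \<Rightarrow> bool"
  where "left_wcont y \<longleftrightarrow> (\<forall>x a C. (\<forall>i. norm (x i) \<le> C) \<longrightarrow> wconv N U x a \<longrightarrow>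
    wconv N U (\<lambda>i. y * x i) (y * a))"

lemma left_wcont_one: "left_wcont 1"
  by (simp add: left_wcont_def)

lemma left_wcont_add: "left_wcont y \<Longrightarrow> left_wcont z \<Longrightarrow> left_wcont (y + z)"
  unfolding left_wcont_def distrib_right by (intro allI impI wconv_add) blast+

lemma left_wcont_scaleC: "left_wcont y \<Longrightarrow> left_wcont (c *\<^sub>C y)"
  unfolding left_wcont_def scaleC_mult_left by (intro allI impI wconv_scaleC[OF N]) blast

lemma left_wcont_spectral_contraction: "spectral_contraction h \<Longrightarrow> left_wcont h"
  unfolding left_wcont_def using wconv_spectral_contraction_mult[OF N _ U] by blast

text \<open>The unitary is a combination of the real parts of \<open>u\<close> and of \<open>-i u\<close>.\<close>

lemma left_wcont_unitary:
  assumes u: "adj u * u = 1" "u * adj u = 1"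
  shows "left_wcont u"
proof -
  let ?v = "(- \<i>) *\<^sub>C u"
  have av: "adj ?v = \<i> *\<^sub>C adj u" by (simp add: adj_scaleC)
  have half: "(1/2) *\<^sub>R x = (1/2) *\<^sub>C x" for x :: 'a
    using scaleC_of_real[of "1/2" x] by simp
  have "adj ?v * ?v = 1" "?v * adj ?v = 1"
    unfolding av by (simp_all add: scaleC_mult_left scaleC_mult_right scaleC_scaleC u scaleC_minus_left scaleC_minus_right)
  then have "left_wcont ((1/2) *\<^sub>R (?v + adj ?v))"
    by (intro left_wcont_spectral_contraction spectral_contraction_real_part_unitary)
  moreover have "left_wcont ((1/2) *\<^sub>R (u + adj u))"
    by (intro left_wcont_spectral_contraction spectral_contraction_real_part_unitary u)
  ultimately have "left_wcont ((1/2) *\<^sub>R (u + adj u) + \<i> *\<^sub>C ((1/2) *\<^sub>R (?v + adj ?v)))"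
    by (intro left_wcont_add left_wcont_scaleC)
  moreover have "(1/2) *\<^sub>R (u + adj u) + \<i> *\<^sub>C ((1/2) *\<^sub>R (?v + adj ?v)) = u"
  proof -
    have "(1/2) *\<^sub>R (u + adj u) + \<i> *\<^sub>C ((1/2) *\<^sub>R (?v + adj ?v))
        = ((1/2) *\<^sub>C u + (1/2) *\<^sub>C u) + ((1/2) *\<^sub>C adj u + (-1/2) *\<^sub>C adj u)"
      unfolding half av by (simp add: scaleC_add_right scaleC_diff_right scaleC_scaleC scaleC_minus_right scaleC_minus_left algebra_simps)
    also have "\<dots> = u" by (simp flip: scaleC_add_left)
    finally show ?thesis .
  qed
  ultimately show ?thesis by simp
qed

lemma left_wcont_closed:
  assumes y: "\<And>e. e > 0 \<Longrightarrow> \<exists>z. left_wcont z \<and> norm (y - z) \<le> e"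
  shows "left_wcont y"
  unfolding left_wcont_def
proof (intro allI impI)
  fix x a C assume x: "\<forall>i. norm (x i) \<le> C" and a: "wconv N U x a"
  have nb: "U \<noteq> bot" using U by (simp add: ultrafilter_def)
  have C0: "0 \<le> C" using x norm_ge_zero order_trans by blast
  have an: "norm a \<le> C" using wconv_norm_le[OF N nb a] x by simp
  have bd: "norm (z * x i) \<le> norm z * C" for z i
    using norm_mult_ineq[of z "x i"] mult_left_mono[OF x[rule_format, of i] norm_ge_zero[of z]] by linarith
  obtain v where v: "wconv N U (\<lambda>i. y * x i) v"
    using bounded_net_wconv[OF N U, of "\<lambda>i. y * x i", OF bd] by (elim exE)
  have "norm (v - y * a) \<le> 0 + e" if e: "e > 0" for e
  proof -
    define d where "d = e / (2 * (C + 1))"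
    have d: "d > 0" "d * C + d * C \<le> e"
    proof -
      show "d > 0" using e C0 by (simp add: d_def)
      have "C + 1 \<noteq> 0" using C0 by simp
      then have "d + d = e / (C + 1)" unfolding d_def by (simp add: divide_simps)
      then have "d * C + d * C = e * (C / (C + 1))" by (simp flip: distrib_right)
      also have "\<dots> \<le> e * 1" using e C0 by (intro mult_left_mono) auto
      finally show "d * C + d * C \<le> e" by simp
    qed
    obtain z where z: "left_wcont z" "norm (y - z) \<le> d" using y[OF d(1)] by blast
    have "wconv N U (\<lambda>i. z * x i) (z * a)" using z(1) x a unfolding left_wcont_def by blast
    from wconv_diff[OF v this] have "wconv N U (\<lambda>i. (y - z) * x i) (v - z * a)"
      by (simp add: left_diff_distrib)
    then have "norm (v - z * a) \<le> norm (y - z) * C"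
      using bd by (intro wconv_norm_le[OF N nb]) auto
    also have "\<dots> \<le> d * C" using z(2) C0 by (intro mult_right_mono)
    finally have 1: "norm (v - z * a) \<le> d * C" .
    have "norm ((y - z) * a) \<le> norm (y - z) * norm a" by (rule norm_mult_ineq)
    also have "\<dots> \<le> d * C" using z(2) an d(1) by (intro mult_mono) auto
    finally have 2: "norm ((y - z) * a) \<le> d * C" .
    have eq: "v - y * a = (v - z * a) - (y - z) * a" by (simp add: algebra_simps)
    show ?thesis unfolding eq
      using norm_triangle_ineq4[of "v - z * a" "(y - z) * a"] 1 2 d(2) by linarith
  qed
  then have "norm (v - y * a) \<le> 0" by (rule field_le_epsilon)
  then show "wconv N U (\<lambda>i. y * x i) (y * a)" using v by simp
qed

text \<open>The Cayley transform of \<open>c = i s g\<close> equals \<open>2 b - 1\<close> with \<open>b = 1 / (1 - c)\<close>, so multiplication by \<open>b\<close> is continuous.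
Since \<open>b - 1 = c b = i s g b\<close>, the difference quotient \<open>(b - 1) / (i s)\<close> equals \<open>g b\<close> and tends to \<open>g\<close> as \<open>s\<close> tends to \<open>0\<close>.\<close>

lemma left_wcont_self_adjoint:
  assumes g: "adj g = g"
  shows "left_wcont g"
proof (rule left_wcont_closed)
  fix e :: real assume e: "e > 0"
  define G where "G = norm g"
  \<comment> \<open>The first bound makes the Neumann series converge, the second makes \<open>norm (g - g * b) \<le> e\<close>.\<close>
  define s where "s = min (1 / (2 * (G + 1))) (e / (2 * (G * G + 1)))"
  have G0: "0 \<le> G" by (simp add: G_def)
  have GG: "0 < G * G + 1" using G0 by (smt (verit) mult_nonneg_nonneg)
  have s0: "s > 0" unfolding s_def using e G0 GG by simp
  have "s * G \<le> 1 / (2 * (G + 1)) * G" using G0 by (intro mult_right_mono) (auto simp: s_def)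
  also have "\<dots> \<le> 1/2" using G0 by (simp add: field_simps)
  finally have sG: "s * G \<le> 1/2" .
  have "s * (G * G) \<le> e / (2 * (G * G + 1)) * (G * G)" by (intro mult_right_mono) (auto simp: s_def)
  also have "\<dots> \<le> e / 2"
  proof -
    have "e / (2 * (G * G + 1)) * (G * G) = e / 2 * ((G * G) / (G * G + 1))" by simp
    also have "\<dots> \<le> e / 2 * 1" using e GG by (intro mult_left_mono) auto
    finally show ?thesis by simp
  qed
  finally have sGG: "2 * (s * (G * G)) \<le> e" by simp
  define c where "c = (\<i> * of_real s) *\<^sub>C g"
  have ac: "adj c = - c"
    by (simp add: c_def adj_scaleC g scaleC_minus_left)
  have nc: "norm c = s * G" using s0 by (simp add: c_def norm_scaleC norm_mult G_def)
  obtain b where b: "(1 - c) * b = 1" "b * (1 - c) = 1" "norm b \<le> 2"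
    using neumann_inverse[of c] nc sG by auto
  let ?u = "(1 + c) * b"
  have "left_wcont ?u" by (rule left_wcont_unitary) (rule cayley_unitary[OF ac b(1,2)])+
  have cb: "c * b = b - 1" using b(1) by (simp add: algebra_simps)
  then have u: "?u = b + b - 1" by (simp add: algebra_simps)
  have "left_wcont ((1/2) *\<^sub>C (?u + 1))"
    by (intro left_wcont_scaleC left_wcont_add left_wcont_one \<open>left_wcont ?u\<close>)
  moreover have "(1/2) *\<^sub>C (?u + 1) = b"
  proof -
    have "(1/2) *\<^sub>C (?u + 1) = (1/2) *\<^sub>C b + (1/2) *\<^sub>C b" by (simp add: u scaleC_add_right)
    also have "\<dots> = b" by (simp flip: scaleC_add_left)
    finally show ?thesis .
  qed
  ultimately have "left_wcont b" by simp
  then have "left_wcont (inverse (\<i> * of_real s) *\<^sub>C (b + (-1) *\<^sub>C 1))"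
    by (intro left_wcont_scaleC left_wcont_add left_wcont_one)
  moreover have "inverse (\<i> * of_real s) *\<^sub>C (b + (-1) *\<^sub>C 1) = g * b"
  proof -
    have "b + (-1) *\<^sub>C 1 = (\<i> * of_real s) *\<^sub>C (g * b)"
      using cb by (simp add: c_def scaleC_minus_left scaleC_mult_left)
    then have "inverse (\<i> * of_real s) *\<^sub>C (b + (-1) *\<^sub>C 1) = (inverse (\<i> * of_real s) * (\<i> * of_real s)) *\<^sub>C (g * b)"
      by (simp only: scaleC_scaleC)
    also have "inverse (\<i> * of_real s) * (\<i> * of_real s) = 1" using s0 by (intro left_inverse) simp
    finally show ?thesis by simp
  qed
  moreover have "norm (g - g * b) \<le> e"
  proof -
    have "g - g * b = - (g * (c * b))" by (simp add: cb algebra_simps)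
    then have "norm (g - g * b) \<le> G * norm (c * b)"
      using norm_mult_ineq[of g "c * b"] by (simp add: G_def)
    also have "norm (c * b) \<le> s * G * 2"
    proof -
      have "s * G * norm b \<le> s * G * 2" by (rule mult_left_mono[OF b(3)]) (use s0 G0 in simp)
      then show ?thesis using norm_mult_ineq[of c b] nc by simp
    qed
    then have "G * norm (c * b) \<le> G * (s * G * 2)" using G0 by (rule mult_left_mono)
    also have "\<dots> \<le> e" using sGG by (simp add: mult_ac)
    finally show ?thesis .
  qed
  ultimately show "\<exists>z. left_wcont z \<and> norm (g - z) \<le> e" by auto
qed

lemma left_wcont_all: "left_wcont y"
proof -
  have half: "(1/2) *\<^sub>R x = (1/2) *\<^sub>C x" for x :: 'a
    using scaleC_of_real[of "1/2" x] by simp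
  let ?g = "(1/2) *\<^sub>C (y + adj y)" and ?k = "(- \<i> / 2) *\<^sub>C (y - adj y)"
  have "adj ?g = ?g" by (simp add: adj_scaleC adj_add adj_adj add.commute)
  moreover have "adj ?k = ?k"
    by (simp add: adj_scaleC adj_diff adj_adj scaleC_diff_right scaleC_minus_left)
  ultimately have "left_wcont (?g + \<i> *\<^sub>C ?k)"
    by (intro left_wcont_add left_wcont_scaleC left_wcont_self_adjoint)
  moreover have "?g + \<i> *\<^sub>C ?k = ((1/2) *\<^sub>C y + (1/2) *\<^sub>C y) + ((1/2) *\<^sub>C adj y + (-1/2) *\<^sub>C adj y)"
    by (simp add: scaleC_scaleC scaleC_add_right scaleC_diff_right scaleC_minus_left)
  moreover have "\<dots> = y" by (simp flip: scaleC_add_left)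
  ultimately show ?thesis by simp
qed

end

lemma wconv_cong:
  assumes "eventually (\<lambda>i. x i = y i) F" "wconv N F x a"
  shows "wconv N F y a"
  unfolding wconv_def
proof
  fix \<phi> assume "\<phi> \<in> N"
  then have "((\<lambda>i. blinfun_apply \<phi> (x i)) \<longlongrightarrow> \<phi> a) F" using assms(2) by (simp add: wconv_def)
  then show "((\<lambda>i. blinfun_apply \<phi> (y i)) \<longlongrightarrow> \<phi> a) F"
    by (rule Lim_transform_eventually) (use assms(1) in \<open>auto elim: eventually_mono\<close>)
qed

text \<open>Sakai's theorem that multiplication in a W*-algebra is weak* continuous in one variable, on bounded nets.\<close>

lemma wconv_mult_left:
  assumes N: "predual N" and b: "eventually (\<lambda>i. norm (x i) \<le> C) F" and a: "wconv N F x a"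
  shows "wconv N F (\<lambda>i. y * x i) (y * a)"
proof (rule wconv_if_all_ultrafilters)
  fix U assume U: "ultrafilter U" "U \<le> F"
  let ?x = "\<lambda>i. if norm (x i) \<le> \<bar>C\<bar> then x i else 0"
  have ev: "eventually (\<lambda>i. x i = ?x i) U"
    using filter_leD[OF U(2) b] by eventually_elim auto
  have "wconv N U ?x a" by (rule wconv_cong[OF ev wconv_mono[OF a U(2)]])
  moreover have nx: "norm (?x i) \<le> \<bar>C\<bar>" for i by simp
  ultimately have "wconv N U (\<lambda>i. y * ?x i) (y * a)"
    by (intro left_wcont_all[OF N U(1), of y, unfolded left_wcont_def[OF N U(1)], rule_format, of ?x, OF nx])
  then show "wconv N U (\<lambda>i. y * x i) (y * a)"
    by (rule wconv_cong[rotated]) (use ev in \<open>auto elim: eventually_mono\<close>)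
qed

lemma bounded_net_wconv_eventually:
  assumes N: "predual N" and U: "ultrafilter U" and b: "eventually (\<lambda>i. norm (x i) \<le> C) U"
  shows "\<exists>a. wconv N U x a"
proof -
  let ?x = "\<lambda>i. if norm (x i) \<le> \<bar>C\<bar> then x i else 0"
  have ev: "eventually (\<lambda>i. ?x i = x i) U" using b by eventually_elim auto
  have nx: "norm (?x i) \<le> \<bar>C\<bar>" for i by simp
  obtain a where "wconv N U ?x a" using bounded_net_wconv[OF N U, of ?x, OF nx] by (elim exE)
  then show ?thesis using wconv_cong[OF ev] by blast
qed

section \<open>Weak* topologies in terms of convergent nets\<close>

lemma limitin_pullback_topology:
  "limitin (pullback_topology A f T) g l F \<longleftrightarrow>
    l \<in> A \<and> (\<forall>\<^sub>F i in F. g i \<in> A) \<and> limitin T (\<lambda>i. f (g i)) (f l) F"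
proof safe
  assume L: "limitin (pullback_topology A f T) g l F"
  then show "l \<in> A" by (simp add: limitin_def topspace_pullback_topology)
  have fl: "f l \<in> topspace T" using L by (simp add: limitin_def topspace_pullback_topology)
  have ev: "\<forall>\<^sub>F i in F. g i \<in> f -` V \<inter> A" if "openin T V" "f l \<in> V" for V
    using L that \<open>l \<in> A\<close> unfolding limitin_def openin_pullback_topology by blast
  show "\<forall>\<^sub>F i in F. g i \<in> A" using ev[OF openin_topspace fl] by (auto elim: eventually_mono)
  show "limitin T (\<lambda>i. f (g i)) (f l) F"
    unfolding limitin_def
  proof (intro conjI allI impI fl, elim conjE)
    fix V assume "openin T V" "f l \<in> V"
    then show "\<forall>\<^sub>F i in F. f (g i) \<in> V" by (intro eventually_mono[OF ev]) auto
  qed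
next
  assume l: "l \<in> A" and A: "\<forall>\<^sub>F i in F. g i \<in> A" and T: "limitin T (\<lambda>i. f (g i)) (f l) F"
  show "limitin (pullback_topology A f T) g l F"
    unfolding limitin_def openin_pullback_topology topspace_pullback_topology
  proof (intro conjI allI impI)
    show "l \<in> f -` topspace T \<inter> A" using T l by (simp add: limitin_def)
    fix U assume "(\<exists>V. openin T V \<and> U = f -` V \<inter> A) \<and> l \<in> U"
    then obtain V where V: "openin T V" "f l \<in> V" "U = f -` V \<inter> A" by blast
    then have "\<forall>\<^sub>F i in F. f (g i) \<in> V" using T by (simp add: limitin_def)
    then show "\<forall>\<^sub>F i in F. g i \<in> U" using A by eventually_elim (simp add: V)
  qed
qed

lemma limitin_weak_star_topology:
  "limitin (weak_star_topology N) x a F \<longleftrightarrow> wconv N F x a"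
  unfolding weak_star_topology_def limitin_pullback_topology limitin_componentwise wconv_def
  by (auto simp: PiE_iff)

lemma topspace_weak_star_topology [simp]: "topspace (weak_star_topology N) = UNIV"
  by (auto simp: weak_star_topology_def topspace_pullback_topology)

lemma topspace_weak_star_operator_topology [simp]:
  "topspace (weak_star_operator_topology N) = cblinfuns"
  by (auto simp: weak_star_operator_topology_def topspace_pullback_topology)

lemma limitin_weak_star_operator_topology:
  "limitin (weak_star_operator_topology N) T S F \<longleftrightarrow>
    S \<in> cblinfuns \<and> (\<forall>\<^sub>F i in F. T i \<in> cblinfuns) \<and> (\<forall>x. wconv N F (\<lambda>i. blinfun_apply (T i) x) (S x))"
  unfolding weak_star_operator_topology_def limitin_pullback_topology limitin_componentwise
    limitin_weak_star_topology
  by auto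

lemma eventually_atin_topspace: "\<forall>\<^sub>F z in atin Z a. z \<in> topspace Z"
  unfolding eventually_atin by (metis DiffD1 openin_topspace)

lemma continuous_map_weak_star_topology:
  "continuous_map Z (weak_star_topology N) f \<longleftrightarrow> (\<forall>a\<in>topspace Z. wconv N (atin Z a) f (f a))"
  unfolding continuous_map_atin limitin_weak_star_topology ..

lemma continuous_map_weak_star_operator_topology:
  "continuous_map Z (weak_star_operator_topology N) f \<longleftrightarrow> (\<forall>z\<in>topspace Z. f z \<in> cblinfuns) \<and>
    (\<forall>a\<in>topspace Z. \<forall>x. wconv N (atin Z a) (\<lambda>z. blinfun_apply (f z) x) (f a x))"
proof -
  have "\<forall>\<^sub>F z in atin Z a. f z \<in> cblinfuns" if "\<forall>z\<in>topspace Z. f z \<in> cblinfuns" for a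
    using eventually_atin_topspace[of Z a] that by (auto elim: eventually_mono)
  then show ?thesis unfolding continuous_map_atin limitin_weak_star_operator_topology by blast
qed

lemma wconv_atin_continuous_operators:
  assumes "continuous_map Z (weak_star_operator_topology N) f" "a \<in> topspace Z"
  shows "wconv N (atin Z a) (\<lambda>z. blinfun_apply (f z) x) (f a x)"
  using assms unfolding continuous_map_weak_star_operator_topology by blast

lemma continuous_map_eval_functional:
  "\<phi> \<in> N \<Longrightarrow> continuous_map (weak_star_topology N) euclidean (blinfun_apply \<phi>)"
  using continuous_map_id[of "weak_star_topology N"]
  unfolding continuous_map_atin limitin_weak_star_topology by (auto simp: wconv_def)

lemma continuous_map_eval_operator:
  "continuous_map (weak_star_operator_topology N) (weak_star_topology N) (\<lambda>T. blinfun_apply T x)"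
  using continuous_map_id[of "weak_star_operator_topology N"]
  unfolding continuous_map_weak_star_topology continuous_map_weak_star_operator_topology by simp

lemma Hausdorff_weak_star_topology:
  assumes N: "predual N"
  shows "Hausdorff_space (weak_star_topology N)"
  unfolding Hausdorff_space_def
proof (intro allI impI, elim conjE)
  fix x y :: 'a assume "x \<noteq> y"
  then obtain \<phi> where \<phi>: "\<phi> \<in> N" "blinfun_apply \<phi> x \<noteq> \<phi> y" using predual_separates[OF N] by blast
  obtain U V where UV: "open U" "open V" "blinfun_apply \<phi> x \<in> U" "blinfun_apply \<phi> y \<in> V" "U \<inter> V = {}"
    using hausdorff[OF \<phi>(2)] by blast
  have op: "openin (weak_star_topology N) {z. blinfun_apply \<phi> z \<in> W}" if "open W" for W
    using openin_continuous_map_preimage[OF continuous_map_eval_functional[OF \<phi>(1)], of W] that by simp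
  show "\<exists>U V. openin (weak_star_topology N) U \<and> openin (weak_star_topology N) V \<and> x \<in> U \<and> y \<in> V \<and> disjnt U V"
    by (intro exI[of _ "{z. blinfun_apply \<phi> z \<in> U}"] exI[of _ "{z. blinfun_apply \<phi> z \<in> V}"])
      (use UV op in \<open>auto simp: disjnt_def\<close>)
qed

lemma Hausdorff_weak_star_operator_topology:
  assumes N: "predual N"
  shows "Hausdorff_space (weak_star_operator_topology N)"
  unfolding Hausdorff_space_def
proof (intro allI impI, elim conjE)
  let ?W = "weak_star_operator_topology N"
  fix S T assume ST: "S \<in> topspace ?W" "T \<in> topspace ?W" "S \<noteq> T"
  then obtain x where x: "blinfun_apply S x \<noteq> T x" by (meson blinfun_eqI)
  then obtain U V where UV: "openin (weak_star_topology N) U" "openin (weak_star_topology N) V"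
      "blinfun_apply S x \<in> U" "blinfun_apply T x \<in> V" "disjnt U V"
    using Hausdorff_weak_star_topology[OF N] unfolding Hausdorff_space_def by force
  have op: "openin ?W {R \<in> topspace ?W. blinfun_apply R x \<in> U}" if "openin (weak_star_topology N) U" for U
    by (rule openin_continuous_map_preimage[OF continuous_map_eval_operator that])
  show "\<exists>U V. openin ?W U \<and> openin ?W V \<and> S \<in> U \<and> T \<in> V \<and> disjnt U V"
    by (intro exI[of _ "{R \<in> topspace ?W. blinfun_apply R x \<in> U}"] exI[of _ "{R \<in> topspace ?W. blinfun_apply R x \<in> V}"])
      (use UV op ST in \<open>auto simp: disjnt_iff\<close>)
qed

section \<open>The semi-inner products of normal states\<close>

text \<open>The common source of the Cauchy-Schwarz inequality (\<open>d\<close> and \<open>A\<close> are the two square norms), of the rigidity of contractions at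
vectors whose norm they preserve (\<open>d = 0\<close>), and of approximate Riesz representation (\<open>d\<close> is the error).\<close>

lemma cmod_square_le_if_quadratic_nonneg:
  assumes nn: "\<And>s. 0 \<le> d + 2 * Re (s * \<beta>) + (cmod s)\<^sup>2 * A" and A: "A \<ge> 0"
  shows "(cmod \<beta>)\<^sup>2 \<le> d * A"
proof (cases "A = 0")
  case False
  then have A: "A > 0" using A by simp
  define s where "s = - cnj \<beta> / of_real A"
  have "Re (s * \<beta>) = - ((cmod \<beta>)\<^sup>2 / A)"
  proof -
    have "s * \<beta> = - (of_real ((cmod \<beta>)\<^sup>2) / of_real A)"
      by (simp add: s_def mult.commute flip: complex_norm_square)
    then show ?thesis by (simp flip: of_real_divide)
  qed
  moreover have "(cmod s)\<^sup>2 * A = (cmod \<beta>)\<^sup>2 / A"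
    using A by (simp add: s_def norm_divide power_divide power2_eq_square)
  ultimately have "(cmod \<beta>)\<^sup>2 / A \<le> d" using nn[of s] by simp
  then show ?thesis using A by (simp add: divide_le_eq)
next
  case True
  have "\<beta> = 0"
  proof (rule ccontr)
    assume b: "\<beta> \<noteq> 0"
    define k where "k = (\<bar>d\<bar> + 1) / (cmod \<beta>)\<^sup>2"
    have "of_real (- k) * cnj \<beta> * \<beta> = of_real (- k * (cmod \<beta>)\<^sup>2)"
      by (simp add: mult.assoc mult.commute[of "cnj \<beta>"] flip: complex_norm_square)
    then have "Re (of_real (- k) * cnj \<beta> * \<beta>) = - k * (cmod \<beta>)\<^sup>2" by (metis Re_complex_of_real)
    also have "\<dots> = - (\<bar>d\<bar> + 1)" using b by (simp add: k_def)
    finally show False using nn[of "of_real (- k) * cnj \<beta>"] True by simp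
  qed
  then show ?thesis using True by simp
qed

context
  fixes N :: "('a::cstar_algebra \<Rightarrow>\<^sub>L complex) set" and \<phi> :: "'a \<Rightarrow>\<^sub>L complex"
  assumes N: "predual N" and \<phi>: "normal_state N \<phi>"
begin

lemma state_scaleC: "blinfun_apply \<phi> (c *\<^sub>C x) = c * \<phi> x"
  using predual_scaleC[OF N] \<phi> unfolding normal_state_def by blast

lemma state_square: "blinfun_apply \<phi> (adj x * x) = of_real (Re (\<phi> (adj x * x)))" "0 \<le> Re (\<phi> (adj x * x))"
proof -
  have "0 \<le> blinfun_apply \<phi> (adj x * x)" using \<phi> unfolding normal_state_def positive_cone_def by blast
  then show "blinfun_apply \<phi> (adj x * x) = of_real (Re (\<phi> (adj x * x)))" "0 \<le> Re (\<phi> (adj x * x))"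
    by (auto simp: less_eq_complex_def complex_eq_iff)
qed

lemma state_expand:
  "blinfun_apply \<phi> (adj (x + s *\<^sub>C y) * (x + s *\<^sub>C y)) =
    \<phi> (adj x * x) + s * \<phi> (adj x * y) + cnj s * \<phi> (adj y * x) + cnj s * s * \<phi> (adj y * y)"
  by (simp add: adj_add adj_scaleC distrib_left distrib_right scaleC_mult_left scaleC_mult_right
      scaleC_scaleC blinfun.add_right state_scaleC mult.assoc)

lemma state_hermitian: "blinfun_apply \<phi> (adj y * x) = cnj (\<phi> (adj x * y))"
proof -
  have im: "Im (blinfun_apply \<phi> (adj z * z)) = 0" for z
    by (subst state_square(1)) (rule Im_complex_of_real)
  have "Im (blinfun_apply \<phi> (adj x * y) + \<phi> (adj y * x)) = 0"
    using im[of "x + 1 *\<^sub>C y"] im[of x] im[of y] unfolding state_expand by simp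
  moreover have "Im (\<i> * blinfun_apply \<phi> (adj x * y) + cnj \<i> * \<phi> (adj y * x)) = 0"
    using im[of "x + \<i> *\<^sub>C y"] im[of x] im[of y] unfolding state_expand by simp
  ultimately show ?thesis by (simp add: complex_eq_iff)
qed

lemma state_expand_Re:
  "Re (\<phi> (adj (x + s *\<^sub>C y) * (x + s *\<^sub>C y))) =
    Re (\<phi> (adj x * x)) + 2 * Re (s * \<phi> (adj x * y)) + (cmod s)\<^sup>2 * Re (\<phi> (adj y * y))"
proof -
  have "cnj s * s = of_real ((cmod s)\<^sup>2)" by (simp add: mult.commute flip: complex_norm_square)
  then have "Re (cnj s * s * \<phi> (adj y * y)) = (cmod s)\<^sup>2 * Re (\<phi> (adj y * y))"
    by (metis Re_complex_of_real state_square(1) of_real_mult)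
  moreover have "Re (cnj s * \<phi> (adj y * x)) = Re (s * \<phi> (adj x * y))"
    by (simp add: state_hermitian[of y x])
  ultimately show ?thesis unfolding state_expand by simp
qed

lemma state_Cauchy_Schwarz:
  "(cmod (\<phi> (adj x * y)))\<^sup>2 \<le> Re (\<phi> (adj x * x)) * Re (\<phi> (adj y * y))"
proof (rule cmod_square_le_if_quadratic_nonneg)
  fix s
  show "0 \<le> Re (\<phi> (adj x * x)) + 2 * Re (s * \<phi> (adj x * y)) + (cmod s)\<^sup>2 * Re (\<phi> (adj y * y))"
    using state_square(2)[of "x + s *\<^sub>C y"] unfolding state_expand_Re .
qed (rule state_square)

lemma state_norm_le: "Re (\<phi> (adj x * x)) \<le> norm \<phi> * (norm x)\<^sup>2"
  using complex_Re_le_cmod[of "\<phi> (adj x * x)"] norm_blinfun[of \<phi> "adj x * x"]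
  by (simp add: cstar_identity)

text \<open>The nonnegative function \<open>s \<mapsto> q(x + s y) - q(T(x + s y))\<close> vanishes at \<open>0\<close>, hence so does its derivative there.\<close>

lemma contraction_isometric_at:
  assumes T: "T \<in> cblinfuns" "\<And>z. Re (\<phi> (adj (blinfun_apply T z) * T z)) \<le> Re (\<phi> (adj z * z))"
    and x: "Re (\<phi> (adj (blinfun_apply T x) * T x)) = Re (\<phi> (adj x * x))"
  shows "\<phi> (adj (blinfun_apply T x) * T y) = \<phi> (adj x * y)"
proof -
  let ?\<beta> = "\<phi> (adj x * y) - \<phi> (adj (blinfun_apply T x) * T y)"
  let ?A = "Re (\<phi> (adj y * y)) - Re (\<phi> (adj (blinfun_apply T y) * T y))"
  have "(cmod ?\<beta>)\<^sup>2 \<le> 0 * ?A"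
  proof (rule cmod_square_le_if_quadratic_nonneg)
    fix s
    have "blinfun_apply T (x + s *\<^sub>C y) = T x + s *\<^sub>C T y"
      using T(1) by (simp add: cblinfuns_def blinfun.add_right)
    then have "Re (\<phi> (adj (T x + s *\<^sub>C T y) * (T x + s *\<^sub>C T y))) \<le> Re (\<phi> (adj (x + s *\<^sub>C y) * (x + s *\<^sub>C y)))"
      using T(2)[of "x + s *\<^sub>C y"] by simp
    then show "0 \<le> 0 + 2 * Re (s * ?\<beta>) + (cmod s)\<^sup>2 * ?A"
      unfolding state_expand_Re x by (simp add: algebra_simps)
  qed (use T in simp)
  then show ?thesis by simp
qed

text \<open>The pre-Hilbert space of the state need not be complete, so a representing vector need not exist in the algebra; a near-minimiser
\<open>w\<close> of \<open>q w - 2 Re (l w)\<close> represents \<open>l\<close> up to an error that is small in the dual norm.\<close>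

lemma state_near_riesz:
  fixes l :: "'a \<Rightarrow> complex"
  assumes add: "\<And>x y. l (x + y) = l x + l y" and sc: "\<And>c x. l (c *\<^sub>C x) = c * l x"
    and B: "\<And>x. (cmod (l x))\<^sup>2 \<le> B * Re (\<phi> (adj x * x))" and e: "e > 0"
  shows "\<exists>w. \<forall>x. (cmod (\<phi> (adj w * x) - l x))\<^sup>2 \<le> e * Re (\<phi> (adj x * x))"
proof -
  let ?q = "\<lambda>x. Re (\<phi> (adj x * x))"
  define E where "E = (\<lambda>w. ?q w - 2 * Re (l w))"
  have low: "- B \<le> E w" if "0 \<le> B" for w
  proof -
    have "\<bar>Re (l w)\<bar> \<le> sqrt (B * ?q w)"
      using abs_Re_le_cmod[of "l w"] real_le_rsqrt[OF B[of w]] by linarith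
    also have "\<dots> \<le> (B + ?q w) / 2" using arith_geo_mean_sqrt[OF that state_square(2)[of w]] by simp
    finally show ?thesis by (simp add: E_def)
  qed
  have "bdd_below (range E)"
  proof (cases "0 \<le> B")
    case True
    show ?thesis by (rule bdd_belowI2[where m = "- B"]) (rule low[OF True])
  next
    case False
    have "E w \<ge> 0" for w
    proof -
      have "B * ?q w \<le> 0" using False state_square(2)[of w] by (simp add: mult_nonpos_nonneg)
      then have "(cmod (l w))\<^sup>2 \<le> 0" using B[of w] by linarith
      then have "l w = 0" by simp
      then show ?thesis using state_square(2)[of w] by (simp add: E_def)
    qed
    then show ?thesis by (rule bdd_belowI2[where m = 0])
  qed
  obtain w where w: "E w < Inf (range E) + e"
    using cInf_lessD[of "range E" "Inf (range E) + e"] e by auto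
  have "(cmod (\<phi> (adj w * x) - l x))\<^sup>2 \<le> e * ?q x" for x
  proof (rule cmod_square_le_if_quadratic_nonneg)
    fix s
    have "Inf (range E) \<le> E (w + s *\<^sub>C x)" by (rule cInf_lower) (use \<open>bdd_below (range E)\<close> in auto)
    then have "E w - e \<le> E (w + s *\<^sub>C x)" using w by simp
    then show "0 \<le> e + 2 * Re (s * (\<phi> (adj w * x) - l x)) + (cmod s)\<^sup>2 * ?q x"
      unfolding E_def state_expand_Re add sc by (simp add: algebra_simps)
  qed (rule state_square)
  then show ?thesis by blast
qed

end

section \<open>Operators contracting the semi-inner products\<close>

text \<open>Equivalently, \<open>T\<close> induces a contraction on the Hilbert space of each state in \<open>\<Phi>\<close>. This
condition passes to weak* operator limits of bounded nets, and it implies weak* continuity on bounded sets (\<open>wconv_state_contraction\<close>).\<close>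

definition state_contraction :: "('a::cstar_algebra \<Rightarrow>\<^sub>L complex) set \<Rightarrow> ('a \<Rightarrow>\<^sub>L 'a) \<Rightarrow> bool"
  where "state_contraction \<Phi> T \<longleftrightarrow> T \<in> cblinfuns \<and>
    (\<forall>\<phi>\<in>\<Phi>. \<forall>x. Re (blinfun_apply \<phi> (adj (T x) * T x)) \<le> Re (blinfun_apply \<phi> (adj x * x)))"

context
  fixes N \<Phi> :: "('a::cstar_algebra \<Rightarrow>\<^sub>L complex) set"
  assumes N: "predual N" and \<Phi>: "\<forall>\<phi>\<in>\<Phi>. normal_state N \<phi>" and faith: "faithful \<Phi>"
begin

lemma \<Phi>_subset: "\<phi> \<in> \<Phi> \<Longrightarrow> \<phi> \<in> N"
  using \<Phi> unfolding normal_state_def by blast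

lemma eq_zero_if_states_vanish:
  assumes "\<And>\<phi>. \<phi> \<in> \<Phi> \<Longrightarrow> Re (blinfun_apply \<phi> (adj x * x)) \<le> 0"
  shows "x = 0"
proof -
  have "blinfun_apply \<phi> (adj x * x) = 0" if "\<phi> \<in> \<Phi>" for \<phi>
    using state_square[OF N \<Phi>[rule_format, OF that], of x] assms[OF that]
    by (metis antisym of_real_0)
  then have "adj x * x = 0"
    using faith unfolding faithful_def positive_cone_def by blast
  then show ?thesis using cstar_identity[of x] by simp
qed

text \<open>On bounded sets the functionals \<open>x \<mapsto> \<phi>(y* x)\<close> with \<open>\<phi>\<close> in \<open>\<Phi>\<close> induce the weak* topology: any weak* cluster point \<open>v\<close> of the net
satisfies \<open>\<phi>(y* (v - a)) = 0\<close> for all \<open>y\<close>, in particular for \<open>y = v - a\<close>, and \<open>\<Phi>\<close> is faithful. The continuity of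
left multiplication is needed here to identify the limit along an ultrafilter.\<close>

lemma wconv_if_states_converge:
  assumes b: "\<forall>\<^sub>F i in F. norm (z i) \<le> C"
    and c: "\<And>\<phi> y. \<phi> \<in> \<Phi> \<Longrightarrow> ((\<lambda>i. blinfun_apply \<phi> (adj y * z i)) \<longlongrightarrow> \<phi> (adj y * a)) F"
  shows "wconv N F z a"
proof (rule wconv_if_all_ultrafilters)
  fix U assume U: "ultrafilter U" "U \<le> F"
  have nb: "U \<noteq> bot" using U by (simp add: ultrafilter_def)
  have bU: "\<forall>\<^sub>F i in U. norm (z i) \<le> C" by (rule filter_leD[OF U(2) b])
  obtain v where v: "wconv N U z v" using bounded_net_wconv_eventually[OF N U(1) bU] by blast
  have eq: "blinfun_apply \<phi> (adj y * v) = \<phi> (adj y * a)" if "\<phi> \<in> \<Phi>" for \<phi> y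
  proof -
    have "((\<lambda>i. blinfun_apply \<phi> (adj y * z i)) \<longlongrightarrow> \<phi> (adj y * v)) U"
      using wconv_mult_left[OF N bU v, of "adj y"] \<Phi>_subset[OF that] by (simp add: wconv_def)
    then show ?thesis using tendsto_mono[OF U(2) c[OF that]] by (rule tendsto_unique[OF nb])
  qed
  have "v - a = 0"
  proof (rule eq_zero_if_states_vanish)
    fix \<phi> assume "\<phi> \<in> \<Phi>"
    then show "Re (blinfun_apply \<phi> (adj (v - a) * (v - a))) \<le> 0"
      using eq[of \<phi> "v - a"] by (simp add: right_diff_distrib blinfun.diff_right)
  qed
  then show "wconv N U z a" using v by simp
qed

text \<open>On the Hilbert space of a state, \<open>T\<close> is a contraction and hence weakly continuous: \<open>x \<mapsto> \<phi>(y* T x)\<close> is approximated, uniformly on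
bounded sets, by functionals \<open>x \<mapsto> \<phi>(w* x)\<close>.\<close>

lemma wconv_state_contraction:
  assumes T: "state_contraction \<Phi> T" and b: "\<forall>\<^sub>F i in F. norm (x i) \<le> C" and a: "wconv N F x a"
  shows "wconv N F (\<lambda>i. blinfun_apply T (x i)) (T a)"
proof (rule wconv_if_states_converge)
  show "\<forall>\<^sub>F i in F. norm (blinfun_apply T (x i)) \<le> norm T * C"
    using b by eventually_elim (meson mult_left_mono norm_blinfun norm_ge_zero order_trans)
next
  fix \<phi> y assume \<phi>: "\<phi> \<in> \<Phi>"
  note st = N \<Phi>[rule_format, OF \<phi>]
  let ?q = "\<lambda>x. Re (\<phi> (adj x * x))"
  define K where "K = norm \<phi> * (max \<bar>C\<bar> (norm a))\<^sup>2 + 1"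
  have K: "K > 0" unfolding K_def by (smt (verit) mult_nonneg_nonneg norm_ge_zero zero_le_power2)
  have qK: "?q z \<le> K" if "norm z \<le> max \<bar>C\<bar> (norm a)" for z
    using state_norm_le[OF st, of z] mult_left_mono[OF power_mono[OF that norm_ge_zero, of 2] norm_ge_zero[of \<phi>]]
    by (simp add: K_def)
  define l where "l = (\<lambda>x. \<phi> (adj y * blinfun_apply T x))"
  have l: "l (x + y) = l x + l y" "l (c *\<^sub>C x) = c * l x" for x y c
    using T by (simp_all add: l_def blinfun.add_right distrib_left state_contraction_def cblinfuns_def
        scaleC_mult_right state_scaleC[OF st])
  have B: "(cmod (l x))\<^sup>2 \<le> ?q y * ?q x" for x
  proof -
    have "(cmod (l x))\<^sup>2 \<le> ?q y * ?q (blinfun_apply T x)" unfolding l_def by (rule state_Cauchy_Schwarz[OF st])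
    also have "\<dots> \<le> ?q y * ?q x"
      using T \<phi> state_square(2)[OF st, of y] by (intro mult_left_mono) (auto simp: state_contraction_def)
    finally show ?thesis .
  qed
  show "((\<lambda>i. blinfun_apply \<phi> (adj y * T (x i))) \<longlongrightarrow> \<phi> (adj y * T a)) F"
  proof (rule tendstoI)
    fix r :: real assume r: "r > 0"
    define e where "e = (r / 3)\<^sup>2 / K"
    have e: "e > 0" using r K by (simp add: e_def)
    obtain w where w: "\<And>x. (cmod (\<phi> (adj w * x) - l x))\<^sup>2 \<le> e * ?q x"
      using state_near_riesz[OF st l B e] by blast
    have close: "cmod (\<phi> (adj w * z) - l z) \<le> r / 3" if "norm z \<le> max \<bar>C\<bar> (norm a)" for z
    proof -
      have "(cmod (\<phi> (adj w * z) - l z))\<^sup>2 \<le> e * K"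
        using w[of z] mult_left_mono[OF qK[OF that], of e] e by linarith
      also have "\<dots> = (r / 3)\<^sup>2" using K by (simp add: e_def)
      finally show ?thesis using r by (simp add: power2_le_iff_abs_le)
    qed
    have "((\<lambda>i. blinfun_apply \<phi> (adj w * x i)) \<longlongrightarrow> \<phi> (adj w * a)) F"
      using wconv_mult_left[OF N b a] \<Phi>_subset[OF \<phi>] by (simp add: wconv_def)
    then have "\<forall>\<^sub>F i in F. dist (\<phi> (adj w * x i)) (\<phi> (adj w * a)) < r / 3"
      using r by (intro tendstoD) auto
    with b have "\<forall>\<^sub>F i in F. dist (l (x i)) (l a) < r"
    proof eventually_elim
      case (elim i)
      have "cmod (\<phi> (adj w * x i) - l (x i)) \<le> r / 3" by (rule close) (use elim in auto)
      moreover have "cmod (\<phi> (adj w * a) - l a) \<le> r / 3" by (rule close) auto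
      moreover have "l (x i) - l a = (\<phi> (adj w * x i) - \<phi> (adj w * a))
          - (\<phi> (adj w * x i) - l (x i)) + (\<phi> (adj w * a) - l a)" by simp
      then have "cmod (l (x i) - l a) \<le> cmod (\<phi> (adj w * x i) - \<phi> (adj w * a))
          + cmod (\<phi> (adj w * x i) - l (x i)) + cmod (\<phi> (adj w * a) - l a)"
        by (metis norm_triangle_ineq norm_triangle_ineq4 add_right_mono order_trans)
      ultimately show ?case using elim(2) by (simp add: dist_norm)
    qed
    then show "\<forall>\<^sub>F i in F. dist (\<phi> (adj y * T (x i))) (\<phi> (adj y * T a)) < r" by (simp add: l_def)
  qed
qed

text \<open>A limit of contractions is a contraction because \<open>q(L x) ^ 2\<close> is the limit of \<open>cmod (\<phi>((L x)* T x)) ^ 2\<close>, which is at most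
\<open>q(L x) * q(x)\<close>.\<close>

lemma compact_state_contractions:
  "compactin (weak_star_operator_topology N) {T. norm T \<le> K \<and> state_contraction \<Phi> T}"
    (is "compactin _ ?Q")
  unfolding compactin_subspace
proof
  show "?Q \<subseteq> topspace (weak_star_operator_topology N)" by (auto simp: state_contraction_def)
  then have ts: "topspace (subtopology (weak_star_operator_topology N) ?Q) = ?Q" by auto
  show "compact_space (subtopology (weak_star_operator_topology N) ?Q)"
  proof (rule compact_space_if_ultrafilters_converge)
    fix U assume U: "ultrafilter U"
      and "\<forall>\<^sub>F T in U. T \<in> topspace (subtopology (weak_star_operator_topology N) ?Q)"
    then have Q: "\<forall>\<^sub>F T in U. T \<in> ?Q" by (simp only: ts)
    have nb: "U \<noteq> bot" using U by (simp add: ultrafilter_def)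
    have bd: "\<forall>\<^sub>F T in U. norm (blinfun_apply T x) \<le> K * norm x" for x
      using Q
    proof eventually_elim
      case (elim T)
      then show ?case using norm_blinfun[of T x] mult_right_mono[of "norm T" K "norm x"] by simp
    qed
    have "\<exists>a. wconv N U (\<lambda>T. blinfun_apply T x) a" for x
      by (rule bounded_net_wconv_eventually[OF N U bd])
    then obtain L where L: "\<And>x. wconv N U (\<lambda>T. blinfun_apply T x) (L x)" by metis
    have nL: "norm (L x) \<le> K * norm x" for x by (rule wconv_norm_le[OF N nb L bd])
    have addL: "L (x + y) = L x + L y" for x y
      using wconv_unique[OF N nb L[of "x + y"]] wconv_add[OF L[of x] L[of y]] by (simp add: blinfun.add_right)
    have scL: "L (c *\<^sub>C x) = c *\<^sub>C L x" for c x
    proof (rule wconv_unique[OF N nb L])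
      show "wconv N U (\<lambda>T. blinfun_apply T (c *\<^sub>C x)) (c *\<^sub>C L x)"
      proof (rule wconv_cong[OF _ wconv_scaleC[OF N L]])
        show "\<forall>\<^sub>F T in U. c *\<^sub>C blinfun_apply T x = T (c *\<^sub>C x)"
          using Q by eventually_elim (auto simp: state_contraction_def cblinfuns_def)
      qed
    qed
    have bl: "bounded_linear L"
    proof (rule bounded_linear_intro)
      show "L (r *\<^sub>R x) = r *\<^sub>R L x" for r x using scL[of "of_real r" x] by (simp add: scaleC_of_real)
      show "norm (L x) \<le> norm x * K" for x using nL[of x] by (simp add: mult.commute)
    qed (rule addL)
    define T where "T = Blinfun L"
    have TL: "blinfun_apply T = L" unfolding T_def by (rule bounded_linear_Blinfun_apply[OF bl])
    have K0: "0 \<le> K" using eventually_happens'[OF nb Q] by (metis (no_types, lifting) mem_Collect_eq norm_ge_zero order_trans)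
    have Tc: "T \<in> cblinfuns" by (simp add: cblinfuns_def TL scL)
    moreover have "Re (\<phi> (adj (blinfun_apply T x) * T x)) \<le> Re (\<phi> (adj x * x))" if \<phi>: "\<phi> \<in> \<Phi>" for \<phi> x
    proof -
      note st = N \<Phi>[rule_format, OF \<phi>]
      let ?q = "\<lambda>x. Re (\<phi> (adj x * x))"
      have "((\<lambda>T. (cmod (\<phi> (adj (L x) * blinfun_apply T x)))\<^sup>2) \<longlongrightarrow> (cmod (\<phi> (adj (L x) * L x)))\<^sup>2) U"
        using wconv_mult_left[OF N bd L, of "adj (L x)"] \<Phi>_subset[OF \<phi>]
        by (intro tendsto_power tendsto_norm) (simp add: wconv_def)
      then have "(cmod (\<phi> (adj (L x) * L x)))\<^sup>2 \<le> ?q (L x) * ?q x"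
      proof (rule tendsto_upperbound[OF _ _ nb])
        show "\<forall>\<^sub>F T in U. (cmod (\<phi> (adj (L x) * blinfun_apply T x)))\<^sup>2 \<le> ?q (L x) * ?q x"
          using Q
        proof eventually_elim
          case (elim T)
          have "(cmod (\<phi> (adj (L x) * blinfun_apply T x)))\<^sup>2 \<le> ?q (L x) * ?q (blinfun_apply T x)"
            by (rule state_Cauchy_Schwarz[OF st])
          also have "\<dots> \<le> ?q (L x) * ?q x"
            using elim \<phi> state_square(2)[OF st] by (intro mult_left_mono) (auto simp: state_contraction_def)
          finally show ?case .
        qed
      qed
      moreover have "(cmod (\<phi> (adj (L x) * L x)))\<^sup>2 = ?q (L x) * ?q (L x)"
        by (subst state_square(1)[OF st]) (simp add: power2_eq_square)
      ultimately have "?q (L x) \<le> ?q x"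
        using state_square(2)[OF st, of "L x"] state_square(2)[OF st, of x]
        by (cases "?q (L x) = 0") (auto simp: mult_le_cancel_left)
      then show ?thesis by (simp add: TL)
    qed
    moreover have "norm T \<le> K" using nL K0 by (intro norm_blinfun_bound) (auto simp: TL)
    ultimately have "T \<in> ?Q" by (simp add: state_contraction_def)
    moreover have "limitin (weak_star_operator_topology N) id T U"
      unfolding limitin_weak_star_operator_topology
    proof (intro conjI allI)
      show "\<forall>\<^sub>F T in U. id T \<in> cblinfuns" using Q by eventually_elim (auto simp: state_contraction_def)
    qed (use Tc L in \<open>auto simp: TL\<close>)
    ultimately show "\<exists>T. limitin (subtopology (weak_star_operator_topology N) ?Q) id T U"
      using Q by (auto simp: limitin_subtopology)
  qed
qed

text \<open>Weak convergence together with convergence of the norms is strong convergence.\<close>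

lemma tendsto_state_square_diff:
  assumes \<phi>: "\<phi> \<in> \<Phi>" and b: "\<forall>\<^sub>F i in F. norm (x i) \<le> C" and a: "wconv N F x a"
    and q: "\<forall>\<^sub>F i in F. Re (\<phi> (adj (x i) * x i)) = Re (\<phi> (adj a * a))"
  shows "((\<lambda>i. Re (\<phi> (adj (x i - a) * (x i - a)))) \<longlongrightarrow> 0) F"
proof -
  note st = N \<Phi>[rule_format, OF \<phi>]
  let ?q = "\<lambda>x. Re (\<phi> (adj x * x))"
  have eq: "?q (z - a) = ?q z + ?q a - 2 * Re (\<phi> (adj a * z))" for z
  proof -
    have "?q (z + (-1) *\<^sub>C a) = ?q z + 2 * Re ((-1) * \<phi> (adj z * a)) + (cmod (-1))\<^sup>2 * ?q a"
      by (rule state_expand_Re[OF st])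
    moreover have "Re (\<phi> (adj z * a)) = Re (\<phi> (adj a * z))" by (simp add: state_hermitian[OF st, of z a])
    ultimately show ?thesis by (simp add: scaleC_minus_left)
  qed
  have "((\<lambda>i. 2 * ?q a - 2 * Re (\<phi> (adj a * x i))) \<longlongrightarrow> 2 * ?q a - 2 * ?q a) F"
  proof -
    have "((\<lambda>i. \<phi> (adj a * x i)) \<longlongrightarrow> \<phi> (adj a * a)) F"
      using wconv_mult_left[OF N b a] \<Phi>_subset[OF \<phi>] by (simp add: wconv_def)
    then show ?thesis
      by (rule tendsto_diff[OF tendsto_const tendsto_mult[OF tendsto_const tendsto_Re]])
  qed
  then have lim: "((\<lambda>i. 2 * ?q a - 2 * Re (\<phi> (adj a * x i))) \<longlongrightarrow> 0) F" by simp
  have "\<forall>\<^sub>F i in F. 2 * ?q a - 2 * Re (\<phi> (adj a * x i)) = ?q (x i - a)"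
    using q by eventually_elim (simp add: eq)
  then show ?thesis by (rule Lim_transform_eventually[OF lim])
qed

lemma tendsto_state_zero:
  assumes \<phi>: "\<phi> \<in> \<Phi>" and q: "((\<lambda>i. Re (\<phi> (adj (z i) * z i))) \<longlongrightarrow> 0) F"
  shows "((\<lambda>i. \<phi> (adj y * z i)) \<longlongrightarrow> 0) F"
proof -
  note st = N \<Phi>[rule_format, OF \<phi>]
  have "((\<lambda>i. sqrt (Re (\<phi> (adj y * y)) * Re (\<phi> (adj (z i) * z i)))) \<longlongrightarrow> sqrt (Re (\<phi> (adj y * y)) * 0)) F"
    by (intro tendsto_intros q)
  then have lim: "((\<lambda>i. sqrt (Re (\<phi> (adj y * y)) * Re (\<phi> (adj (z i) * z i)))) \<longlongrightarrow> 0) F" by simp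
  show ?thesis
    by (rule Lim_null_comparison[OF _ lim])
      (auto intro!: always_eventually real_le_rsqrt state_Cauchy_Schwarz[OF st])
qed

end

section \<open>Compact right topological semigroups\<close>

text \<open>Zorn's lemma for closed sets; compactness keeps intersections of chains nonempty. The instances of \<open>P\<close> are closure under
multiplication and the left ideal property.\<close>

lemma minimal_closed_set_exists:
  assumes X: "compact_space X"
    and A: "closedin X A" "A \<noteq> {}" "P A"
    and Inter: "\<And>\<C>. \<C> \<noteq> {} \<Longrightarrow> (\<And>C. C \<in> \<C> \<Longrightarrow> closedin X C \<and> P C) \<Longrightarrow> P (\<Inter>\<C>)"
  obtains M where "closedin X M" "M \<noteq> {}" "P M" "M \<subseteq> A"
    "\<And>C. closedin X C \<Longrightarrow> C \<noteq> {} \<Longrightarrow> P C \<Longrightarrow> C \<subseteq> M \<Longrightarrow> C = M"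
proof -
  let ?Q = "{C. closedin X C \<and> C \<noteq> {} \<and> P C \<and> C \<subseteq> A}"
  have "\<exists>m\<in>?Q. \<forall>a\<in>?Q. m \<supseteq> a \<longrightarrow> a = m"
  proof (rule predicate_Zorn)
    show "partial_order_on ?Q (relation_of (\<supseteq>) ?Q)"
      by (rule partial_order_on_relation_ofI) auto
  next
    fix \<C> assume \<C>: "\<C> \<in> Chains (relation_of (\<supseteq>) ?Q)"
    have sub: "\<C> \<subseteq> ?Q" and tot: "\<And>a b. a \<in> \<C> \<Longrightarrow> b \<in> \<C> \<Longrightarrow> a \<subseteq> b \<or> b \<subseteq> a"
      using \<C> by (auto simp: Chains_def relation_of_def)
    show "\<exists>u\<in>?Q. \<forall>a\<in>\<C>. u \<subseteq> a"
    proof (cases "\<C> = {}")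
      case True then show ?thesis using A by auto
    next
      case False
      have fin: "\<F> \<noteq> {} \<longrightarrow> \<F> \<subseteq> \<C> \<longrightarrow> \<Inter>\<F> \<in> \<F>" if "finite \<F>" for \<F>
        using that
      proof (induction \<F>)
        case (insert C \<F>)
        show ?case
        proof (intro impI)
          assume sub': "insert C \<F> \<subseteq> \<C>"
          show "\<Inter> (insert C \<F>) \<in> insert C \<F>"
          proof (cases "\<F> = {}")
            case False
            then have I: "\<Inter>\<F> \<in> \<F>" using insert.IH sub' by auto
            then have "C \<subseteq> \<Inter>\<F> \<or> \<Inter>\<F> \<subseteq> C" using sub' by (intro tot) auto
            then have "C \<inter> \<Inter>\<F> = C \<or> C \<inter> \<Inter>\<F> = \<Inter>\<F>" by blast
            then show ?thesis using I unfolding Inter_insert by auto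
          qed simp
        qed
      qed simp
      have "\<Inter>\<C> \<noteq> {}"
      proof (rule X[unfolded compact_space_fip, rule_format], intro conjI ballI allI impI)
        show "closedin X C" if "C \<in> \<C>" for C using sub that by auto
        show "\<Inter>\<F> \<noteq> {}" if "finite \<F> \<and> \<F> \<subseteq> \<C>" for \<F>
          using fin[of \<F>] that sub by (cases "\<F> = {}") auto
      qed
      moreover have "closedin X (\<Inter>\<C>)" using False sub by (intro closedin_Inter) auto
      moreover have "P (\<Inter>\<C>)" using False sub by (intro Inter) auto
      moreover have "\<Inter>\<C> \<subseteq> A" using False sub by blast
      ultimately show ?thesis by (intro bexI[of _ "\<Inter>\<C>"]) auto
    qed
  qed
  then obtain M where M: "M \<in> ?Q" and min: "\<forall>C\<in>?Q. C \<subseteq> M \<longrightarrow> C = M" by (elim bexE)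
  show ?thesis
  proof (rule that[of M])
    fix C assume C: "closedin X C" "C \<noteq> {}" "P C" "C \<subseteq> M"
    then have "C \<in> ?Q" using M by blast
    then show "C = M" using min[rule_format, of C] C(4) by blast
  qed (use M in simp_all)
qed

locale compact_right_topological_semigroup =
  fixes X :: "'s topology" and m :: "'s \<Rightarrow> 's \<Rightarrow> 's"  (infixl "\<odot>" 70)
  assumes compact: "compact_space X" and Hausdorff: "Hausdorff_space X"
    and closed: "a \<in> topspace X \<Longrightarrow> b \<in> topspace X \<Longrightarrow> a \<odot> b \<in> topspace X"
    and assoc: "a \<in> topspace X \<Longrightarrow> b \<in> topspace X \<Longrightarrow> c \<in> topspace X \<Longrightarrow> a \<odot> b \<odot> c = a \<odot> (b \<odot> c)"
    and right_continuous: "b \<in> topspace X \<Longrightarrow> continuous_map X X (\<lambda>a. a \<odot> b)"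
begin

lemma closedin_right_translate:
  assumes "closedin X Q" "x \<in> topspace X"
  shows "closedin X ((\<lambda>a. a \<odot> x) ` Q)"
  using closedin_compact_space[OF compact assms(1)] right_continuous[OF assms(2)] Hausdorff
  by (meson compactin_imp_closedin image_compactin)

lemma closedin_right_stabilizer:
  assumes "closedin X Q" "x \<in> topspace X" "y \<in> topspace X"
  shows "closedin X {a \<in> Q. a \<odot> x = y}"
proof -
  have "closedin X {a \<in> topspace X. a \<odot> x \<in> {y}}"
    by (rule closedin_continuous_map_preimage[OF right_continuous[OF assms(2)]])
      (simp add: closedin_Hausdorff_singleton[OF Hausdorff] assms)
  then have "closedin X (Q \<inter> {a \<in> topspace X. a \<odot> x \<in> {y}})" using assms(1) by blast
  moreover have "Q \<inter> {a \<in> topspace X. a \<odot> x \<in> {y}} = {a \<in> Q. a \<odot> x = y}"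
    using closedin_subset[OF assms(1)] by auto
  ultimately show ?thesis by simp
qed

text \<open>Ellis's lemma. In a minimal closed subsemigroup \<open>M\<close> with element \<open>x\<close>, both \<open>M x\<close> and the stabiliser of \<open>x\<close> are closed
subsemigroups, hence all of \<open>M\<close>; in particular \<open>x\<close> stabilises itself.\<close>

lemma idempotent_exists:
  assumes Q: "closedin X Q" "Q \<noteq> {}" "\<And>a b. a \<in> Q \<Longrightarrow> b \<in> Q \<Longrightarrow> a \<odot> b \<in> Q"
  obtains e where "e \<in> Q" "e \<odot> e = e"
proof -
  let ?P = "\<lambda>C. \<forall>a\<in>C. \<forall>b\<in>C. a \<odot> b \<in> C"
  have PQ: "?P Q" using Q(3) by blast
  have PI: "?P (\<Inter>\<C>)" if "\<And>C. C \<in> \<C> \<Longrightarrow> closedin X C \<and> ?P C" for \<C>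
    using that by (meson InterE InterI)
  obtain M where M: "closedin X M" "M \<noteq> {}" "?P M" "M \<subseteq> Q"
    and min: "\<And>C. closedin X C \<Longrightarrow> C \<noteq> {} \<Longrightarrow> ?P C \<Longrightarrow> C \<subseteq> M \<Longrightarrow> C = M"
    using minimal_closed_set_exists[where P = ?P, OF compact Q(1,2) PQ PI] by metis
  have top: "a \<in> topspace X" if "a \<in> M" for a using closedin_subset[OF M(1)] that by auto
  obtain x where x: "x \<in> M" using M(2) by blast
  have "(\<lambda>a. a \<odot> x) ` M = M"
  proof (rule min[OF closedin_right_translate[OF M(1) top[OF x]]])
    show "\<forall>a\<in>(\<lambda>a. a \<odot> x) ` M. \<forall>b\<in>(\<lambda>a. a \<odot> x) ` M. a \<odot> b \<in> (\<lambda>a. a \<odot> x) ` M"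
    proof safe
      fix a b assume ab: "a \<in> M" "b \<in> M"
      have "(a \<odot> x) \<odot> (b \<odot> x) = ((a \<odot> x) \<odot> b) \<odot> x" using ab x by (simp add: assoc closed top)
      then show "(a \<odot> x) \<odot> (b \<odot> x) \<in> (\<lambda>a. a \<odot> x) ` M" using ab x M(3) by blast
    qed
  qed (use x M in auto)
  then obtain y where y: "y \<in> M" "y \<odot> x = x" using x by (metis imageE)
  have "{a \<in> M. a \<odot> x = x} = M"
  proof (rule min[OF closedin_right_stabilizer[OF M(1) top[OF x] top[OF x]]])
    show "\<forall>a\<in>{a \<in> M. a \<odot> x = x}. \<forall>b\<in>{a \<in> M. a \<odot> x = x}. a \<odot> b \<in> {a \<in> M. a \<odot> x = x}"
      using M(3) x by (auto simp: assoc top)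
  qed (use y in auto)
  then have "x \<odot> x = x" using x by blast
  then show ?thesis using that x M(4) by blast
qed

lemma minimal_left_ideal_exists:
  assumes ne: "topspace X \<noteq> {}"
  obtains L where "closedin X L" "L \<noteq> {}" "\<And>s a. s \<in> topspace X \<Longrightarrow> a \<in> L \<Longrightarrow> s \<odot> a \<in> L"
    "\<And>a. a \<in> L \<Longrightarrow> (\<lambda>s. s \<odot> a) ` topspace X = L"
proof -
  let ?P = "\<lambda>C. \<forall>s\<in>topspace X. \<forall>a\<in>C. s \<odot> a \<in> C"
  have PQ: "?P (topspace X)" using closed by blast
  have PI: "?P (\<Inter>\<C>)" if "\<And>C. C \<in> \<C> \<Longrightarrow> closedin X C \<and> ?P C" for \<C>
    using that by (meson InterE InterI)
  obtain L where L: "closedin X L" "L \<noteq> {}" "?P L"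
    and min: "\<And>C. closedin X C \<Longrightarrow> C \<noteq> {} \<Longrightarrow> ?P C \<Longrightarrow> C \<subseteq> L \<Longrightarrow> C = L"
    using minimal_closed_set_exists[where P = ?P, OF compact closedin_topspace ne PQ PI] by metis
  have "(\<lambda>s. s \<odot> a) ` topspace X = L" if a: "a \<in> L" for a
  proof (rule min)
    have at: "a \<in> topspace X" using closedin_subset[OF L(1)] a by auto
    show "closedin X ((\<lambda>s. s \<odot> a) ` topspace X)" by (rule closedin_right_translate[OF closedin_topspace at])
    show "\<forall>s\<in>topspace X. \<forall>b\<in>(\<lambda>s. s \<odot> a) ` topspace X. s \<odot> b \<in> (\<lambda>s. s \<odot> a) ` topspace X"
    proof safe
      fix s t assume "s \<in> topspace X" "t \<in> topspace X"
      then show "s \<odot> (t \<odot> a) \<in> (\<lambda>s. s \<odot> a) ` topspace X"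
        using at by (intro image_eqI[of _ _ "s \<odot> t"]) (auto simp: assoc closed)
    qed
  qed (use ne a L in auto)
  then show ?thesis using that L by blast
qed

end

section \<open>The closed semigroup\<close>

lemma blinfun_comp_assoc: "(A o\<^sub>L B) o\<^sub>L C = A o\<^sub>L (B o\<^sub>L C)"
  by (rule blinfun_eqI) simp

lemma comp_cblinfuns: "S \<in> cblinfuns \<Longrightarrow> T \<in> cblinfuns \<Longrightarrow> S o\<^sub>L T \<in> cblinfuns"
  by (simp add: cblinfuns_def)

lemma continuous_comp_right:
  assumes "B \<subseteq> cblinfuns" "R \<in> cblinfuns"
  shows "continuous_map (subtopology (weak_star_operator_topology N) B) (weak_star_operator_topology N) (\<lambda>T. T o\<^sub>L R)"
proof -
  have "continuous_map (subtopology (weak_star_operator_topology N) B) (weak_star_operator_topology N) (\<lambda>T. T)"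
    by (rule continuous_map_from_subtopology) simp
  then show ?thesis
    using assms unfolding continuous_map_weak_star_operator_topology by (auto intro: comp_cblinfuns)
qed

lemma continuous_comp_left:
  assumes N: "predual N" and \<Phi>: "\<forall>\<phi>\<in>\<Phi>. normal_state N \<phi>" and faith: "faithful \<Phi>"
    and R: "state_contraction \<Phi> R"
    and B: "B \<subseteq> cblinfuns" "\<And>T. T \<in> B \<Longrightarrow> norm T \<le> K"
  shows "continuous_map (subtopology (weak_star_operator_topology N) B) (weak_star_operator_topology N) (\<lambda>T. R o\<^sub>L T)"
proof -
  let ?X = "subtopology (weak_star_operator_topology N) B"
  have topX: "topspace ?X = B" using B by auto
  show ?thesis
    unfolding continuous_map_weak_star_operator_topology topX
  proof (intro conjI ballI allI)
    show "R o\<^sub>L T \<in> cblinfuns" if "T \<in> B" for T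
      using that B(1) R by (auto simp: state_contraction_def intro: comp_cblinfuns)
  next
    fix a x assume a: "a \<in> B"
    have "continuous_map ?X (weak_star_operator_topology N) (\<lambda>T. T)"
      by (rule continuous_map_from_subtopology) simp
    then have w: "wconv N (atin ?X a) (\<lambda>T. blinfun_apply T x) (a x)"
      by (rule wconv_atin_continuous_operators) (simp only: topX a)
    have "\<forall>\<^sub>F T in atin ?X a. T \<in> B"
      using eventually_atin_topspace[of ?X a] unfolding topX .
    then have "\<forall>\<^sub>F T in atin ?X a. norm (blinfun_apply T x) \<le> K * norm x"
    proof eventually_elim
      case (elim T)
      then show ?case using norm_blinfun[of T x] mult_right_mono[OF B(2)[OF elim], of "norm x"] by simp
    qed
    from wconv_state_contraction[OF N \<Phi> faith R this w]
    show "wconv N (atin ?X a) (\<lambda>T. blinfun_apply (R o\<^sub>L T) x) (blinfun_apply (R o\<^sub>L a) x)"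
      by simp
  qed
qed

text \<open>The properties of the closure of the given semigroup that determine its structure.\<close>

locale contraction_semigroup =
  fixes N \<Phi> :: "('a::cstar_algebra \<Rightarrow>\<^sub>L complex) set" and SS :: "('a \<Rightarrow>\<^sub>L 'a) set" and K :: real
  assumes predual: "predual N" and states: "\<forall>\<phi>\<in>\<Phi>. normal_state N \<phi>" and faithful: "faithful \<Phi>"
    and compactin_SS: "compactin (weak_star_operator_topology N) SS" and nonempty: "SS \<noteq> {}"
    and norm_bound: "T \<in> SS \<Longrightarrow> norm T \<le> K"
    and contraction: "T \<in> SS \<Longrightarrow> state_contraction \<Phi> T"
    and comp_closed: "S \<in> SS \<Longrightarrow> T \<in> SS \<Longrightarrow> S o\<^sub>L T \<in> SS"
begin

abbreviation "W \<equiv> weak_star_operator_topology N"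
abbreviation "sq \<phi> x \<equiv> Re (blinfun_apply \<phi> (adj x * x))"

lemma complex_linear: "T \<in> SS \<Longrightarrow> T \<in> cblinfuns"
  using contraction unfolding state_contraction_def by blast

lemma SS_cblinfuns: "SS \<subseteq> cblinfuns"
  using complex_linear by blast

lemma sq_le: "T \<in> SS \<Longrightarrow> \<phi> \<in> \<Phi> \<Longrightarrow> sq \<phi> (blinfun_apply T x) \<le> sq \<phi> x"
  using contraction unfolding state_contraction_def by blast

lemma norm_apply_le: "T \<in> SS \<Longrightarrow> norm (blinfun_apply T x) \<le> K * norm x"
  using norm_blinfun[of T x] mult_right_mono[OF norm_bound norm_ge_zero, of T x] by linarith

lemma isometric_at:
  assumes "T \<in> SS" "\<phi> \<in> \<Phi>" "sq \<phi> (blinfun_apply T x) = sq \<phi> x"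
  shows "blinfun_apply \<phi> (adj (blinfun_apply T x) * T y) = \<phi> (adj x * y)"
  using contraction_isometric_at[OF predual states[rule_format] complex_linear sq_le] assms by blast

lemma Hausdorff_W: "Hausdorff_space W"
  by (rule Hausdorff_weak_star_operator_topology[OF predual])

lemma topspace_sub: "B \<subseteq> SS \<Longrightarrow> topspace (subtopology W B) = B"
  using SS_cblinfuns by auto

lemma eventually_sub: "B \<subseteq> SS \<Longrightarrow> \<forall>\<^sub>F T in atin (subtopology W B) a. T \<in> B"
  by (rule eventually_mono[OF eventually_atin_topspace]) (simp only: topspace_sub)

lemma wconv_sub:
  assumes "a \<in> B" "B \<subseteq> SS"
  shows "wconv N (atin (subtopology W B) a) (\<lambda>T. blinfun_apply T x) (a x)"
proof (rule wconv_atin_continuous_operators)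
  show "continuous_map (subtopology W B) W (\<lambda>T. T)"
    by (rule continuous_map_from_subtopology) simp
qed (use assms topspace_sub in auto)

lemma continuous_comp_left_sub:
  assumes R: "R \<in> SS" and B: "B \<subseteq> SS"
  shows "continuous_map (subtopology W B) W (\<lambda>T. R o\<^sub>L T)"
  using B norm_bound
  by (intro continuous_comp_left[OF predual states faithful contraction[OF R], of _ K])
    (auto intro: complex_linear)

lemma semitopological: "semitopological_semigroup (subtopology W SS) (o\<^sub>L)"
  unfolding semitopological_semigroup_def topspace_sub[OF order_refl]
  using continuous_comp_left_sub[OF _ order_refl] continuous_comp_right[OF SS_cblinfuns complex_linear]
  by (auto simp: comp_closed blinfun_comp_assoc continuous_map_in_subtopology topspace_sub[OF order_refl] Pi_iff image_subset_iff)

sublocale compact_right_topological_semigroup "subtopology W SS" "(o\<^sub>L)"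
proof
  show "compact_space (subtopology W SS)" using compactin_SS by (simp add: compactin_subspace)
  show "Hausdorff_space (subtopology W SS)" by (rule Hausdorff_space_subtopology[OF Hausdorff_W])
  show "continuous_map (subtopology W SS) (subtopology W SS) (\<lambda>a. a o\<^sub>L b)" if "b \<in> topspace (subtopology W SS)" for b
    using semitopological that unfolding semitopological_semigroup_def by blast
qed (use topspace_sub[OF order_refl] comp_closed in \<open>auto simp: blinfun_comp_assoc\<close>)

text \<open>The orbit is the image of a compact set under evaluation at \<open>x\<close>.\<close>

lemma orbit_closed:
  "weak_star_topology N closure_of {blinfun_apply T x |T. T \<in> SS} = {blinfun_apply T x |T. T \<in> SS}"
proof -
  have "{blinfun_apply T x |T. T \<in> SS} = (\<lambda>T. blinfun_apply T x) ` SS" by blast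
  moreover have "compactin (weak_star_topology N) ((\<lambda>T. blinfun_apply T x) ` SS)"
    by (rule image_compactin[OF compactin_SS continuous_map_eval_operator])
  ultimately show ?thesis
    using compactin_imp_closedin[OF Hausdorff_weak_star_topology[OF predual]] by (simp add: closure_of_eq)
qed

section \<open>The kernel\<close>

text \<open>Contractive idempotents of a Hilbert space are orthogonal projections. This is the reason why the kernel of the semigroup has a
single idempotent: two orthogonal projections with the same kernel are equal.\<close>

lemma idempotent_orthogonal:
  assumes E: "E \<in> SS" "E o\<^sub>L E = E" and \<phi>: "\<phi> \<in> \<Phi>" and y: "blinfun_apply E y = 0"
  shows "blinfun_apply \<phi> (adj (blinfun_apply E x) * y) = 0"
proof -
  have "blinfun_apply E (blinfun_apply E x) = E x" using E(2) by (metis blinfun_apply_blinfun_compose)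
  then show ?thesis
    using isometric_at[OF E(1) \<phi>, of "blinfun_apply E x" y] by (simp add: y)
qed

lemma eq_zero_if_states_eq_zero:
  assumes "\<And>\<phi>. \<phi> \<in> \<Phi> \<Longrightarrow> blinfun_apply \<phi> (adj x * x) = 0"
  shows "x = 0"
  by (rule eq_zero_if_states_vanish[OF predual states faithful]) (simp add: assms)

lemma idempotents_eq:
  assumes P: "P \<in> SS" "P o\<^sub>L P = P" and E: "E \<in> SS" "E o\<^sub>L E = E"
    and PE: "P o\<^sub>L E = P" "E o\<^sub>L P = E"
  shows "P = E"
proof (rule blinfun_eqI)
  fix x
  let ?z = "blinfun_apply P x - blinfun_apply E x"
  have app: "blinfun_apply P (P y) = P y" "blinfun_apply E (E y) = E y"
     "blinfun_apply P (E y) = P y" "blinfun_apply E (P y) = E y" for y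
    using P(2) E(2) PE by (metis blinfun_apply_blinfun_compose)+
  have "?z = 0"
  proof (rule eq_zero_if_states_eq_zero)
    fix \<phi> assume \<phi>: "\<phi> \<in> \<Phi>"
    have "blinfun_apply \<phi> (adj (blinfun_apply P x) * ?z) = 0"
      by (rule idempotent_orthogonal[OF P \<phi>]) (simp add: blinfun.diff_right app)
    moreover have "blinfun_apply \<phi> (adj (blinfun_apply E x) * ?z) = 0"
      by (rule idempotent_orthogonal[OF E \<phi>]) (simp add: blinfun.diff_right app)
    ultimately show "blinfun_apply \<phi> (adj ?z * ?z) = 0"
      by (simp only: adj_diff left_diff_distrib blinfun.diff_right[of \<phi>] diff_self)
  qed
  then show "blinfun_apply P x = blinfun_apply E x" by simp
qed

lemma isometric_if_left_invertible:
  assumes "T \<in> SS" "s \<in> SS" "s o\<^sub>L (T o\<^sub>L P) = P" "\<phi> \<in> \<Phi>"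
  shows "sq \<phi> (blinfun_apply T (P x)) = sq \<phi> (blinfun_apply P x)"
proof (rule antisym)
  show "sq \<phi> (blinfun_apply T (P x)) \<le> sq \<phi> (blinfun_apply P x)" by (rule sq_le[OF assms(1,4)])
  have "blinfun_apply s (T (P x)) = P x"
    using arg_cong[OF assms(3), of "\<lambda>A. blinfun_apply A x"] by simp
  then show "sq \<phi> (blinfun_apply P x) \<le> sq \<phi> (blinfun_apply T (P x))"
    using sq_le[OF assms(2,4), of "blinfun_apply T (P x)"] by simp
qed

text \<open>\<open>L\<close> is a closed left ideal in which \<open>P\<close> is a right unit and every element is left invertible up to \<open>P\<close>, and \<open>P\<close> commutes
with the semigroup. These facts suffice for \<open>L\<close> to be the minimal ideal and a group with unit \<open>P\<close>.\<close>

definition is_kernel :: "('a \<Rightarrow>\<^sub>L 'a) set \<Rightarrow> ('a \<Rightarrow>\<^sub>L 'a) \<Rightarrow> bool"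
  where "is_kernel L P \<longleftrightarrow> closedin (subtopology W SS) L \<and> P \<in> L \<and> P o\<^sub>L P = P \<and>
    (\<forall>l\<in>L. l o\<^sub>L P = l \<and> (\<exists>s\<in>SS. s o\<^sub>L l = P)) \<and> (\<forall>T\<in>SS. T o\<^sub>L P \<in> L \<and> P o\<^sub>L T = T o\<^sub>L P)"

text \<open>Let \<open>P\<close> be an idempotent of a minimal left ideal \<open>L\<close>. For \<open>l\<close> in \<open>L\<close> the stabiliser of \<open>l\<close> in \<open>L\<close> contains an idempotent; it
has the same kernel as \<open>P\<close>, hence equals \<open>P\<close>, and \<open>P l = l\<close>. So each operator \<open>T\<close> maps the range of \<open>P\<close> onto itself, and it does so
isometrically, because \<open>T P\<close> is left invertible. A contraction that is isometric on a subspace preserves orthogonality to it, so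
\<open>T\<close> also maps the kernel of \<open>P\<close> to itself, and \<open>P T = T P\<close>.\<close>

lemma kernel_exists: "\<exists>L P. is_kernel L P"
proof -
  note top = topspace_sub[OF order_refl]
  have ne: "topspace (subtopology W SS) \<noteq> {}" using nonempty by (simp only: top) simp
  obtain L where L: "closedin (subtopology W SS) L" "L \<noteq> {}" "\<And>s a. s \<in> SS \<Longrightarrow> a \<in> L \<Longrightarrow> s o\<^sub>L a \<in> L"
    and Lmin: "\<And>a. a \<in> L \<Longrightarrow> (\<lambda>s. s o\<^sub>L a) ` SS = L"
    using minimal_left_ideal_exists[OF ne] unfolding top by metis
  have sub: "L \<subseteq> SS" using closedin_subset[OF L(1)] unfolding top .
  have LL: "a o\<^sub>L b \<in> L" if "a \<in> L" "b \<in> L" for a b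
    using that sub L(3) by blast
  obtain P where P: "P \<in> L" "P o\<^sub>L P = P"
    by (rule idempotent_exists[OF L(1,2) LL])
  have PS: "P \<in> SS" using P sub by blast
  have right_unit: "l o\<^sub>L e = l" if l: "l \<in> L" and e: "e \<in> L" "e o\<^sub>L e = e" for l e
  proof -
    obtain s where "l = s o\<^sub>L e" using Lmin[OF e(1)] l by auto
    then show ?thesis using e(2) by (simp add: blinfun_comp_assoc)
  qed
  have fixed: "P o\<^sub>L l = l" if l: "l \<in> L" for l
  proof -
    let ?Q = "{s \<in> L. s o\<^sub>L l = l}"
    have lS: "l \<in> SS" using l sub by blast
    have "closedin (subtopology W SS) ?Q"
      by (rule closedin_right_stabilizer[OF L(1)]) (simp_all only: top lS)
    moreover have "?Q \<noteq> {}"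
    proof -
      have "l o\<^sub>L l \<in> L" by (rule L(3)[OF lS l])
      then have "l \<in> (\<lambda>s. s o\<^sub>L (l o\<^sub>L l)) ` SS" using Lmin l by simp
      then obtain s where s: "s \<in> SS" "l = s o\<^sub>L (l o\<^sub>L l)" by (rule imageE)
      then have "s o\<^sub>L l \<in> ?Q" using L(3)[OF s(1) l] by (simp add: blinfun_comp_assoc)
      then show ?thesis by blast
    qed
    moreover have "a o\<^sub>L b \<in> ?Q" if "a \<in> ?Q" "b \<in> ?Q" for a b
      using that LL by (simp add: blinfun_comp_assoc)
    ultimately obtain e where e: "e \<in> ?Q" "e o\<^sub>L e = e" by (rule idempotent_exists)
    then have eL: "e \<in> L" by simp
    have "P = e"
      by (rule idempotents_eq[OF PS P(2) subsetD[OF sub eL] e(2) right_unit[OF P(1) eL e(2)] right_unit[OF eL P]])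
    then show ?thesis using e by simp
  qed
  have inv: "\<exists>s\<in>SS. s o\<^sub>L l = P" if "l \<in> L" for l using Lmin[OF that] P(1) by (metis imageE)
  have iso: "sq \<phi> (blinfun_apply T (P x)) = sq \<phi> (blinfun_apply P x)"
    if T: "T \<in> SS" and \<phi>: "\<phi> \<in> \<Phi>" for T \<phi> x
    using inv[OF L(3)[OF T P(1)]] isometric_if_left_invertible[OF T _ _ \<phi>] by blast
  have PP: "blinfun_apply P (P x) = P x" for x using P(2) by (metis blinfun_apply_blinfun_compose)
  have central: "P o\<^sub>L T = T o\<^sub>L P" if T: "T \<in> SS" for T
  proof -
    let ?U = "T o\<^sub>L P"
    have UL: "?U \<in> L" by (rule L(3)[OF T P(1)])
    obtain s where s: "s \<in> SS" "s o\<^sub>L ?U = P" using inv[OF UL] by blast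
    define g where "g = s o\<^sub>L P"
    have gL: "g \<in> L" unfolding g_def by (rule L(3)[OF s(1) P(1)])
    have gU: "g o\<^sub>L ?U = P" using s(2) fixed[OF UL] by (simp add: g_def blinfun_comp_assoc)
    have Ug: "?U o\<^sub>L g = P"
    proof -
      obtain r where "r \<in> SS" "r o\<^sub>L g = P" using inv[OF gL] by blast
      then have "?U = r o\<^sub>L g o\<^sub>L ?U" using fixed[OF UL] by simp
      also have "\<dots> = r o\<^sub>L P" by (simp add: blinfun_comp_assoc gU)
      finally have "?U o\<^sub>L g = r o\<^sub>L (P o\<^sub>L g)" by (simp add: blinfun_comp_assoc)
      then show ?thesis using fixed[OF gL] \<open>r o\<^sub>L g = P\<close> by simp
    qed
    have kernel_invariant: "blinfun_apply P (T w) = 0" if w: "blinfun_apply P w = 0" for w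
    proof (rule eq_zero_if_states_eq_zero)
      fix \<phi> assume \<phi>: "\<phi> \<in> \<Phi>"
      let ?z = "blinfun_apply P (T w)"
      have z: "T (P (g ?z)) = ?z"
        using arg_cong[OF Ug, of "\<lambda>A. blinfun_apply A ?z"] PP by simp
      have "blinfun_apply \<phi> (adj (blinfun_apply T (P (g ?z))) * T w) = \<phi> (adj (P (g ?z)) * w)"
        by (rule isometric_at[OF T \<phi> iso[OF T \<phi>]])
      also have "\<dots> = 0"
        by (rule idempotent_orthogonal[OF PS P(2) \<phi> w])
      finally have "blinfun_apply \<phi> (adj ?z * T w) = 0" unfolding z .
      moreover have "blinfun_apply \<phi> (adj ?z * (T w - ?z)) = 0"
        by (rule idempotent_orthogonal[OF PS P(2) \<phi>]) (simp add: blinfun.diff_right PP)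
      ultimately show "blinfun_apply \<phi> (adj ?z * ?z) = 0"
        by (simp add: right_diff_distrib blinfun.diff_right)
    qed
    show ?thesis
    proof (rule blinfun_eqI)
      fix x
      have "blinfun_apply P (T (x - P x)) = 0"
        by (rule kernel_invariant) (simp add: blinfun.diff_right PP)
      then have "blinfun_apply P (T x) = P (T (P x))" by (simp add: blinfun.diff_right)
      also have "\<dots> = T (P x)" using arg_cong[OF fixed[OF UL], of "\<lambda>A. blinfun_apply A x"] by simp
      finally show "blinfun_apply (P o\<^sub>L T) x = (T o\<^sub>L P) x" by simp
    qed
  qed
  have "is_kernel L P"
    unfolding is_kernel_def
    using L(1) P right_unit[OF _ P] inv central L(3)[OF _ P(1)] by blast
  then show ?thesis by blast
qed

context
  fixes L P assumes kernel: "is_kernel L P"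
begin

lemma kernel_closed: "closedin (subtopology W SS) L"
  and unit_in: "P \<in> L" and idem: "P o\<^sub>L P = P"
  and right_unit: "l \<in> L \<Longrightarrow> l o\<^sub>L P = l"
  and left_inverse_SS: "l \<in> L \<Longrightarrow> \<exists>s\<in>SS. s o\<^sub>L l = P"
  and absorb: "T \<in> SS \<Longrightarrow> T o\<^sub>L P \<in> L"
  and central: "T \<in> SS \<Longrightarrow> P o\<^sub>L T = T o\<^sub>L P"
  using kernel unfolding is_kernel_def by blast+

lemma kernel_subset: "L \<subseteq> SS"
  using closedin_subset[OF kernel_closed] unfolding topspace_sub[OF order_refl] .

lemma unit_in_SS: "P \<in> SS" using unit_in kernel_subset by blast

lemma left_unit: "l \<in> L \<Longrightarrow> P o\<^sub>L l = l"
  using central right_unit kernel_subset by auto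

lemma ideal: "T \<in> SS \<Longrightarrow> l \<in> L \<Longrightarrow> T o\<^sub>L l \<in> L \<and> l o\<^sub>L T \<in> L"
proof
  assume T: "T \<in> SS" and l: "l \<in> L"
  then have lS: "l \<in> SS" using kernel_subset by blast
  have "T o\<^sub>L l = (T o\<^sub>L l) o\<^sub>L P" using right_unit[OF l] by (simp add: blinfun_comp_assoc)
  then show "T o\<^sub>L l \<in> L" using absorb[OF comp_closed[OF T lS]] by simp
  have "l o\<^sub>L T = (l o\<^sub>L T) o\<^sub>L P"
    using right_unit[OF l] central[OF T] by (metis blinfun_comp_assoc)
  then show "l o\<^sub>L T \<in> L" using absorb[OF comp_closed[OF lS T]] by simp
qed

lemma left_inverse: "l \<in> L \<Longrightarrow> \<exists>g\<in>L. g o\<^sub>L l = P"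
proof -
  assume l: "l \<in> L"
  obtain s where s: "s \<in> SS" "s o\<^sub>L l = P" using left_inverse_SS[OF l] by blast
  have "(s o\<^sub>L P) o\<^sub>L l = P" using s left_unit[OF l] by (simp add: blinfun_comp_assoc)
  then show ?thesis using absorb[OF s(1)] by blast
qed

lemma minimal_ideal_kernel: "minimal_ideal SS L"
proof -
  have "J = L" if J: "semigroup_ideal SS J" "J \<subseteq> L" for J
  proof
    obtain j where j: "j \<in> J" using J unfolding semigroup_ideal_def by blast
    then obtain s where "s \<in> SS" "s o\<^sub>L j = P" using left_inverse_SS J by blast
    then have PJ: "P \<in> J" using J j unfolding semigroup_ideal_def by metis
    show "L \<subseteq> J"
    proof
      fix l assume l: "l \<in> L"
      then have "l o\<^sub>L P \<in> J" using J(1) PJ kernel_subset unfolding semigroup_ideal_def by blast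
      then show "l \<in> J" using right_unit[OF l] by simp
    qed
  qed (rule J)
  then show ?thesis
    using ideal unit_in kernel_subset unfolding minimal_ideal_def semigroup_ideal_def by blast
qed

lemma minimal_ideal_unique:
  assumes M: "minimal_ideal SS M"
  shows "M = L"
proof -
  have MI: "semigroup_ideal SS M" using M unfolding minimal_ideal_def by blast
  obtain j where j: "j \<in> M" using MI unfolding semigroup_ideal_def by blast
  then have jS: "j \<in> SS" using MI unfolding semigroup_ideal_def by blast
  obtain s where s: "s \<in> SS" "s o\<^sub>L (j o\<^sub>L P) = P" using left_inverse_SS[OF absorb[OF jS]] by blast
  have "j o\<^sub>L P \<in> M" using MI j unit_in_SS unfolding semigroup_ideal_def by blast
  then have PM: "P \<in> M" using MI s unfolding semigroup_ideal_def by metis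
  have "L \<subseteq> M"
  proof
    fix l assume l: "l \<in> L"
    then have "l o\<^sub>L P \<in> M" using MI PM kernel_subset unfolding semigroup_ideal_def by blast
    then show "l \<in> M" using right_unit[OF l] by simp
  qed
  then show ?thesis
    using M minimal_ideal_kernel unfolding minimal_ideal_def by metis
qed

lemma isometric_on_range:
  assumes T: "T \<in> SS" and \<phi>: "\<phi> \<in> \<Phi>"
  shows "sq \<phi> (blinfun_apply T (P x)) = sq \<phi> (blinfun_apply P x)"
  using left_inverse_SS[OF absorb[OF T]] isometric_if_left_invertible[OF T _ _ \<phi>] by blast

lemma isometric_kernel: "l \<in> L \<Longrightarrow> \<phi> \<in> \<Phi> \<Longrightarrow> sq \<phi> (blinfun_apply l x) = sq \<phi> (blinfun_apply P x)"
  using isometric_on_range[of l \<phi> x] right_unit[of l] kernel_subset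
  by (metis blinfun_apply_blinfun_compose subsetD)

abbreviation "G \<equiv> \<lparr>carrier = L, mult = (o\<^sub>L), one = P\<rparr>"

lemma group_kernel: "group G"
proof (rule groupI)
  show "x \<otimes>\<^bsub>G\<^esub> y \<in> carrier G" if "x \<in> carrier G" "y \<in> carrier G" for x y
    using that ideal kernel_subset by auto
  show "\<exists>y\<in>carrier G. y \<otimes>\<^bsub>G\<^esub> x = \<one>\<^bsub>G\<^esub>" if "x \<in> carrier G" for x
    using that left_inverse by auto
qed (auto simp: unit_in left_unit blinfun_comp_assoc)

lemma strong_convergence:
  fixes T :: "'i \<Rightarrow> 'a \<Rightarrow>\<^sub>L 'a" and a :: "'a \<Rightarrow>\<^sub>L 'a"
  assumes "wconv N F (\<lambda>i. blinfun_apply (T i) x) (a x)" "\<forall>\<^sub>F i in F. T i \<in> L" "a \<in> L" "\<phi> \<in> \<Phi>"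
  shows "((\<lambda>i. sq \<phi> (blinfun_apply (T i) x - a x)) \<longlongrightarrow> 0) F"
proof (rule tendsto_state_square_diff[OF predual states faithful assms(4) _ assms(1)])
  show "\<forall>\<^sub>F i in F. norm (blinfun_apply (T i) x) \<le> K * norm x"
    using assms(2) by eventually_elim (use kernel_subset norm_apply_le in blast)
  show "\<forall>\<^sub>F i in F. sq \<phi> (blinfun_apply (T i) x) = sq \<phi> (blinfun_apply a x)"
    using assms(2) by eventually_elim (simp add: isometric_kernel assms)
qed

lemma topspace_kernel: "topspace (subtopology W L) = L"
  by (rule topspace_sub[OF kernel_subset])

lemma continuous_map_into_kernel:
  assumes "continuous_map Z W f" "\<And>z. z \<in> topspace Z \<Longrightarrow> f z \<in> L"
  shows "continuous_map Z (subtopology W L) f"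
  using assms by (auto simp: continuous_map_in_subtopology)

lemma wconv_kernel:
  assumes "continuous_map Z (subtopology W L) f" "p \<in> topspace Z"
  shows "wconv N (atin Z p) (\<lambda>z. blinfun_apply (f z) y) (f p y)"
  using assms by (intro wconv_atin_continuous_operators) (simp_all add: continuous_map_in_subtopology)

text \<open>The elements of the kernel are isometric on the range of \<open>P\<close>, so on the kernel weak convergence is strong convergence
(\<open>strong_convergence\<close>), for which composition is jointly continuous on bounded sets.\<close>

lemma comp_jointly_continuous:
  "continuous_map (prod_topology (subtopology W L) (subtopology W L)) (subtopology W L) (\<lambda>p. fst p o\<^sub>L snd p)"
proof (rule continuous_map_into_kernel)
  let ?Z = "prod_topology (subtopology W L) (subtopology W L)"
  have topZ: "topspace ?Z = L \<times> L" by (simp only: topspace_prod_topology topspace_kernel)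
  have inL: "fst p o\<^sub>L snd p \<in> L" if "p \<in> topspace ?Z" for p
  proof -
    have "fst p \<in> SS" "snd p \<in> L" using that kernel_subset unfolding topZ by auto
    then show ?thesis using ideal by blast
  qed
  then show "fst p o\<^sub>L snd p \<in> L" if "p \<in> topspace ?Z" for p using that .
  show "continuous_map ?Z W (\<lambda>p. fst p o\<^sub>L snd p)"
    unfolding continuous_map_weak_star_operator_topology
  proof (intro conjI ballI allI)
    show "fst p o\<^sub>L snd p \<in> cblinfuns" if "p \<in> topspace ?Z" for p
      using inL[OF that] kernel_subset complex_linear by blast
  next
    fix p x assume p: "p \<in> topspace ?Z"
    let ?F = "atin ?Z p"
    let ?b = "blinfun_apply (snd p) x"
    have snd_p: "snd p \<in> L" using p unfolding topZ by auto
    have evZ: "\<forall>\<^sub>F z in ?F. z \<in> L \<times> L"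
      using eventually_atin_topspace[of ?Z p] by (simp only: topZ)
    have ev1: "\<forall>\<^sub>F z in ?F. fst z \<in> L" and ev2: "\<forall>\<^sub>F z in ?F. snd z \<in> L"
      by (rule eventually_mono[OF evZ]; auto)+
    note cf = wconv_kernel[OF continuous_map_fst p] and cs = wconv_kernel[OF continuous_map_snd p]
    show "wconv N ?F (\<lambda>z. blinfun_apply (fst z o\<^sub>L snd z) x) (blinfun_apply (fst p o\<^sub>L snd p) x)"
    proof (rule wconv_if_states_converge[OF predual states faithful])
      show "\<forall>\<^sub>F z in ?F. norm (blinfun_apply (fst z o\<^sub>L snd z) x) \<le> K * norm x"
        using ev1 ev2
      proof eventually_elim
        case (elim z)
        then have "fst z o\<^sub>L snd z \<in> SS" using comp_closed kernel_subset by blast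
        then show ?case by (rule norm_apply_le)
      qed
      fix \<phi> y assume \<phi>: "\<phi> \<in> \<Phi>"
      have bd: "\<forall>\<^sub>F z in ?F. norm (blinfun_apply (fst z) ?b) \<le> K * norm ?b"
        using ev1 by eventually_elim (rule norm_apply_le, rule subsetD[OF kernel_subset])
      have 1: "((\<lambda>z. blinfun_apply \<phi> (adj y * blinfun_apply (fst z) ?b)) \<longlongrightarrow> \<phi> (adj y * blinfun_apply (fst p) ?b)) ?F"
        using wconv_mult_left[OF predual bd cf] \<Phi>_subset[OF predual states faithful \<phi>]
        unfolding wconv_def by blast
      have 2: "((\<lambda>z. blinfun_apply \<phi> (adj y * blinfun_apply (fst z) (blinfun_apply (snd z) x - ?b))) \<longlongrightarrow> 0) ?F"
      proof (rule tendsto_state_zero[OF predual states faithful \<phi>])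
        have lim: "((\<lambda>z. sq \<phi> (blinfun_apply (snd z) x - ?b)) \<longlongrightarrow> 0) ?F"
          by (rule strong_convergence[OF cs ev2 snd_p \<phi>])
        show "((\<lambda>z. sq \<phi> (blinfun_apply (fst z) (blinfun_apply (snd z) x - ?b))) \<longlongrightarrow> 0) ?F"
        proof (rule tendsto_sandwich[OF _ _ tendsto_const lim])
          show "\<forall>\<^sub>F z in ?F. 0 \<le> sq \<phi> (blinfun_apply (fst z) (blinfun_apply (snd z) x - ?b))"
            using state_square(2)[OF predual states[rule_format, OF \<phi>]] by (intro always_eventually allI)
          show "\<forall>\<^sub>F z in ?F. sq \<phi> (blinfun_apply (fst z) (blinfun_apply (snd z) x - ?b)) \<le> sq \<phi> (blinfun_apply (snd z) x - ?b)"
            using ev1 by eventually_elim (rule sq_le[OF subsetD[OF kernel_subset] \<phi>])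
        qed
      qed
      have "blinfun_apply \<phi> (adj y * blinfun_apply (fst z) ?b) + \<phi> (adj y * blinfun_apply (fst z) (blinfun_apply (snd z) x - ?b))
          = \<phi> (adj y * blinfun_apply (fst z o\<^sub>L snd z) x)" for z
        by (simp add: blinfun.diff_right right_diff_distrib)
      then show "((\<lambda>z. blinfun_apply \<phi> (adj y * blinfun_apply (fst z o\<^sub>L snd z) x)) \<longlongrightarrow>
          \<phi> (adj y * blinfun_apply (fst p o\<^sub>L snd p) x)) ?F"
        using tendsto_add[OF 1 2] by simp
    qed
  qed
qed

lemma inverse_in_kernel: "T \<in> L \<Longrightarrow> inv\<^bsub>G\<^esub> T \<in> L"
  using group.inv_closed[OF group_kernel, of T] by simp

lemma comp_inverse: "T \<in> L \<Longrightarrow> T o\<^sub>L inv\<^bsub>G\<^esub> T = P"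
  using group.r_inv[OF group_kernel, of T] by simp

text \<open>Isometry gives \<open>q(T\<inverse> x - a\<inverse> x) = q(T (T\<inverse> x) - T (a\<inverse> x)) = q(a (a\<inverse> x) - T (a\<inverse> x))\<close>, and the right-hand side tends to \<open>0\<close>
as \<open>T\<close> tends to \<open>a\<close>.\<close>

lemma inverse_continuous:
  "continuous_map (subtopology W L) (subtopology W L) (\<lambda>T. inv\<^bsub>G\<^esub> T)"
proof (rule continuous_map_into_kernel)
  show "inv\<^bsub>G\<^esub> T \<in> L" if "T \<in> topspace (subtopology W L)" for T
    using that inverse_in_kernel unfolding topspace_kernel by blast
  show "continuous_map (subtopology W L) W (\<lambda>T. inv\<^bsub>G\<^esub> T)"
    unfolding continuous_map_weak_star_operator_topology topspace_kernel
  proof (intro conjI ballI allI)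
    show "inv\<^bsub>G\<^esub> T \<in> cblinfuns" if "T \<in> L" for T
      using inverse_in_kernel[OF that] kernel_subset complex_linear by blast
  next
    fix a x assume a: "a \<in> L"
    let ?F = "atin (subtopology W L) a" and ?c = "blinfun_apply (inv\<^bsub>G\<^esub> a) x"
    have ev: "\<forall>\<^sub>F T in ?F. T \<in> L" by (rule eventually_sub[OF kernel_subset])
    show "wconv N ?F (\<lambda>T. blinfun_apply (inv\<^bsub>G\<^esub> T) x) ?c"
    proof (rule wconv_if_states_converge[OF predual states faithful])
      show "\<forall>\<^sub>F T in ?F. norm (blinfun_apply (inv\<^bsub>G\<^esub> T) x) \<le> K * norm x"
        using ev by eventually_elim (rule norm_apply_le, rule subsetD[OF kernel_subset inverse_in_kernel])
      fix \<phi> y assume \<phi>: "\<phi> \<in> \<Phi>"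
      have lim: "((\<lambda>T. sq \<phi> (blinfun_apply T ?c - blinfun_apply a ?c)) \<longlongrightarrow> 0) ?F"
        by (rule strong_convergence[OF wconv_sub[OF a kernel_subset] ev a \<phi>])
      have "\<forall>\<^sub>F T in ?F. sq \<phi> (blinfun_apply T ?c - blinfun_apply a ?c) = sq \<phi> (blinfun_apply (inv\<^bsub>G\<^esub> T) x - ?c)"
        using ev
      proof eventually_elim
        case (elim T)
        let ?d = "?c - blinfun_apply (inv\<^bsub>G\<^esub> T) x"
        have id_app: "blinfun_apply S (blinfun_apply (inv\<^bsub>G\<^esub> S) x) = P x"
          and P_inv: "blinfun_apply P (blinfun_apply (inv\<^bsub>G\<^esub> S) x) = blinfun_apply (inv\<^bsub>G\<^esub> S) x" if "S \<in> L" for S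
          using arg_cong[OF comp_inverse[OF that], of "\<lambda>A. blinfun_apply A x"]
            arg_cong[OF left_unit[OF inverse_in_kernel[OF that]], of "\<lambda>A. blinfun_apply A x"] by simp_all
        have "blinfun_apply T ?c - blinfun_apply a ?c = T ?d"
          by (simp add: blinfun.diff_right id_app[OF a] id_app[OF elim])
        moreover have "blinfun_apply P ?d = ?d"
          by (simp add: blinfun.diff_right P_inv[OF a] P_inv[OF elim])
        ultimately have "sq \<phi> (blinfun_apply T ?c - blinfun_apply a ?c) = sq \<phi> ?d"
          using isometric_kernel[OF elim \<phi>, of ?d] by simp
        also have "adj ?d * ?d = adj (- ?d) * (- ?d)" by (simp only: adj_minus minus_mult_minus)
        also have "- ?d = blinfun_apply (inv\<^bsub>G\<^esub> T) x - ?c" by simp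
        finally show ?case .
      qed
      then have "((\<lambda>T. sq \<phi> (blinfun_apply (inv\<^bsub>G\<^esub> T) x - ?c)) \<longlongrightarrow> 0) ?F"
        by (rule Lim_transform_eventually[OF lim])
      from tendsto_state_zero[OF predual states faithful \<phi> this, of y]
      show "((\<lambda>T. blinfun_apply \<phi> (adj y * blinfun_apply (inv\<^bsub>G\<^esub> T) x)) \<longlongrightarrow> \<phi> (adj y * ?c)) ?F"
        unfolding right_diff_distrib blinfun.diff_right[of \<phi>] by (rule LIM_zero_cancel)
    qed
  qed
qed

lemma topological_group_kernel: "topological_group G (subtopology W L)"
  unfolding topological_group_def
proof (intro conjI)
  show "topspace (subtopology W L) = carrier G" by (simp only: topspace_kernel partial_object.simps)
  have "(\<lambda>(a, b). a \<otimes>\<^bsub>G\<^esub> b) = (\<lambda>p. fst p o\<^sub>L snd p)" by (simp add: fun_eq_iff)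
  then show "continuous_map (prod_topology (subtopology W L) (subtopology W L)) (subtopology W L) (\<lambda>(a, b). a \<otimes>\<^bsub>G\<^esub> b)"
    using comp_jointly_continuous by simp
qed (rule group_kernel inverse_continuous)+

section \<open>The decomposition\<close>

lemma idem_apply: "blinfun_apply P (P x) = P x"
  using idem by (metis blinfun_apply_blinfun_compose)

lemma central_apply: "T \<in> SS \<Longrightarrow> blinfun_apply P (T x) = T (P x)"
  using central by (metis blinfun_apply_blinfun_compose)

lemma range_iff: "x \<in> range (blinfun_apply P) \<longleftrightarrow> blinfun_apply P x = x"
proof
  assume "x \<in> range (blinfun_apply P)"
  then show "blinfun_apply P x = x" by (auto simp: idem_apply)
next
  assume "blinfun_apply P x = x"
  then have "x = P x" by simp
  then show "x \<in> range (blinfun_apply P)" by (rule range_eqI)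
qed

lemma decomposition: "direct_sum_decomposition (range (blinfun_apply P)) {x. blinfun_apply P x = 0}"
  unfolding direct_sum_decomposition_def
proof (intro conjI)
  have c: "blinfun_apply P (s *\<^sub>C x) = s *\<^sub>C P x" for s x
    using complex_linear[OF unit_in_SS] unfolding cblinfuns_def by blast
  show "csubspace (range (blinfun_apply P))"
    unfolding csubspace_def Ball_def range_iff by (simp add: c blinfun.add_right)
  show "csubspace {x. blinfun_apply P x = 0}"
    unfolding csubspace_def by (simp add: c blinfun.add_right)
  show "range (blinfun_apply P) \<inter> {x. blinfun_apply P x = 0} = {0}"
  proof -
    have "x \<in> range (blinfun_apply P) \<inter> {x. blinfun_apply P x = 0} \<longleftrightarrow> x \<in> {0}" for x
      unfolding Int_iff range_iff by auto
    then show ?thesis by blast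
  qed
  have "\<exists>v w. x = v + w \<and> v \<in> range (blinfun_apply P) \<and> blinfun_apply P w = 0" for x
    by (rule exI[of _ "P x"], rule exI[of _ "x - P x"]) (simp add: blinfun.diff_right idem_apply)
  then show "{v + w |v w. v \<in> range (blinfun_apply P) \<and> w \<in> {x. blinfun_apply P x = 0}} = UNIV"
    by blast
qed

lemma range_reversible:
  "range (blinfun_apply P) = {x. \<forall>S\<in>SS. \<exists>T\<in>SS. blinfun_apply T (blinfun_apply S x) = x}"
proof safe
  fix x S assume S: "S \<in> SS"
  obtain s where s: "s \<in> SS" "s o\<^sub>L (S o\<^sub>L P) = P" using left_inverse_SS[OF absorb[OF S]] by blast
  then have "blinfun_apply s (S (P x)) = P x" by (metis blinfun_apply_blinfun_compose)
  then show "\<exists>T\<in>SS. blinfun_apply T (S (P x)) = P x" using s(1) by blast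
next
  fix x assume "\<forall>S\<in>SS. \<exists>T\<in>SS. blinfun_apply T (S x) = x"
  then obtain T where T: "T \<in> SS" "blinfun_apply T (P x) = x" using unit_in_SS by blast
  then have "x = P (T x)" by (simp add: central_apply)
  then show "x \<in> range (blinfun_apply P)" by blast
qed

lemma state_eq_iff: "\<phi> \<in> \<Phi> \<Longrightarrow> blinfun_apply \<phi> (adj y * y) = \<phi> (adj x * x) \<longleftrightarrow> sq \<phi> y = sq \<phi> x"
  using state_square(1)[OF predual states[rule_format]] by metis

lemma range_if_isometric:
  assumes "\<And>\<phi>. \<phi> \<in> \<Phi> \<Longrightarrow> sq \<phi> (blinfun_apply P x) = sq \<phi> x"
  shows "x \<in> range (blinfun_apply P)"
proof -
  let ?z = "x - P x"
  have "?z = 0"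
  proof (rule eq_zero_if_states_eq_zero)
    fix \<phi> assume \<phi>: "\<phi> \<in> \<Phi>"
    have Pz: "blinfun_apply P ?z = 0" by (simp add: blinfun.diff_right idem_apply)
    have "blinfun_apply \<phi> (adj x * ?z) = 0"
      using isometric_at[OF unit_in_SS \<phi> assms[OF \<phi>], of ?z] by (simp only: Pz) simp
    moreover have "blinfun_apply \<phi> (adj (P x) * ?z) = 0"
      by (rule idempotent_orthogonal[OF unit_in_SS idem \<phi> Pz])
    ultimately show "blinfun_apply \<phi> (adj ?z * ?z) = 0"
      by (simp only: adj_diff left_diff_distrib blinfun.diff_right[of \<phi>] diff_self)
  qed
  then have "x = P x" by simp
  then show ?thesis by (rule range_eqI)
qed

lemma range_isometric:
  "range (blinfun_apply P) =
    {x. \<forall>T\<in>SS. \<forall>\<phi>\<in>\<Phi>. blinfun_apply \<phi> (adj (blinfun_apply T x) * T x) = \<phi> (adj x * x)}"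
proof (intro equalityI subsetI CollectI ballI)
  fix x T \<phi> assume "x \<in> range (blinfun_apply P)" "T \<in> SS" "\<phi> \<in> \<Phi>"
  then show "blinfun_apply \<phi> (adj (blinfun_apply T x) * T x) = \<phi> (adj x * x)"
    using isometric_on_range[of T \<phi> x] by (simp add: state_eq_iff range_iff)
next
  fix x assume "x \<in> {x. \<forall>T\<in>SS. \<forall>\<phi>\<in>\<Phi>. blinfun_apply \<phi> (adj (blinfun_apply T x) * T x) = \<phi> (adj x * x)}"
  then show "x \<in> range (blinfun_apply P)"
    using unit_in_SS by (intro range_if_isometric) simp
qed

lemma range_unitary:
  "range (blinfun_apply P) =
    {x. \<forall>T\<in>SS. \<forall>\<phi>\<in>\<Phi>. \<forall>y. blinfun_apply \<phi> (adj (blinfun_apply T x) * T y) = \<phi> (adj x * y)}"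
proof (intro equalityI subsetI CollectI ballI allI)
  fix x T \<phi> y assume x: "x \<in> range (blinfun_apply P)" and T: "T \<in> SS" and \<phi>: "\<phi> \<in> \<Phi>"
  have "sq \<phi> (blinfun_apply T x) = sq \<phi> x"
    using isometric_on_range[OF T \<phi>, of x] x by (simp add: range_iff)
  then show "blinfun_apply \<phi> (adj (blinfun_apply T x) * T y) = \<phi> (adj x * y)"
    by (rule isometric_at[OF T \<phi>])
next
  fix x assume "x \<in> {x. \<forall>T\<in>SS. \<forall>\<phi>\<in>\<Phi>. \<forall>y. blinfun_apply \<phi> (adj (blinfun_apply T x) * T y) = \<phi> (adj x * y)}"
  then show "x \<in> range (blinfun_apply P)"
    using unit_in_SS by (intro range_if_isometric) simp
qed

lemma kernel_union: "{x. blinfun_apply P x = 0} = (\<Union>T\<in>SS. {x. blinfun_apply T x = 0})"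
proof (intro equalityI subsetI)
  fix x assume "x \<in> {x. blinfun_apply P x = 0}"
  then show "x \<in> (\<Union>T\<in>SS. {x. blinfun_apply T x = 0})" using unit_in_SS by blast
next
  fix x assume "x \<in> (\<Union>T\<in>SS. {x. blinfun_apply T x = 0})"
  then obtain T where T: "T \<in> SS" "blinfun_apply T x = 0" by blast
  obtain s where s: "s \<in> SS" "s o\<^sub>L (T o\<^sub>L P) = P" using left_inverse_SS[OF absorb[OF T(1)]] by blast
  have "blinfun_apply T (P x) = 0" using central_apply[OF T(1), of x] T(2) by simp
  then have "blinfun_apply (s o\<^sub>L (T o\<^sub>L P)) x = 0" by simp
  then show "x \<in> {x. blinfun_apply P x = 0}" using s(2) by simp
qed

lemma kernel_orbit: "{x. blinfun_apply P x = 0} = {x. 0 \<in> {blinfun_apply T x |T. T \<in> SS}}"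
proof -
  have "0 \<in> {blinfun_apply T x |T. T \<in> SS} \<longleftrightarrow> x \<in> (\<Union>T\<in>SS. {x. blinfun_apply T x = 0})" for x
    unfolding mem_Collect_eq UN_iff by metis
  then show ?thesis unfolding kernel_union by blast
qed

lemma compact_kernel: "compact_space (subtopology W L)"
proof -
  have "closedin W L"
    using kernel_closed compactin_imp_closedin[OF Hausdorff_W compactin_SS] by (rule closedin_trans_full)
  then have "compactin W L" by (rule closed_compactin[OF compactin_SS kernel_subset])
  then show ?thesis by (simp only: compactin_subspace)
qed

end

end

section \<open>The closure of the given semigroup\<close>

text \<open>Closedness under composition passes to the closure in two steps, first in the right factor with the left one in the given
semigroup, then in the left factor.\<close>

lemma contraction_semigroup_closure:
  fixes N \<Phi> :: "('a::cstar_algebra \<Rightarrow>\<^sub>L complex) set" and \<S> :: "('a \<Rightarrow>\<^sub>L 'a) set"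
  assumes N: "predual N" and \<Phi>: "\<forall>\<phi>\<in>\<Phi>. normal_state N \<phi>" and faith: "faithful \<Phi>"
    and ne: "\<S> \<noteq> {}" and K: "\<And>T. T \<in> \<S> \<Longrightarrow> norm T \<le> K"
    and contr: "\<And>T. T \<in> \<S> \<Longrightarrow> state_contraction \<Phi> T"
    and comp: "\<And>S T. S \<in> \<S> \<Longrightarrow> T \<in> \<S> \<Longrightarrow> S o\<^sub>L T \<in> \<S>"
  shows "contraction_semigroup N \<Phi> (weak_star_operator_topology N closure_of \<S>) K"
proof
  let ?W = "weak_star_operator_topology N" and ?Q = "{T. norm T \<le> K \<and> state_contraction \<Phi> T}"
  let ?SS = "?W closure_of \<S>"
  have compQ: "compactin ?W ?Q" by (rule compact_state_contractions[OF N \<Phi> faith])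
  have sub: "\<S> \<subseteq> ?Q" using K contr by blast
  have closQ: "closedin ?W ?Q"
    by (rule compactin_imp_closedin[OF Hausdorff_weak_star_operator_topology[OF N] compQ])
  have SSQ: "?SS \<subseteq> ?Q" by (rule closure_of_minimal[OF sub closQ])
  have SSclosed: "closedin ?W ?SS" by (rule closedin_closure_of)
  have \<S>c: "\<S> \<subseteq> cblinfuns" and Qc: "?Q \<subseteq> cblinfuns" using contr by (auto simp: state_contraction_def)
  have incl: "\<S> \<subseteq> ?SS" by (rule closure_of_subset) (simp add: \<S>c)
  show compSS: "compactin ?W ?SS" by (rule closed_compactin[OF compQ SSQ SSclosed])
  show "?SS \<noteq> {}" using incl ne by blast
  show "norm T \<le> K" "state_contraction \<Phi> T" if "T \<in> ?SS" for T using SSQ that by auto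
  show "S o\<^sub>L T \<in> ?SS" if ST: "S \<in> ?SS" "T \<in> ?SS" for S T
  proof -
    have topQ: "topspace (subtopology ?W ?Q) = ?Q" using Qc by auto
    have step: "f R \<in> ?SS" if f: "continuous_map (subtopology ?W ?Q) ?W f" and \<S>: "\<And>R. R \<in> \<S> \<Longrightarrow> f R \<in> ?SS"
      and R: "R \<in> ?SS" for f R
    proof -
      have "closedin (subtopology ?W ?Q) {R \<in> topspace (subtopology ?W ?Q). f R \<in> ?SS}"
        by (rule closedin_continuous_map_preimage[OF f SSclosed])
      then have "closedin ?W {R \<in> ?Q. f R \<in> ?SS}"
        using closQ unfolding topQ by (rule closedin_trans_full)
      then have "?SS \<subseteq> {R \<in> ?Q. f R \<in> ?SS}"
        by (intro closure_of_minimal) (use sub \<S> in auto)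
      then show ?thesis using R by blast
    qed
    have left: "continuous_map (subtopology ?W ?Q) ?W (\<lambda>T. R o\<^sub>L T)" if R: "state_contraction \<Phi> R" for R
      by (rule continuous_comp_left[OF N \<Phi> faith R Qc, where K = K]) simp
    have 1: "R o\<^sub>L T \<in> ?SS" if R: "R \<in> \<S>" for R
      by (rule step[OF left[OF contr[OF R]] _ ST(2)]) (use comp[OF R] incl in blast)
    have "T \<in> cblinfuns" using ST(2) SSQ Qc by blast
    from continuous_comp_right[OF Qc this]
    show ?thesis by (rule step[OF _ 1 ST(1)])
  qed
qed (use N \<Phi> faith in auto)

theorem theorem1p2:
  fixes N :: "('a::cstar_algebra \<Rightarrow>\<^sub>L complex) set"
    and \<S> SS :: "('a \<Rightarrow>\<^sub>L 'a) set"
    and \<Phi> :: "('a \<Rightarrow>\<^sub>L complex) set"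
  assumes "predual N"
    and "operator_semigroup \<S>" and "\<S> \<noteq> {}" and "bounded \<S>"
    and "\<S> \<subseteq> weak_star_continuous_operators N"
    and "\<forall>\<phi>\<in>\<Phi>. normal_state N \<phi>" and "faithful \<Phi>"
    and "\<forall>x. \<forall>S\<in>\<S>. \<forall>\<phi>\<in>\<Phi>. \<phi> (adj (S x) * S x) \<le> \<phi> (adj x * x)"
  defines "SS \<equiv> weak_star_operator_topology N closure_of \<S>"
  shows "compact_space (subtopology (weak_star_operator_topology N) SS) \<and>
    Hausdorff_space (subtopology (weak_star_operator_topology N) SS) \<and>
    semitopological_semigroup (subtopology (weak_star_operator_topology N) SS) (o\<^sub>L) \<and>
    (\<exists>M P.
      minimal_ideal SS M \<and> (\<forall>M'. minimal_ideal SS M' \<longrightarrow> M' = M) \<and>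
      compact_space (subtopology (weak_star_operator_topology N) M) \<and>
      Hausdorff_space (subtopology (weak_star_operator_topology N) M) \<and>
      topological_group \<lparr>carrier = M, mult = (o\<^sub>L), one = P\<rparr>
        (subtopology (weak_star_operator_topology N) M) \<and>
      P o\<^sub>L P = P \<and>
      (\<exists>A\<^sub>r A\<^sub>s.
        direct_sum_decomposition A\<^sub>r A\<^sub>s \<and>
        range P = A\<^sub>r \<and>
        A\<^sub>r = {x. \<forall>S\<in>SS. \<exists>T\<in>SS. T (S x) = x} \<and>
        A\<^sub>r = {x. \<forall>T\<in>SS. \<forall>\<phi>\<in>\<Phi>. \<phi> (adj (T x) * T x) = \<phi> (adj x * x)} \<and>
        A\<^sub>r = {x. \<forall>T\<in>SS. \<forall>\<phi>\<in>\<Phi>. \<forall>y. \<phi> (adj (T x) * T y) = \<phi> (adj x * y)} \<and>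
        {x. P x = 0} = A\<^sub>s \<and>
        A\<^sub>s = {x. 0 \<in> {blinfun_apply T x |T. T \<in> SS}} \<and>
        A\<^sub>s = {x. 0 \<in> weak_star_topology N closure_of {blinfun_apply T x |T. T \<in> SS}} \<and>
        A\<^sub>s = (\<Union>T\<in>SS. {x. blinfun_apply T x = 0})))"
proof -
  obtain K where K: "\<And>T. T \<in> \<S> \<Longrightarrow> norm T \<le> K"
    using \<open>bounded \<S>\<close> unfolding bounded_iff by blast
  have contr: "state_contraction \<Phi> T" if "T \<in> \<S>" for T
    using that assms(2,8) unfolding state_contraction_def operator_semigroup_def less_eq_complex_def by blast
  interpret contraction_semigroup N \<Phi> SS K
    unfolding SS_def using assms(2) K contr
    by (intro contraction_semigroup_closure assms) (auto simp: operator_semigroup_def)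
  obtain M P where k: "is_kernel M P" using kernel_exists by blast
  have orbit: "{x. blinfun_apply P x = 0} =
      {x. 0 \<in> weak_star_topology N closure_of {blinfun_apply T x |T. T \<in> SS}}"
    unfolding orbit_closed by (rule kernel_orbit[OF k])
  have "compact_space (subtopology W SS)" using compactin_SS by (simp add: compactin_subspace)
  moreover have "Hausdorff_space (subtopology W S)" for S
    by (rule Hausdorff_space_subtopology[OF Hausdorff_W])
  moreover note semitopological
  moreover have "\<exists>A\<^sub>r A\<^sub>s.
        direct_sum_decomposition A\<^sub>r A\<^sub>s \<and>
        range P = A\<^sub>r \<and>
        A\<^sub>r = {x. \<forall>S\<in>SS. \<exists>T\<in>SS. T (S x) = x} \<and>
        A\<^sub>r = {x. \<forall>T\<in>SS. \<forall>\<phi>\<in>\<Phi>. \<phi> (adj (T x) * T x) = \<phi> (adj x * x)} \<and>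
        A\<^sub>r = {x. \<forall>T\<in>SS. \<forall>\<phi>\<in>\<Phi>. \<forall>y. \<phi> (adj (T x) * T y) = \<phi> (adj x * y)} \<and>
        {x. P x = 0} = A\<^sub>s \<and>
        A\<^sub>s = {x. 0 \<in> {blinfun_apply T x |T. T \<in> SS}} \<and>
        A\<^sub>s = {x. 0 \<in> weak_star_topology N closure_of {blinfun_apply T x |T. T \<in> SS}} \<and>
        A\<^sub>s = (\<Union>T\<in>SS. {x. blinfun_apply T x = 0})"
    by (intro exI conjI, rule decomposition[OF k], rule refl, rule range_reversible[OF k],
        rule range_isometric[OF k], rule range_unitary[OF k], rule refl, rule kernel_orbit[OF k],
        rule orbit, rule kernel_union[OF k])
  moreover have "P o\<^sub>L P = P" using k unfolding is_kernel_def by blast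
  ultimately show ?thesis
    using minimal_ideal_kernel[OF k] minimal_ideal_unique[OF k] compact_kernel[OF k]
      topological_group_kernel[OF k] by (intro conjI exI[of _ M] exI[of _ P]) (assumption | blast)+
qed

end
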